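(* Let $\mu(dx)=e^{-V(x)}dx$ and $\nu(dy)=e^{-W(y)}dy$ be probability measures with $V:\mathbb{R}^n\to\mathbb{R}$, $W:\mathbb{R}^n\to\mathbb{R}\cup\{+\infty\}$ such that $D^2V\le\alpha_V I_n$ and $D^2W\ge\beta_W I_n$ with $\alpha_V,\beta_W>0$. Let $a,b:\mathbb{R}^n\to\mathbb{R}$ be Lipschitz with constants $L_a,L_b$, and let $\mu_a,\nu_b$ be the probability measures with densities proportional to $e^{-(a+V)}$ and $e^{-(b+W)}$. Then the Kantorovich potential $\phi_{a,b}$ for the transport of $\mu_a$ onto $\nu_b$ is $\sigma_{a,b}$-smooth with \[ \sigma_{a,b}(r)=\int_0^r\Big(\sqrt{\tfrac{4L_b^2}{\beta_W^2}+\tfrac{4L_a}{\beta_W}s+\tfrac{\alpha_V}{\beta_W}s^2}+\tfrac{2L_b}{\beta_W}\Big)ds,\qquad r\ge0, \] and the Brenier map $T_{a,b}$ sending $\mu_a$ onto $\nu_b$ satisfies \[ |T_{a,b}(x)-T_{a,b}(y)|\le\frac{4L_b}{\beta_W}+4\sqrt{\frac{L_b^2}{\beta_W^2}+\frac{L_a}{\beta_W}|x-y|}+\sqrt{\frac{\alpha_V}{\beta_W}}|x-y|,\qquad\forall x,y\in\mathbb{R}^n. \]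
   Context: A function $f$ is $\sigma$-smooth if $f((1-t)x_0+tx_1)+t(1-t)\sigma(|x_1-x_0|)\ge(1-t)f(x_0)+tf(x_1)$ for all $t\in(0,1)$ and $x_0,x_1$ with $(1-t)x_0+tx_1\in\mathrm{dom} f$. A Kantorovich potential is a lower semicontinuous convex $\phi$ with $\int\phi\,d\mu_a+\int\phi^*d\nu_b=\sup_\pi\iint\langle x,y\rangle d\pi$ over couplings; the Brenier map is $T_{a,b}=\nabla\phi_{a,b}$. *)

theory Defs
  imports "HOL-Analysis.Analysis"
begin

definition expm_ereal :: "ereal \<Rightarrow> real" where
  "expm_ereal w = (if w = \<infinity> then 0 else exp (- real_of_ereal w))"

definition edom :: "('a \<Rightarrow> ereal) \<Rightarrow> 'a set" where
  "edom f = {x. f x < \<infinity>}"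

definition sigma_smooth :: "(real \<Rightarrow> real) \<Rightarrow> ('a::real_normed_vector \<Rightarrow> ereal) \<Rightarrow> bool" where
  "sigma_smooth \<sigma> f \<longleftrightarrow>
     (\<forall>t x0 x1. 0 < t \<and> t < 1 \<and> (1 - t) *\<^sub>R x0 + t *\<^sub>R x1 \<in> edom f \<longrightarrow>
        f ((1 - t) *\<^sub>R x0 + t *\<^sub>R x1) + ereal (t * (1 - t) * \<sigma> (norm (x1 - x0)))
          \<ge> ereal (1 - t) * f x0 + ereal t * f x1)"

definition ereal_convex :: "('a::real_vector \<Rightarrow> ereal) \<Rightarrow> bool" where
  "ereal_convex f \<longleftrightarrow> (\<forall>t x y. 0 \<le> t \<and> t \<le> 1 \<longrightarrow>
      f ((1 - t) *\<^sub>R x + t *\<^sub>R y) \<le> ereal (1 - t) * f x + ereal t * f y)"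

definition ereal_lsc :: "('a::topological_space \<Rightarrow> ereal) \<Rightarrow> bool" where
  "ereal_lsc f \<longleftrightarrow> (\<forall>c. closed {x. f x \<le> c})"

definition ereal_proper :: "('a \<Rightarrow> ereal) \<Rightarrow> bool" where
  "ereal_proper f \<longleftrightarrow> (\<forall>x. f x \<noteq> -\<infinity>) \<and> (\<exists>x. f x \<noteq> \<infinity>)"

definition fconj :: "('a::real_inner \<Rightarrow> ereal) \<Rightarrow> 'a \<Rightarrow> ereal" where
  "fconj f y = (SUP x. ereal (inner x y) - f x)"

definition coupling :: "('a::euclidean_space \<times> 'a) measure \<Rightarrow> 'a measure \<Rightarrow> 'a measure \<Rightarrow> bool" where
  "coupling \<pi> \<mu> \<nu> \<longleftrightarrow> sets \<pi> = sets borel \<and> distr \<pi> borel fst = \<mu> \<and> distr \<pi> borel snd = \<nu>"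

text \<open>Kantorovich potential (for the quadratic cost written as the correlation maximisation):
  a proper lsc convex phi such that phi is mu-integrable, phi* is nu-integrable and
  int phi dmu + int phi* dnu = sup over couplings of int <x,y> dpi.\<close>
definition kantorovich_potential :: "'a::euclidean_space measure \<Rightarrow> 'a measure \<Rightarrow> ('a \<Rightarrow> ereal) \<Rightarrow> bool" where
  "kantorovich_potential \<mu> \<nu> \<phi> \<longleftrightarrow>
     ereal_convex \<phi> \<and> ereal_lsc \<phi> \<and> ereal_proper \<phi> \<and>
     (AE x in \<mu>. \<phi> x \<noteq> \<infinity>) \<and> integrable \<mu> (\<lambda>x. real_of_ereal (\<phi> x)) \<and>
     (AE y in \<nu>. \<bar>fconj \<phi> y\<bar> \<noteq> \<infinity>) \<and> integrable \<nu> (\<lambda>y. real_of_ereal (fconj \<phi> y)) \<and>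
     ereal ((\<integral>x. real_of_ereal (\<phi> x) \<partial>\<mu>) + (\<integral>y. real_of_ereal (fconj \<phi> y) \<partial>\<nu>))
       = (SUP \<pi> \<in> {\<pi>. coupling \<pi> \<mu> \<nu> \<and> integrable \<pi> (\<lambda>(x, y). inner x y)}.
            ereal (\<integral>z. (case z of (x, y) \<Rightarrow> inner x y) \<partial>\<pi>))"

definition normalized_density :: "('a::euclidean_space \<Rightarrow> real) \<Rightarrow> 'a measure" where
  "normalized_density f = density lborel (\<lambda>x. ennreal (f x / (\<integral>y. f y \<partial>lborel)))"

definition sigma_ab :: "real \<Rightarrow> real \<Rightarrow> real \<Rightarrow> real \<Rightarrow> real \<Rightarrow> real" where
  "sigma_ab La Lb \<alpha>V \<beta>W r =
     integral {0..r} (\<lambda>s. sqrt (4 * Lb\<^sup>2 / \<beta>W\<^sup>2 + 4 * La / \<beta>W * s + \<alpha>V / \<beta>W * s\<^sup>2) + 2 * Lb / \<beta>W)"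

end

theory Submission
  imports Defs "HOL-Complex_Analysis.Great_Picard"
begin

text \<open>
  The potential is obtained as a limit of entropic potentials. For \<open>e > 0\<close>, if \<open>f\<close> is smooth with modulus \<open>\<sigma>\<close>, then
  Hoelder's inequality turns this into convexity of \<open>y \<mapsto> e ln (\<integral> exp ((x \<bullet> y - f x) / e) d\<mu>)\<close>, and the
  Prekopa-Leindler inequality turns the latter back into smoothness of the Sinkhorn iterate of \<open>f\<close>. The modulus
  \<open>\<sigma>\<close> is reproduced exactly when its slope \<open>s\<close> at \<open>r\<close> satisfies \<open>\<beta> s\<^sup>2 / 2 - 2 Lb s = \<alpha> r\<^sup>2 / 2 + 2 La r\<close>.
  A minimiser of the entropic dual functional over the compact set of smooth functions is a fixed point of the
  iteration, because the iteration strictly decreases the functional elsewhere; so it is an entropic potential.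
  To make this well-posed, \<open>\<mu>\<close> is damped by a Gaussian factor and \<open>\<nu>\<close> is restricted to a ball.
  As all the parameters are relaxed, the entropic potentials converge to a smooth convex \<open>g\<close>. A nearly optimal coupling is
  concentrated on pairs \<open>(x, y)\<close> for which \<open>y\<close> is nearly a subgradient at \<open>x\<close> of both \<open>g\<close> and the given potential, and
  two convex functions with a common subgradient at each point differ by a constant. The bound on the Brenier map
  follows from smoothness and convexity by cocoercivity of the gradient.
\<close>

section \<open>The Prekopa-Leindler inequality\<close>

text \<open>The guiding computation is Legendre duality of moduli. One iteration turns the
  smoothness modulus \<open>\<sigma>\<close> into the convexity modulus given by the supremum over r
  of \<open>r * s - \<sigma> r - e * \<kappa> r\<close>, adds \<open>e * \<rho> s\<close>, and takes
  the conjugate of the sum. At the r where \<open>\<sigma>\<close> has slope s, the conjugate of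
  \<open>\<sigma>\<close> is reduced by at most \<open>e * \<kappa> r\<close>, so
  \<open>\<sigma>\<close> survives once \<open>\<rho> s = \<kappa> r\<close>. The factor e cancels:
  the modulus is uniform in e, and \<open>sigma_ab\<close> is the integral of a root of a quadratic
  equation. The shaping obstacle is that the given potential has no regularity that could be
  differentiated. Entropic potentials are logarithms of integrals, to which integral inequalities
  apply. Minimising inside the smooth class yields a smooth fixed point at once, without a
  convergence analysis of the iteration. Damping provides the exponential moments that make the
  logarithms finite; the ball provides one Lipschitz constant for all iterates, hence compactness.
  Since the given potential is arbitrary, smoothness must be transferred to it, which is why
  uniqueness up to constants is proved.\<close>

lemma emeasure_lborel_affine_vimage:
  fixes A :: "real set"
  assumes [measurable]: "A \<in> sets borel" and c: "c > 0"
  shows "emeasure lborel {x. (x - d) / c \<in> A} = ennreal c * emeasure lborel A"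
proof -
  have "emeasure lborel A = (\<integral>\<^sup>+x. indicator A x \<partial>lborel)" by simp
  also have "\<dots> = \<bar>1/c\<bar> * (\<integral>\<^sup>+x. indicator A (- d / c + (1/c) * x) \<partial>lborel)"
    by (rule nn_integral_real_affine) (use c in auto)
  also have "(\<lambda>x. indicator A (- d / c + (1/c) * x) :: ennreal) = indicator {x. (x - d) / c \<in> A}"
    using c by (auto simp: fun_eq_iff indicator_def field_simps)
  also have "(\<integral>\<^sup>+x. indicator {x. (x - d) / c \<in> A} x \<partial>lborel) = emeasure lborel {x. (x - d) / c \<in> A}"
    by (rule nn_integral_indicator) measurable
  finally have "ennreal c * emeasure lborel A = ennreal c * (ennreal \<bar>1/c\<bar> * emeasure lborel {x. (x - d) / c \<in> A})"
    by simp
  also have "\<dots> = emeasure lborel {x. (x - d) / c \<in> A}"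
    using c by (simp add: mult.assoc[symmetric] ennreal_mult'[symmetric])
  finally show ?thesis by simp
qed

text \<open>Translates of \<open>(1 - t) A\<close> and \<open>t B\<close> by a nearly minimal element of \<open>t B\<close> and a nearly maximal element of
  \<open>(1 - t) A\<close> lie in \<open>C\<close> and overlap in an interval of length at most \<open>e\<close>.\<close>

lemma brunn_minkowski_real:
  fixes A B C :: "real set"
  assumes [measurable]: "A \<in> sets borel" "B \<in> sets borel" "C \<in> sets borel"
    and bdd: "bounded A" "bounded B" and ne: "A \<noteq> {}" "B \<noteq> {}" and t: "0 < t" "t < 1"
    and sub: "\<And>x y. x \<in> A \<Longrightarrow> y \<in> B \<Longrightarrow> (1 - t) * x + t * y \<in> C"
  shows "ennreal (1 - t) * emeasure lborel A + ennreal t * emeasure lborel B \<le> emeasure lborel C"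
proof (rule ennreal_le_epsilon)
  fix e :: real assume e: "e > 0"
  have bA: "bdd_above A" and bB: "bdd_below B"
    using bdd by (auto simp: bounded_imp_bdd_above bounded_imp_bdd_below)
  obtain a where a: "a \<in> A" "Sup A - e < a"
    using less_cSup_iff[OF ne(1) bA, of "Sup A - e"] e by auto
  obtain b where b: "b \<in> B" "b < Inf B + e"
    using cInf_less_iff[OF ne(2) bB, of "Inf B + e"] e by auto
  define A1 where "A1 = {x. (x - t * b) / (1 - t) \<in> A}"
  define B1 where "B1 = {x. (x - (1 - t) * a) / t \<in> B}"
  have [measurable]: "A1 \<in> sets borel" "B1 \<in> sets borel" unfolding A1_def B1_def by measurable
  have "A1 \<subseteq> C"
  proof
    fix x assume "x \<in> A1"
    then have "(1 - t) * ((x - t * b) / (1 - t)) + t * b \<in> C" using b sub unfolding A1_def by blast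
    moreover have "(1 - t) * ((x - t * b) / (1 - t)) + t * b = x" using t by simp
    ultimately show "x \<in> C" by metis
  qed
  moreover have "B1 \<subseteq> C"
  proof
    fix x assume "x \<in> B1"
    then have "(1 - t) * a + t * ((x - (1 - t) * a) / t) \<in> C" using a sub unfolding B1_def by blast
    moreover have "(1 - t) * a + t * ((x - (1 - t) * a) / t) = x" using t by simp
    ultimately show "x \<in> C" by metis
  qed
  ultimately have U: "emeasure lborel (A1 \<union> B1) \<le> emeasure lborel C"
    by (intro emeasure_mono) auto
  have "A1 \<inter> B1 \<subseteq> {(1 - t) * a + t * Inf B .. (1 - t) * Sup A + t * b}"
  proof
    fix x assume x: "x \<in> A1 \<inter> B1"
    then have "(x - t * b) / (1 - t) \<le> Sup A" "Inf B \<le> (x - (1 - t) * a) / t"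
      using bA bB by (auto simp: A1_def B1_def intro: cSup_upper cInf_lower)
    then show "x \<in> {(1 - t) * a + t * Inf B .. (1 - t) * Sup A + t * b}"
      using t by (auto simp: field_simps)
  qed
  then have "emeasure lborel (A1 \<inter> B1) \<le> emeasure lborel {(1 - t) * a + t * Inf B .. (1 - t) * Sup A + t * b}"
    by (intro emeasure_mono) auto
  also have "\<dots> \<le> ennreal e"
  proof -
    have "(1 - t) * (Sup A - a) + t * (b - Inf B) \<le> (1 - t) * e + t * e"
      using a b t by (intro add_mono mult_left_mono) auto
    then have "(1 - t) * Sup A + t * b - ((1 - t) * a + t * Inf B) \<le> e"
      by (simp add: algebra_simps)
    then show ?thesis using e
      by (cases "(1 - t) * a + t * Inf B \<le> (1 - t) * Sup A + t * b") (auto intro!: ennreal_leI)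
  qed
  finally have I: "emeasure lborel (A1 \<inter> B1) \<le> ennreal e" .
  have "ennreal (1 - t) * emeasure lborel A + ennreal t * emeasure lborel B
      = emeasure lborel A1 + emeasure lborel B1"
    unfolding A1_def B1_def using t by (simp add: emeasure_lborel_affine_vimage)
  also have "\<dots> = emeasure lborel (A1 \<union> B1) + emeasure lborel (A1 \<inter> B1)"
    by (rule emeasure_Un_Int) auto
  also have "\<dots> \<le> emeasure lborel C + ennreal e" by (intro add_mono U I)
  finally show "ennreal (1 - t) * emeasure lborel A + ennreal t * emeasure lborel B \<le> emeasure lborel C + ennreal e" .
qed

lemma nn_integral_layer_cake_unit:
  fixes u :: "real \<Rightarrow> real"
  assumes [measurable]: "u \<in> borel_measurable borel" and u: "\<And>x. 0 \<le> u x" "\<And>x. u x \<le> 1"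
  shows "(\<integral>\<^sup>+l. indicator {0<..<1} l * emeasure lborel {x. l < u x} \<partial>lborel) = (\<integral>\<^sup>+x. ennreal (u x) \<partial>lborel)"
proof -
  have "(\<integral>\<^sup>+l. indicator {0<..<1} l * emeasure lborel {x. l < u x} \<partial>lborel)
     = (\<integral>\<^sup>+l. \<integral>\<^sup>+x. indicator {0<..<1} l * indicator {x. l < u x} x \<partial>lborel \<partial>lborel)"
    by (intro nn_integral_cong) (simp add: nn_integral_cmult)
  also have "\<dots> = (\<integral>\<^sup>+x. \<integral>\<^sup>+l. indicator {0<..<1} l * indicator {x. l < u x} x \<partial>lborel \<partial>lborel)"
  proof (rule lborel_pair.Fubini')
    show "(\<lambda>(x, l). indicator {0<..<1} l * indicator {x. l < u x} x :: ennreal) \<in> borel_measurable (lborel \<Otimes>\<^sub>M lborel)"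
      unfolding indicator_def by measurable
  qed
  also have "\<dots> = (\<integral>\<^sup>+x. emeasure lborel {0<..<u x} \<partial>lborel)"
  proof (rule nn_integral_cong)
    fix x
    have "(\<lambda>l. indicator {0<..<1} l * indicator {x. l < u x} x :: ennreal) = indicator {0<..<u x}"
      using u[of x] by (auto simp: fun_eq_iff indicator_def)
    then show "(\<integral>\<^sup>+l. indicator {0<..<1} l * indicator {x. l < u x} x \<partial>lborel) = emeasure lborel {0<..<u x}"
      by simp
  qed
  also have "\<dots> = (\<integral>\<^sup>+x. ennreal (u x) \<partial>lborel)" using u by simp
  finally show ?thesis .
qed

text \<open>Dividing f and g by their suprema \<open>a\<close> and \<open>b\<close> makes their
  superlevel sets non-empty for the same levels in (0,1), as \<open>brunn_minkowski_real\<close>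
  demands. Integrating over the levels gives a bound with an arithmetic mean, and the weighted AM-GM
  inequality turns it into the geometric one. \<open>h\<close> takes values in
  \<open>ennreal\<close> because the induction on the dimension feeds in partial integrals that may
  be infinite.\<close>

lemma prekopa_leindler_real:
  fixes f g :: "real \<Rightarrow> real" and h :: "real \<Rightarrow> ennreal"
  assumes [measurable]: "f \<in> borel_measurable borel" "g \<in> borel_measurable borel" "h \<in> borel_measurable borel"
    and f: "\<And>x. 0 \<le> f x" "\<And>x. f x \<le> K" "\<And>x. \<bar>x\<bar> > K \<Longrightarrow> f x = 0"
    and g: "\<And>x. 0 \<le> g x" "\<And>x. g x \<le> K" "\<And>x. \<bar>x\<bar> > K \<Longrightarrow> g x = 0"
    and t: "0 < t" "t < 1"
    and le: "\<And>x y. ennreal (f x powr (1 - t) * g y powr t) \<le> h ((1 - t) * x + t * y)"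
  shows "ennreal ((LINT x|lborel. f x) powr (1 - t) * (LINT x|lborel. g x) powr t) \<le> (\<integral>\<^sup>+x. h x \<partial>lborel)"
proof -
  define F where "F = (LINT x|lborel. f x)"
  define G where "G = (LINT x|lborel. g x)"
  have int: "integrable lborel u" if "u \<in> borel_measurable borel" "\<And>x. 0 \<le> u x" "\<And>x. u x \<le> K" "\<And>x. \<bar>x\<bar> > K \<Longrightarrow> u x = 0" for u :: "real \<Rightarrow> real"
  proof (rule Bochner_Integration.integrable_bound)
    show "integrable lborel (\<lambda>x. K * indicator {-K..K} x :: real)"
      by (intro integrable_mult_right integrable_real_indicator) (auto simp: emeasure_lborel_Icc_eq)
    show "u \<in> borel_measurable lborel" using that by simp
    show "AE x in lborel. norm (u x) \<le> norm (K * indicator {-K..K} x)"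
      using that by (intro AE_I2) (force simp: indicator_def abs_le_iff not_le)
  qed
  have nn: "(\<integral>\<^sup>+x. ennreal (f x) \<partial>lborel) = ennreal F" "(\<integral>\<^sup>+x. ennreal (g x) \<partial>lborel) = ennreal G"
    unfolding F_def G_def using int[of f] int[of g] assms(1,2) f g by (simp_all add: nn_integral_eq_integral)
  have FG: "F \<ge> 0" "G \<ge> 0" unfolding F_def G_def using f(1) g(1) by (auto intro: integral_nonneg_AE)
  show ?thesis
  proof (cases "F = 0 \<or> G = 0")
    case True
    then show ?thesis by (auto simp: F_def[symmetric] G_def[symmetric])
  next
    case False
    then have FG: "F > 0" "G > 0" using FG by auto
    define a where "a = Sup (range f)"
    define b where "b = Sup (range g)"
    have bd: "bdd_above (range f)" "bdd_above (range g)" using f g by (auto intro!: bdd_aboveI)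
    have fa: "f x \<le> a" and gb: "g x \<le> b" for x
      unfolding a_def b_def using bd by (auto intro: cSup_upper)
    have "\<exists>x. f x \<noteq> 0" using FG unfolding F_def by (metis integral_zero less_irrefl ext)
    then have a: "a > 0" using f fa by (metis less_le_trans order_le_less)
    have "\<exists>x. g x \<noteq> 0" using FG unfolding G_def by (metis integral_zero less_irrefl ext)
    then have b: "b > 0" using g gb by (metis less_le_trans order_le_less)
    define c where "c = a powr (1 - t) * b powr t"
    have c: "c > 0" using a b by (simp add: c_def)
    \<comment> \<open>Cutting \<open>h / c\<close> at 1 loses nothing at levels below 1 and makes
      the layer cake formula applicable.\<close>
    define uh where "uh x = enn2real (min 1 (h x / ennreal c))" for x
    have [measurable]: "uh \<in> borel_measurable borel" unfolding uh_def by measurable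
    have fin: "min 1 (h x / ennreal c) \<le> 1" for x by simp
    have uh: "0 \<le> uh x" "uh x \<le> 1" "ennreal (uh x) = min 1 (h x / ennreal c)" for x
      unfolding uh_def using fin[of x] by (auto simp: enn2real_leI top.extremum_unique intro!: ennreal_enn2real le_less_trans[OF fin])
    have key: "ennreal (1 - t) * emeasure lborel {x. l < f x / a} + ennreal t * emeasure lborel {x. l < g x / b}
        \<le> emeasure lborel {x. l < uh x}" if l: "0 < l" "l < 1" for l
    proof (rule brunn_minkowski_real)
      have "bounded {-K..K}" by simp
      moreover have "{x. l < f x / a} \<subseteq> {-K..K}"
      proof
        fix x assume "x \<in> {x. l < f x / a}"
        then have "f x \<noteq> 0" using l by auto
        then show "x \<in> {-K..K}" using f(3)[of x] by (cases "K < \<bar>x\<bar>") (auto simp: abs_le_iff not_less)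
      qed
      moreover have "{x. l < g x / b} \<subseteq> {-K..K}"
      proof
        fix x assume "x \<in> {x. l < g x / b}"
        then have "g x \<noteq> 0" using l by auto
        then show "x \<in> {-K..K}" using g(3)[of x] by (cases "K < \<bar>x\<bar>") (auto simp: abs_le_iff not_less)
      qed
      ultimately show "bounded {x. l < f x / a}" "bounded {x. l < g x / b}"
        using bounded_subset by blast+
      have "l * a < a" "l * b < b" using a b l by auto
      then have "\<exists>x. l * a < f x" "\<exists>x. l * b < g x"
        unfolding a_def b_def using less_cSup_iff[OF _ bd(1)] less_cSup_iff[OF _ bd(2)] by auto
      then show "{x. l < f x / a} \<noteq> {}" "{x. l < g x / b} \<noteq> {}" using a b by (auto simp: field_simps)
      fix x y assume "x \<in> {x. l < f x / a}" "y \<in> {x. l < g x / b}"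
      then have xy: "l < f x / a" "l < g y / b" by auto
      have "l = l powr (1 - t) * l powr t" using l by (simp add: powr_add[symmetric])
      also have "\<dots> < (f x / a) powr (1 - t) * (g y / b) powr t"
        using xy l t by (intro mult_strict_mono powr_less_mono2) auto
      also have "\<dots> = f x powr (1 - t) * g y powr t / c"
        using f g a b by (simp add: c_def powr_divide)
      finally have "ennreal l < ennreal (f x powr (1 - t) * g y powr t / c)"
        using l by (simp add: ennreal_less_iff)
      also have "\<dots> = ennreal (f x powr (1 - t) * g y powr t) / ennreal c"
        using c f g by (simp add: divide_ennreal)
      also have "\<dots> \<le> h ((1 - t) * x + t * y) / ennreal c"
        by (intro divide_right_mono_ennreal le)
      finally have "ennreal l < ennreal (uh ((1 - t) * x + t * y))"
        using l by (simp add: uh)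
      then show "(1 - t) * x + t * y \<in> {x. l < uh x}"
        using l by (simp add: ennreal_less_iff)
    qed (use t in auto)
    have "ennreal ((1 - t) * (F / a) + t * (G / b)) = ennreal (1 - t) * (\<integral>\<^sup>+x. ennreal (f x / a) \<partial>lborel) + ennreal t * (\<integral>\<^sup>+x. ennreal (g x / b) \<partial>lborel)"
    proof -
      have "(\<integral>\<^sup>+x. ennreal (f x / a) \<partial>lborel) = ennreal (F / a)"
        unfolding F_def using int[of f] f a by (subst nn_integral_eq_integral) auto
      moreover have "(\<integral>\<^sup>+x. ennreal (g x / b) \<partial>lborel) = ennreal (G / b)"
        unfolding G_def using int[of g] g b by (subst nn_integral_eq_integral) auto
      ultimately show ?thesis using t FG a b by (simp add: ennreal_mult'[symmetric] ennreal_plus[symmetric] del: ennreal_plus)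
    qed
    also have "\<dots> = ennreal (1 - t) * (\<integral>\<^sup>+l. indicator {0<..<1} l * emeasure lborel {x. l < f x / a} \<partial>lborel)
        + ennreal t * (\<integral>\<^sup>+l. indicator {0<..<1} l * emeasure lborel {x. l < g x / b} \<partial>lborel)"
      using f g fa gb a b by (subst (1 2) nn_integral_layer_cake_unit) auto
    also have "\<dots> = (\<integral>\<^sup>+l. indicator {0<..<1} l * (ennreal (1 - t) * emeasure lborel {x. l < f x / a} + ennreal t * emeasure lborel {x. l < g x / b}) \<partial>lborel)"
    proof -
      have [measurable]: "(\<lambda>l. emeasure lborel {x. l < u x}) \<in> borel_measurable borel"
        if [measurable]: "u \<in> borel_measurable borel" for u :: "real \<Rightarrow> real"
      proof -
        have "(\<lambda>l. emeasure lborel (Pair l -` {(l, x). l < u x})) \<in> borel_measurable borel"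
          using sigma_finite_measure.measurable_emeasure_Pair[OF sigma_finite_lborel, of "{(l, x). l < u x}" "borel :: real measure"]
          by measurable
        then show ?thesis by (simp add: vimage_def)
      qed
      show ?thesis
        by (subst (1 2) nn_integral_cmult[symmetric], measurable)
           (subst nn_integral_add[symmetric], measurable, auto intro!: nn_integral_cong simp: indicator_def)
    qed
    also have "\<dots> \<le> (\<integral>\<^sup>+l. indicator {0<..<1} l * emeasure lborel {x. l < uh x} \<partial>lborel)"
      using key by (intro nn_integral_mono) (auto simp: indicator_def)
    also have "\<dots> = (\<integral>\<^sup>+x. ennreal (uh x) \<partial>lborel)"
      using uh by (intro nn_integral_layer_cake_unit) auto
    finally have 1: "ennreal ((1 - t) * (F / a) + t * (G / b)) \<le> (\<integral>\<^sup>+x. ennreal (uh x) \<partial>lborel)" .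
    have "(F / a) powr (1 - t) * (G / b) powr t \<le> (1 - t) * (F / a) + t * (G / b)"
      using Youngs_inequality_0[of "1 - t" t "F / a" "G / b"] t FG a b by simp
    then have "F powr (1 - t) * G powr t \<le> c * ((1 - t) * (F / a) + t * (G / b))"
      using a b c FG by (simp add: c_def powr_divide field_simps)
    then have "ennreal (F powr (1 - t) * G powr t) \<le> ennreal c * ennreal ((1 - t) * (F / a) + t * (G / b))"
      using c by (subst ennreal_mult'[symmetric]) (auto intro: ennreal_leI)
    also have "\<dots> \<le> ennreal c * (\<integral>\<^sup>+x. ennreal (uh x) \<partial>lborel)"
      by (intro mult_left_mono 1) simp
    also have "\<dots> = (\<integral>\<^sup>+x. ennreal c * ennreal (uh x) \<partial>lborel)"
      by (simp add: nn_integral_cmult)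
    also have "\<dots> \<le> (\<integral>\<^sup>+x. h x \<partial>lborel)"
    proof (rule nn_integral_mono)
      fix x
      have "ennreal c * ennreal (uh x) \<le> ennreal c * (h x / ennreal c)"
        unfolding uh by (intro mult_left_mono) auto
      also have "\<dots> = h x" using c
        by (metis ennreal_neq_top ennreal_mult_divide_eq ennreal_times_divide ennreal_eq_0_iff mult.commute not_less)
      finally show "ennreal c * ennreal (uh x) \<le> h x" .
    qed
    finally show ?thesis by (simp add: F_def G_def)
  qed
qed


text \<open>Tensorisation: after one coordinate is integrated out, the one-dimensional inequality
  for the slices is precisely the hypothesis for the partial integrals. The hypothesis is asked at
  \<open>extensional\<close> points because slices are known to be measurable only through points of
  the product space.\<close>

lemma prekopa_leindler_PiM:
  fixes f g :: "('i \<Rightarrow> real) \<Rightarrow> real" and h :: "('i \<Rightarrow> real) \<Rightarrow> ennreal"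
  assumes "finite I" and t: "0 < t" "t < 1"
    and "f \<in> borel_measurable (\<Pi>\<^sub>M i\<in>I. lborel)" "g \<in> borel_measurable (\<Pi>\<^sub>M i\<in>I. lborel)"
      "h \<in> borel_measurable (\<Pi>\<^sub>M i\<in>I. lborel)"
    and "\<And>x. 0 \<le> f x" "\<And>x. f x \<le> K" "\<And>x i. i \<in> I \<Longrightarrow> \<bar>x i\<bar> > K \<Longrightarrow> f x = 0"
    and "\<And>x. 0 \<le> g x" "\<And>x. g x \<le> K" "\<And>x i. i \<in> I \<Longrightarrow> \<bar>x i\<bar> > K \<Longrightarrow> g x = 0"
    and "\<And>x y. x \<in> extensional I \<Longrightarrow> y \<in> extensional I \<Longrightarrow>
      ennreal (f x powr (1 - t) * g y powr t) \<le> h (\<lambda>i\<in>I. (1 - t) * x i + t * y i)"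
  shows "ennreal (enn2real (\<integral>\<^sup>+x. f x \<partial>(\<Pi>\<^sub>M i\<in>I. lborel)) powr (1 - t) * enn2real (\<integral>\<^sup>+x. g x \<partial>(\<Pi>\<^sub>M i\<in>I. lborel)) powr t)
     \<le> (\<integral>\<^sup>+x. h x \<partial>(\<Pi>\<^sub>M i\<in>I. lborel))"
  using assms(1,4-)
proof (induction I arbitrary: f g h K rule: finite_induct)
  case empty
  interpret product_sigma_finite "\<lambda>i::'i. lborel :: real measure" ..
  \<comment> \<open>The empty product has a single point, the constant function
    \<open>undefined\<close>, so the claim is the hypothesis at that point.\<close>
  show ?case
    using empty(4,7) empty.prems(10)[of "\<lambda>k. undefined" "\<lambda>k. undefined"]
    by (simp add: PiM_empty nn_integral_count_space_finite restrict_def)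
next
  case (insert i I f g h K)
  interpret product_sigma_finite "\<lambda>i::'i. lborel :: real measure" ..
  note f = insert.prems(4,5,6) and g = insert.prems(7,8,9)
  have K: "K \<ge> 0" using f(1,2) order_trans by blast
  have inner[measurable]: "(\<lambda>x. \<integral>\<^sup>+y. u (x(i := y)) \<partial>lborel) \<in> borel_measurable (\<Pi>\<^sub>M i\<in>I. lborel)"
    if [measurable]: "u \<in> borel_measurable (\<Pi>\<^sub>M i\<in>insert i I. lborel)" for u :: "('i \<Rightarrow> real) \<Rightarrow> ennreal"
  proof -
    have "(\<lambda>(x, y). u (x(i := y))) \<in> borel_measurable ((\<Pi>\<^sub>M i\<in>I. lborel) \<Otimes>\<^sub>M lborel)"
      using measurable_compose[OF measurable_add_dim that] by (simp add: split_beta')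
    then show ?thesis
      by (intro lborel.borel_measurable_nn_integral) (simp add: split_beta')
  qed
  have bound: "(\<integral>\<^sup>+y. ennreal (u (x(i := y))) \<partial>lborel) \<le> ennreal (K * (2 * K))"
    if u: "\<And>x. 0 \<le> u x" "\<And>x. u x \<le> K" "\<And>x j. j \<in> insert i I \<Longrightarrow> \<bar>x j\<bar> > K \<Longrightarrow> u x = 0" for u :: "('i \<Rightarrow> real) \<Rightarrow> real" and x
  proof -
    have "(\<integral>\<^sup>+y. ennreal (u (x(i := y))) \<partial>lborel) \<le> (\<integral>\<^sup>+y. ennreal K * indicator {-K..K} y \<partial>lborel)"
    proof (rule nn_integral_mono)
      fix y show "ennreal (u (x(i := y))) \<le> ennreal K * indicator {-K..K} y"
      proof (cases "y \<in> {-K..K}")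
        case True then show ?thesis using u(2) by (simp add: ennreal_leI)
      next
        case False
        then have "u (x(i := y)) = 0" by (intro u(3)[of i]) auto
        then show ?thesis by simp
      qed
    qed
    also have "\<dots> = ennreal K * emeasure lborel {-K..K}" by (subst nn_integral_cmult_indicator) auto
    also have "\<dots> = ennreal (K * (2 * K))" using K by (simp add: ennreal_mult')
    finally show ?thesis .
  qed
  define F where "F x = enn2real (\<integral>\<^sup>+y. ennreal (f (x(i := y))) \<partial>lborel)" for x
  define G where "G x = enn2real (\<integral>\<^sup>+y. ennreal (g (x(i := y))) \<partial>lborel)" for x
  define H where "H x = (\<integral>\<^sup>+y. h (x(i := y)) \<partial>lborel)" for x
  have bf: "(\<integral>\<^sup>+y. ennreal (f (x(i := y))) \<partial>lborel) \<le> ennreal (K * (2 * K))"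
    and bg: "(\<integral>\<^sup>+y. ennreal (g (x(i := y))) \<partial>lborel) \<le> ennreal (K * (2 * K))" for x
    by (rule bound[where u = f], fact f(1), fact f(2), erule (1) f(3))
       (rule bound[where u = g], fact g(1), fact g(2), erule (1) g(3))
  have eF: "ennreal (F x) = (\<integral>\<^sup>+y. ennreal (f (x(i := y))) \<partial>lborel)" for x
    unfolding F_def by (intro ennreal_enn2real le_less_trans[OF bf]) simp
  have eG: "ennreal (G x) = (\<integral>\<^sup>+y. ennreal (g (x(i := y))) \<partial>lborel)" for x
    unfolding G_def by (intro ennreal_enn2real le_less_trans[OF bg]) simp
  \<comment> \<open>The new bound must dominate both the support radius \<open>K\<close> and the
    size \<open>K * (2 * K)\<close> of a slice integral; hence the generalisation of the induction
    over \<open>K\<close>.\<close>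
  define K' where "K' = K + K * (2 * K)"
  have K': "K \<le> K'" "K * (2 * K) \<le> K'" using K by (auto simp: K'_def)
  have m1: "(\<lambda>y. x(i := y)) \<in> measurable lborel (\<Pi>\<^sub>M i\<in>insert i I. lborel)"
    if "x \<in> space (\<Pi>\<^sub>M i\<in>I. lborel)" for x :: "'i \<Rightarrow> real"
    using measurable_component_update[OF that, of i] insert.hyps by simp
  have "ennreal (enn2real (\<integral>\<^sup>+x. F x \<partial>(\<Pi>\<^sub>M i\<in>I. lborel)) powr (1 - t) * enn2real (\<integral>\<^sup>+x. G x \<partial>(\<Pi>\<^sub>M i\<in>I. lborel)) powr t)
     \<le> (\<integral>\<^sup>+x. H x \<partial>(\<Pi>\<^sub>M i\<in>I. lborel))"
  proof (rule insert.IH[where K = K'])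
    show "F \<in> borel_measurable (\<Pi>\<^sub>M i\<in>I. lborel)" "G \<in> borel_measurable (\<Pi>\<^sub>M i\<in>I. lborel)"
      "H \<in> borel_measurable (\<Pi>\<^sub>M i\<in>I. lborel)"
      unfolding F_def G_def H_def using insert.prems(1-3) by measurable
    fix x
    show "0 \<le> F x" "0 \<le> G x" by (auto simp: F_def G_def)
    have "ennreal (F x) \<le> ennreal K'" "ennreal (G x) \<le> ennreal K'"
      unfolding eF eG using bf[of x] bg[of x] K' by (auto intro: order_trans ennreal_leI)
    then show "F x \<le> K'" "G x \<le> K'" using K K' by (auto simp: ennreal_le_iff)
  next
    fix x j assume j: "j \<in> I" "K' < \<bar>x j\<bar>"
    then have "f (x(i := y)) = 0" "g (x(i := y)) = 0" for y
      using K' insert.hyps(2) by (auto intro!: f(3)[of j] g(3)[of j])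
    then show "F x = 0" "G x = 0" by (auto simp: F_def G_def)
  next
    fix x y :: "'i \<Rightarrow> real"
    assume x: "x \<in> extensional I" and y: "y \<in> extensional I"
    define w where "w = (\<lambda>i\<in>I. (1 - t) * x i + t * y i)"
    have m2[measurable]: "(\<lambda>y. x(i := y)) \<in> measurable lborel (\<Pi>\<^sub>M i\<in>insert i I. lborel)"
      "(\<lambda>z. y(i := z)) \<in> measurable lborel (\<Pi>\<^sub>M i\<in>insert i I. lborel)"
      "(\<lambda>z. w(i := z)) \<in> measurable lborel (\<Pi>\<^sub>M i\<in>insert i I. lborel)"
      using x y by (auto intro!: m1 simp: space_PiM PiE_def w_def)
    have [measurable]: "(\<lambda>z. f (x(i := z))) \<in> borel_measurable borel" "(\<lambda>z. g (y(i := z))) \<in> borel_measurable borel"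
      "(\<lambda>z. h (w(i := z))) \<in> borel_measurable borel"
      using measurable_compose[OF m2(1) insert.prems(1)] measurable_compose[OF m2(2) insert.prems(2)]
        measurable_compose[OF m2(3) insert.prems(3)] by (simp_all only: measurable_lborel2)
    have "ennreal ((LINT z|lborel. f (x(i := z))) powr (1 - t) * (LINT z|lborel. g (y(i := z))) powr t) \<le> (\<integral>\<^sup>+z. h (w(i := z)) \<partial>lborel)"
    proof (rule prekopa_leindler_real[where K = K])
      fix u v :: real
      have "(\<lambda>j\<in>insert i I. (1 - t) * (x(i := u)) j + t * (y(i := v)) j) = w(i := (1 - t) * u + t * v)"
        using insert.hyps(2) by (auto simp: w_def fun_eq_iff)
      moreover have "x(i := u) \<in> extensional (insert i I)" "y(i := v) \<in> extensional (insert i I)"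
        using x y by (auto simp: extensional_def)
      ultimately show "ennreal (f (x(i := u)) powr (1 - t) * g (y(i := v)) powr t) \<le> h (w(i := (1 - t) * u + t * v))"
        using insert.prems(10) by metis
    next
      fix u assume "K < \<bar>u\<bar>"
      then show "f (x(i := u)) = 0" "g (y(i := u)) = 0" by (auto intro!: f(3)[of i] g(3)[of i])
    qed (use t f(1,2) g(1,2) in auto)
    moreover have "F x = (LINT z|lborel. f (x(i := z)))" "G y = (LINT z|lborel. g (y(i := z)))"
      unfolding F_def G_def using f(1) g(1) by (subst integral_eq_nn_integral; simp)+
    ultimately show "ennreal (F x powr (1 - t) * G y powr t) \<le> H (\<lambda>i\<in>I. (1 - t) * x i + t * y i)"
      by (simp add: H_def w_def)
  qed
  also have "(\<integral>\<^sup>+x. F x \<partial>(\<Pi>\<^sub>M i\<in>I. lborel)) = (\<integral>\<^sup>+x. f x \<partial>(\<Pi>\<^sub>M i\<in>insert i I. lborel))"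
    using insert.hyps insert.prems(1) by (subst product_nn_integral_insert) (auto simp: eF)
  also have "(\<integral>\<^sup>+x. G x \<partial>(\<Pi>\<^sub>M i\<in>I. lborel)) = (\<integral>\<^sup>+x. g x \<partial>(\<Pi>\<^sub>M i\<in>insert i I. lborel))"
    using insert.hyps insert.prems(2) by (subst product_nn_integral_insert) (auto simp: eG)
  also have "(\<integral>\<^sup>+x. H x \<partial>(\<Pi>\<^sub>M i\<in>I. lborel)) = (\<integral>\<^sup>+x. h x \<partial>(\<Pi>\<^sub>M i\<in>insert i I. lborel))"
    using insert.hyps insert.prems(3) by (subst product_nn_integral_insert) (auto simp: H_def[abs_def])
  finally show ?case .
qed


lemma prekopa_leindler_bounded:
  fixes f g :: "'a::euclidean_space \<Rightarrow> real" and h :: "'a \<Rightarrow> ennreal"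
  assumes [measurable]: "f \<in> borel_measurable borel" "g \<in> borel_measurable borel" "h \<in> borel_measurable borel"
    and f: "\<And>x. 0 \<le> f x" "\<And>x. f x \<le> K" "\<And>x. norm x > K \<Longrightarrow> f x = 0"
    and g: "\<And>x. 0 \<le> g x" "\<And>x. g x \<le> K" "\<And>x. norm x > K \<Longrightarrow> g x = 0"
    and t: "0 < t" "t < 1"
    and le: "\<And>x y. ennreal (f x powr (1 - t) * g y powr t) \<le> h ((1 - t) *\<^sub>R x + t *\<^sub>R y)"
  shows "ennreal ((LINT x|lborel. f x) powr (1 - t) * (LINT x|lborel. g x) powr t) \<le> (\<integral>\<^sup>+x. h x \<partial>lborel)"
proof -
  define T :: "('a \<Rightarrow> real) \<Rightarrow> 'a" where "T x = (\<Sum>b\<in>Basis. x b *\<^sub>R b)" for x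
  have [measurable]: "T \<in> borel_measurable (\<Pi>\<^sub>M b\<in>Basis. lborel)" unfolding T_def by measurable
  have nn: "(\<integral>\<^sup>+x. u x \<partial>lborel) = (\<integral>\<^sup>+x. u (T x) \<partial>(\<Pi>\<^sub>M b\<in>Basis. lborel))"
    if [measurable]: "u \<in> borel_measurable borel" for u :: "'a \<Rightarrow> ennreal"
    by (subst lborel_eq) (simp add: nn_integral_distr T_def)
  have TK: "norm (T x) > K" if "b \<in> Basis" "\<bar>x b\<bar> > K" for x b
    using that Basis_le_norm[of b "T x"] by (simp add: T_def)
  have "ennreal (enn2real (\<integral>\<^sup>+x. f (T x) \<partial>(\<Pi>\<^sub>M b\<in>Basis. lborel)) powr (1 - t) * enn2real (\<integral>\<^sup>+x. g (T x) \<partial>(\<Pi>\<^sub>M b\<in>Basis. lborel)) powr t)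
     \<le> (\<integral>\<^sup>+x. h (T x) \<partial>(\<Pi>\<^sub>M b\<in>Basis. lborel))"
  proof (rule prekopa_leindler_PiM[where K = K])
    fix x y :: "'a \<Rightarrow> real"
    have "T (\<lambda>b\<in>Basis. (1 - t) * x b + t * y b) = (1 - t) *\<^sub>R T x + t *\<^sub>R T y"
      unfolding T_def by (simp add: scaleR_sum_right sum.distrib[symmetric] scaleR_add_left)
    then show "ennreal (f (T x) powr (1 - t) * g (T y) powr t) \<le> h (T (\<lambda>b\<in>Basis. (1 - t) * x b + t * y b))"
      using le by simp
  qed (use t f g TK in auto)
  then show ?thesis
    using f(1) g(1) by (simp add: integral_eq_nn_integral nn)
qed

text \<open>Truncating f and g in value and in space only lowers them, so the hypothesis persists
  with the same h, and dominated convergence removes the truncation.\<close>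

lemma prekopa_leindler:
  fixes f g h :: "'a::euclidean_space \<Rightarrow> real"
  assumes f: "integrable lborel f" "\<And>x. 0 \<le> f x" and g: "integrable lborel g" "\<And>x. 0 \<le> g x"
    and h: "integrable lborel h" "\<And>x. 0 \<le> h x"
    and t: "0 < t" "t < 1"
    and le: "\<And>x y. f x powr (1 - t) * g y powr t \<le> h ((1 - t) *\<^sub>R x + t *\<^sub>R y)"
  shows "(LINT x|lborel. f x) powr (1 - t) * (LINT x|lborel. g x) powr t \<le> (LINT x|lborel. h x)"
proof -
  define c where "c u n x = (if norm x \<le> real n then min (u x) (real n) else 0)" for u :: "'a \<Rightarrow> real" and n x
  have [measurable]: "f \<in> borel_measurable borel" "g \<in> borel_measurable borel" "h \<in> borel_measurable borel"
    using f h g by (auto dest: borel_measurable_integrable)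
  have lim: "(\<lambda>n. \<integral>x. c u n x \<partial>lborel) \<longlonglongrightarrow> (LINT x|lborel. u x)"
    if u: "integrable lborel u" "\<And>x. 0 \<le> u x" for u
  proof (rule integral_dominated_convergence[where w = u])
    have [measurable]: "u \<in> borel_measurable borel" using u by (auto dest: borel_measurable_integrable)
    show "c u n \<in> borel_measurable lborel" for n unfolding c_def by measurable
    show "u \<in> borel_measurable lborel" by simp
    show "AE x in lborel. (\<lambda>n. c u n x) \<longlonglongrightarrow> u x"
    proof (intro AE_I2)
      fix x
      have "\<forall>\<^sub>F n in sequentially. max (norm x) (u x) \<le> real n"
        by (rule eventually_ge_at_top[of "nat \<lceil>max (norm x) (u x)\<rceil>", THEN eventually_mono]) linarith
      then have "\<forall>\<^sub>F n in sequentially. c u n x = u x"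
        by eventually_elim (simp add: c_def)
      then show "(\<lambda>n. c u n x) \<longlonglongrightarrow> u x" by (rule tendsto_eventually)
    qed
    show "AE x in lborel. norm (c u n x) \<le> u x" for n
      using u by (intro AE_I2) (simp add: c_def)
  qed (use u in auto)
  have "(LINT x|lborel. c f n x) powr (1 - t) * (LINT x|lborel. c g n x) powr t \<le> (LINT x|lborel. h x)" for n
  proof -
    have "ennreal ((LINT x|lborel. c f n x) powr (1 - t) * (LINT x|lborel. c g n x) powr t) \<le> (\<integral>\<^sup>+x. ennreal (h x) \<partial>lborel)"
    proof (rule prekopa_leindler_bounded[where K = n])
      show "c f n \<in> borel_measurable borel" "c g n \<in> borel_measurable borel" unfolding c_def by measurable
      fix x y
      have "c f n x powr (1 - t) * c g n y powr t \<le> f x powr (1 - t) * g y powr t"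
        using f g t by (intro mult_mono powr_mono2) (auto simp: c_def)
      then show "ennreal (c f n x powr (1 - t) * c g n y powr t) \<le> ennreal (h ((1 - t) *\<^sub>R x + t *\<^sub>R y))"
        by (intro ennreal_leI order_trans[OF _ le])
    qed (use f g t in \<open>auto simp: c_def\<close>)
    also have "\<dots> = ennreal (LINT x|lborel. h x)" using h by (intro nn_integral_eq_integral) auto
    finally show ?thesis using h by (simp add: ennreal_le_iff)
  qed
  moreover have "(\<lambda>n. (LINT x|lborel. c f n x) powr (1 - t) * (LINT x|lborel. c g n x) powr t)
      \<longlonglongrightarrow> (LINT x|lborel. f x) powr (1 - t) * (LINT x|lborel. g x) powr t"
    using f g t by (intro tendsto_mult tendsto_powr2 lim tendsto_const) (auto simp: c_def intro!: always_eventually integral_nonneg_AE)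
  ultimately show ?thesis by (intro LIMSEQ_le_const2) auto
qed

section \<open>Entropic potentials\<close>

lemma integral_exp_pos:
  fixes u :: "'a \<Rightarrow> real"
  assumes "integrable M (\<lambda>x. exp (u x))" "emeasure M (space M) \<noteq> 0"
  shows "0 < (LINT x|M. exp (u x))"
proof (rule ccontr)
  assume "\<not> ?thesis"
  moreover have "0 \<le> (LINT x|M. exp (u x))" by (intro integral_nonneg_AE) auto
  ultimately have "(LINT x|M. exp (u x)) = 0" by simp
  then have "AE x in M. exp (u x) = 0"
    using integral_nonneg_eq_0_iff_AE[OF assms(1)] by simp
  then have "AE x in M. False" by simp
  then show False using assms(2) by (simp add: AE_iff_null null_sets_def)
qed

text \<open>Hoelder's inequality in logarithmic form. Once both integrals are normalised to 1,
  pointwise convexity of \<open>exp\<close> and integration give it directly.\<close>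

lemma ln_integral_exp_convex:
  fixes f0 f1 g :: "'a \<Rightarrow> real"
  assumes M: "emeasure M (space M) \<noteq> 0"
    and int: "integrable M (\<lambda>x. exp (f0 x))" "integrable M (\<lambda>x. exp (f1 x))" "integrable M (\<lambda>x. exp (g x))"
    and t: "0 < t" "t < 1" and le: "\<And>x. g x \<le> (1 - t) * f0 x + t * f1 x"
  shows "ln (LINT x|M. exp (g x)) \<le> (1 - t) * ln (LINT x|M. exp (f0 x)) + t * ln (LINT x|M. exp (f1 x))"
proof -
  define I0 where "I0 = (LINT x|M. exp (f0 x))"
  define I1 where "I1 = (LINT x|M. exp (f1 x))"
  define I where "I = (LINT x|M. exp (g x))"
  have pos: "I0 > 0" "I1 > 0" "I > 0"
    unfolding I0_def I1_def I_def using int M by (auto intro!: integral_exp_pos)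
  define c where "c = (1 - t) * ln I0 + t * ln I1"
  have "exp (g x) * exp (- c) \<le> (1 - t) * (exp (f0 x) / I0) + t * (exp (f1 x) / I1)" for x
  proof -
    have "exp (g x) * exp (- c) \<le> exp ((1 - t) * (f0 x - ln I0) + t * (f1 x - ln I1))"
      using le[of x] by (simp add: exp_add[symmetric] c_def algebra_simps)
    also have "\<dots> \<le> (1 - t) * exp (f0 x - ln I0) + t * exp (f1 x - ln I1)"
      using convex_onD[OF exp_convex, of t "f0 x - ln I0" "f1 x - ln I1"] t by simp
    also have "\<dots> = (1 - t) * (exp (f0 x) / I0) + t * (exp (f1 x) / I1)"
      using pos by (simp add: exp_diff)
    finally show ?thesis .
  qed
  then have "(LINT x|M. exp (g x) * exp (- c)) \<le> (LINT x|M. (1 - t) * (exp (f0 x) / I0) + t * (exp (f1 x) / I1))"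
    using int by (intro integral_mono) auto
  also have "\<dots> = (1 - t) * (I0 / I0) + t * (I1 / I1)"
    using int by (simp add: I0_def I1_def)
  also have "\<dots> = 1" using pos by simp
  finally have "I * exp (- c) \<le> 1" by (simp add: I_def)
  then have "I \<le> exp c" by (simp add: exp_minus field_simps)
  then have "ln I \<le> c" using pos by (metis ln_exp ln_le_cancel_iff exp_gt_zero)
  then show ?thesis by (simp add: c_def I0_def I1_def I_def)
qed

lemma lborel_integral_translate:
  fixes f :: "'a::euclidean_space \<Rightarrow> real"
  shows "(LINT x|lborel. f (c + x)) = (LINT x|lborel. f x)"
    and "f \<in> borel_measurable borel \<Longrightarrow> integrable lborel (\<lambda>x. f (c + x)) \<longleftrightarrow> integrable lborel f"
proof -
  show 2: "integrable lborel (\<lambda>x. f (c + x)) \<longleftrightarrow> integrable lborel f" if "f \<in> borel_measurable borel" for f :: "'a \<Rightarrow> real"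
    using that by (subst (2) lborel_distr_plus[of c, symmetric]) (simp add: integrable_distr_eq)
  show "(LINT x|lborel. f (c + x)) = (LINT x|lborel. f x)"
  proof (cases "f \<in> borel_measurable borel")
    case True
    then show ?thesis by (subst (2) lborel_distr_plus[of c, symmetric]) (simp add: integral_distr)
  next
    case False
    have "\<not> integrable lborel (\<lambda>x. f (c + x))"
    proof
      assume "integrable lborel (\<lambda>x. f (c + x))"
      then have "(\<lambda>x. f (c + x)) \<in> borel_measurable borel" by (auto dest: borel_measurable_integrable)
      then have "(\<lambda>x. f (c + (x - c))) \<in> borel_measurable borel" by (rule measurable_compose[rotated]) simp
      then show False using False by simp
    qed
    then show ?thesis using False
      by (metis not_integrable_integral_eq borel_measurable_integrable measurable_lborel2)
  qed
qed

text \<open>The density, with respect to the product of the two measures, of an entropic coupling.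
  Both partial integrals being identically 1 is the Schroedinger system: the coupling then has the
  prescribed marginals.\<close>

abbreviation gibbs :: "real \<Rightarrow> ('a::real_inner \<Rightarrow> real) \<Rightarrow> ('a \<Rightarrow> real) \<Rightarrow> 'a \<Rightarrow> 'a \<Rightarrow> real" where
  "gibbs e f \<psi> x y \<equiv> exp ((x \<bullet> y - f x - \<psi> y) / e)"

text \<open>\<open>\<sigma>\<close> is the candidate modulus of smoothness of the potential, \<open>\<kappa>\<close> the modulus of smoothness of \<open>U\<close> and \<open>\<rho>\<close> the
  modulus of convexity of \<open>q\<close>. Smoothness is only required at distances in \<open>A\<close>: in the application \<open>\<rho>\<close> is negative
  near 0, so that no function \<open>\<sigma>\<close> vanishing at 0 is reproduced at all distances, but the \<open>\<sigma>\<close> of the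
  theorem is reproduced at distances at least \<open>2 e Lb\<close>, a threshold that tends to 0 with \<open>e\<close>.\<close>

locale entropic_transport =
  fixes U q :: "'a::euclidean_space \<Rightarrow> real" and S :: "'a set" and e R :: real
    and \<kappa> \<rho> \<sigma> :: "real \<Rightarrow> real" and A :: "real set"
  assumes e: "0 < e" and R: "0 \<le> R"
    and U_meas[measurable]: "U \<in> borel_measurable borel"
    and U_int: "\<And>c. integrable lborel (\<lambda>x. exp (c * norm x - U x))"
    and U_prob: "(LINT x|lborel. exp (- U x)) = 1"
    and U_smooth: "\<And>t x0 x1. 0 < t \<Longrightarrow> t < 1 \<Longrightarrow>
      (1 - t) * U x0 + t * U x1 \<le> U ((1 - t) *\<^sub>R x0 + t *\<^sub>R x1) + t * (1 - t) * \<kappa> (norm (x1 - x0))"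
    and S_meas[measurable]: "S \<in> sets borel" and S_convex: "convex S" and S_bounded: "S \<subseteq> cball 0 R"
    and q_meas[measurable]: "q \<in> borel_measurable borel"
    and q_int: "integrable lborel (\<lambda>y. indicator S y * exp (- q y))"
    and q_prob: "(LINT y|lborel. indicator S y * exp (- q y)) = 1"
    and q_convex: "\<And>t y0 y1. 0 < t \<Longrightarrow> t < 1 \<Longrightarrow> y0 \<in> S \<Longrightarrow> y1 \<in> S \<Longrightarrow>
      q ((1 - t) *\<^sub>R y0 + t *\<^sub>R y1) + t * (1 - t) * \<rho> (norm (y1 - y0)) \<le> (1 - t) * q y0 + t * q y1"
    and zero: "\<sigma> 0 = 0" "\<kappa> 0 = 0" "\<rho> 0 = 0"
    and A_nonneg: "\<And>r. r \<in> A \<Longrightarrow> 0 \<le> r" and \<sigma>_nonneg: "\<And>r. r \<in> A \<Longrightarrow> 0 \<le> \<sigma> r"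
    and modulus: "\<And>r s. r \<in> A \<Longrightarrow> 0 \<le> s \<Longrightarrow>
      \<exists>r'\<in>insert 0 A. r * s - \<sigma> r \<le> r' * s - \<sigma> r' - e * \<kappa> r' + e * \<rho> s"
begin

section \<open>Entropic Legendre transforms and Sinkhorn iterates\<close>

definition M where "M = density lborel (\<lambda>x. ennreal (exp (- U x)))"
definition N where "N = density lborel (\<lambda>y. ennreal (indicator S y * exp (- q y)))"

definition smooth :: "('a \<Rightarrow> real) \<Rightarrow> bool" where
  "smooth f \<longleftrightarrow> (\<forall>t x0 x1. 0 < t \<and> t < 1 \<and> norm (x1 - x0) \<in> A \<longrightarrow>
     (1 - t) * f x0 + t * f x1 \<le> f ((1 - t) *\<^sub>R x0 + t *\<^sub>R x1) + t * (1 - t) * \<sigma> (norm (x1 - x0)))"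

text \<open>The Legendre transform of f with the supremum replaced by a soft maximum against
  \<open>M\<close>. For Lipschitz f it is the only partner for which
  \<open>gibbs e f (Psi f)\<close> integrates to 1 in x.\<close>

definition Psi :: "('a \<Rightarrow> real) \<Rightarrow> 'a \<Rightarrow> real" where
  "Psi f y = e * ln (LINT x|M. exp ((x \<bullet> y - f x) / e))"

text \<open>One full Sinkhorn step, the soft transform against \<open>M\<close> followed by the one
  against \<open>N\<close>; a fixed point solves both marginal equations.\<close>

definition Sk :: "('a \<Rightarrow> real) \<Rightarrow> 'a \<Rightarrow> real" where
  "Sk f x = e * ln (LINT y|N. exp ((x \<bullet> y - Psi f y) / e))"

lemma sets_MN[simp, measurable_cong]: "sets M = sets borel" "sets N = sets borel"
  by (simp_all add: M_def N_def)

lemma space_MN[simp]: "space M = UNIV" "space N = UNIV"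
  by (simp_all add: M_def N_def)

lemma integral_M: "u \<in> borel_measurable borel \<Longrightarrow> (LINT x|M. u x) = (LINT x|lborel. exp (- U x) * u x)"
  and integrable_M: "u \<in> borel_measurable borel \<Longrightarrow> integrable M u \<longleftrightarrow> integrable lborel (\<lambda>x. exp (- U x) * u x)"
  for u :: "'a \<Rightarrow> real"
  by (simp_all add: M_def integral_density integrable_density)

lemma integral_N: "u \<in> borel_measurable borel \<Longrightarrow> (LINT x|N. u x) = (LINT x|lborel. indicator S x * exp (- q x) * u x)"
  and integrable_N: "u \<in> borel_measurable borel \<Longrightarrow> integrable N u \<longleftrightarrow> integrable lborel (\<lambda>x. indicator S x * exp (- q x) * u x)"
  for u :: "'a \<Rightarrow> real"
  by (simp_all add: N_def integral_density integrable_density)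

lemma emeasure_MN: "emeasure M UNIV = 1" "emeasure N UNIV = 1"
proof -
  have "integrable lborel (\<lambda>x. exp (- U x))" using U_int[of 0] by simp
  then have "(\<integral>\<^sup>+x. ennreal (exp (- U x)) \<partial>lborel) = 1"
    using U_prob by (subst nn_integral_eq_integral) auto
  then show "emeasure M UNIV = 1" by (simp add: M_def emeasure_density)
  have "(\<integral>\<^sup>+x. ennreal (indicator S x * exp (- q x)) \<partial>lborel) = 1"
    using q_prob q_int by (subst nn_integral_eq_integral) auto
  then show "emeasure N UNIV = 1" by (simp add: N_def emeasure_density)
qed

sublocale M: finite_measure M by (rule finite_measureI) (simp add: emeasure_MN)
sublocale N: finite_measure N by (rule finite_measureI) (simp add: emeasure_MN)
sublocale MN: pair_sigma_finite M N ..

lemma measure_MN[simp]: "measure M UNIV = 1" "measure N UNIV = 1"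
  using emeasure_MN by (simp_all add: measure_def)

lemma AE_N: "AE y in N. y \<in> S"
  unfolding N_def by (subst AE_density) (auto simp: indicator_def intro!: AE_I2)

lemma integrable_exp_norm: "integrable M (\<lambda>x. exp (c * norm x))"
  using U_int[of c] by (subst integrable_M) (simp_all add: exp_add[symmetric])

lemma lipschitz_measurable: "R-lipschitz_on UNIV f \<Longrightarrow> f \<in> borel_measurable borel" for f :: "'a \<Rightarrow> real"
  by (intro borel_measurable_continuous_onI lipschitz_on_continuous_on)

lemma lipschitz_bound: "R-lipschitz_on UNIV f \<Longrightarrow> \<bar>f x - f 0\<bar> \<le> R * norm x" for f :: "'a \<Rightarrow> real"
  using lipschitz_onD[of R UNIV f x 0] by (simp add: dist_real_def)

lemma integrable_Psi:
  assumes f: "R-lipschitz_on UNIV f"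
  shows "integrable M (\<lambda>x. exp ((x \<bullet> y - f x) / e))"
proof (rule Bochner_Integration.integrable_bound)
  have [measurable]: "f \<in> borel_measurable borel" using lipschitz_measurable f by auto
  show "integrable M (\<lambda>x. exp (\<bar>f 0\<bar> / e) * exp ((norm y + R) / e * norm x))"
    by (intro integrable_mult_right integrable_exp_norm)
  show "(\<lambda>x. exp ((x \<bullet> y - f x) / e)) \<in> borel_measurable M" by measurable
  have "(x \<bullet> y - f x) / e \<le> \<bar>f 0\<bar> / e + (norm y + R) / e * norm x" for x
  proof -
    have "x \<bullet> y - f x \<le> \<bar>f 0\<bar> + (norm y + R) * norm x"
      using lipschitz_bound[OF f, of x] norm_cauchy_schwarz[of x y] by (simp add: algebra_simps)
    then have "(x \<bullet> y - f x) / e \<le> (\<bar>f 0\<bar> + (norm y + R) * norm x) / e"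
      using e by (intro divide_right_mono) auto
    then show ?thesis unfolding add_divide_distrib[of "\<bar>f 0\<bar>"] by simp
  qed
  then show "AE x in M. norm (exp ((x \<bullet> y - f x) / e)) \<le> norm (exp (\<bar>f 0\<bar> / e) * exp ((norm y + R) / e * norm x))"
    by (intro AE_I2) (simp add: exp_add[symmetric])
qed

lemma exp_Psi:
  assumes f: "R-lipschitz_on UNIV f"
  shows "exp (Psi f y / e) = (LINT x|M. exp ((x \<bullet> y - f x) / e))"
  using integral_exp_pos[OF integrable_Psi[OF f, of y]] e by (simp add: Psi_def emeasure_MN)

lemma measurable_Psi[measurable]:
  assumes f: "R-lipschitz_on UNIV f"
  shows "Psi f \<in> borel_measurable borel"
proof -
  have [measurable]: "f \<in> borel_measurable borel" using lipschitz_measurable f by auto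
  show ?thesis unfolding Psi_def[abs_def]
    by (intro borel_measurable_times borel_measurable_const borel_measurable_ln M.borel_measurable_lebesgue_integral) measurable
qed

abbreviation "psi_lo \<equiv> e * ln (LINT x|M. exp (- (2 * R / e) * norm x))"
abbreviation "psi_hi \<equiv> e * ln (LINT x|M. exp (2 * R / e * norm x))"

text \<open>On the ball of radius \<open>R\<close> the exponent \<open>x \<bullet> y - f x\<close>
  differs from \<open>- f 0\<close> by at most \<open>2 * R * norm x\<close>, so the bounds depend
  on f only through \<open>f 0\<close>. This uniformity supplies the dominating functions and the
  lower bound used in the minimisation.\<close>

lemma Psi_bounds:
  assumes f: "R-lipschitz_on UNIV f" and y: "norm y \<le> R"
  shows "psi_lo - f 0 \<le> Psi f y"
    and "Psi f y \<le> psi_hi - f 0"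
proof -
  have b: "\<bar>x \<bullet> y - f x + f 0\<bar> \<le> 2 * R * norm x" for x
  proof -
    have "\<bar>x \<bullet> y\<bar> \<le> norm x * R" using Cauchy_Schwarz_ineq2[of x y] y mult_left_mono[OF y, of "norm x"] by simp
    then show ?thesis using lipschitz_bound[OF f, of x] by (simp add: algebra_simps)
  qed
  note pos = integral_exp_pos[OF integrable_Psi[OF f, of y]]
  have pos1: "0 < (LINT x|M. exp (c * norm x))" for c
    using integral_exp_pos[OF integrable_exp_norm] by (simp add: emeasure_MN)
  have "exp (- f 0 / e) * (LINT x|M. exp (- (2 * R / e) * norm x)) = (LINT x|M. exp (- f 0 / e) * exp (- (2 * R / e) * norm x))" by simp
  also have "\<dots> \<le> (LINT x|M. exp ((x \<bullet> y - f x) / e))"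
  proof (intro integral_mono integrable_mult_right integrable_exp_norm integrable_Psi f)
    fix x
    have "(- f 0 - 2 * R * norm x) / e \<le> (x \<bullet> y - f x) / e"
      using b[of x] e by (intro divide_right_mono) auto
    then show "exp (- f 0 / e) * exp (- (2 * R / e) * norm x) \<le> exp ((x \<bullet> y - f x) / e)"
      by (simp add: exp_add[symmetric] diff_divide_distrib)
  qed
  finally have "ln (exp (- f 0 / e) * (LINT x|M. exp (- (2 * R / e) * norm x))) \<le> ln (LINT x|M. exp ((x \<bullet> y - f x) / e))"
    using pos pos1[of "- (2 * R / e)"] by (subst ln_le_cancel_iff) (auto simp: emeasure_MN)
  then have "e * (- f 0 / e + ln (LINT x|M. exp (- (2 * R / e) * norm x))) \<le> Psi f y"
    using pos1[of "- (2 * R / e)"] e by (simp add: ln_mult Psi_def)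
  then show "psi_lo - f 0 \<le> Psi f y"
    using e by (simp add: algebra_simps)
  have "(LINT x|M. exp ((x \<bullet> y - f x) / e)) \<le> (LINT x|M. exp (- f 0 / e) * exp (2 * R / e * norm x))"
  proof (intro integral_mono integrable_mult_right integrable_exp_norm integrable_Psi f)
    fix x
    have "(x \<bullet> y - f x) / e \<le> (- f 0 + 2 * R * norm x) / e"
      using b[of x] e by (intro divide_right_mono) auto
    then show "exp ((x \<bullet> y - f x) / e) \<le> exp (- f 0 / e) * exp (2 * R / e * norm x)"
      by (simp add: exp_add[symmetric] add_divide_distrib[symmetric] diff_divide_distrib)
  qed
  also have "\<dots> = exp (- f 0 / e) * (LINT x|M. exp (2 * R / e * norm x))" by simp
  finally have "ln (LINT x|M. exp ((x \<bullet> y - f x) / e)) \<le> ln (exp (- f 0 / e) * (LINT x|M. exp (2 * R / e * norm x)))"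
    using pos pos1[of "2 * R / e"] by (subst ln_le_cancel_iff) (auto simp: emeasure_MN)
  then have "Psi f y \<le> e * (- f 0 / e + ln (LINT x|M. exp (2 * R / e * norm x)))"
    using pos1[of "2 * R / e"] e by (simp add: ln_mult Psi_def)
  then show "Psi f y \<le> psi_hi - f 0"
    using e by (simp add: algebra_simps)
qed

lemma integrable_Sk:
  assumes f: "R-lipschitz_on UNIV f"
  shows "integrable N (\<lambda>y. exp ((x \<bullet> y - Psi f y) / e))"
proof (rule N.integrable_const_bound)
  have [measurable]: "Psi f \<in> borel_measurable borel" using f by measurable
  show "(\<lambda>y. exp ((x \<bullet> y - Psi f y) / e)) \<in> borel_measurable N" by measurable
  show "AE y in N. norm (exp ((x \<bullet> y - Psi f y) / e)) \<le> exp ((norm x * R - (psi_lo - f 0)) / e)"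
    using AE_N
  proof eventually_elim
    fix y assume "y \<in> S"
    then have y: "norm y \<le> R" using S_bounded by auto
    have "x \<bullet> y \<le> norm x * R" using norm_cauchy_schwarz[of x y] mult_left_mono[OF y, of "norm x"] by simp
    then show "norm (exp ((x \<bullet> y - Psi f y) / e)) \<le> exp ((norm x * R - (psi_lo - f 0)) / e)"
      using Psi_bounds(1)[OF f y] e by (simp add: divide_right_mono)
  qed
qed

lemma exp_Sk:
  assumes f: "R-lipschitz_on UNIV f"
  shows "exp (Sk f x / e) = (LINT y|N. exp ((x \<bullet> y - Psi f y) / e))"
  using integral_exp_pos[OF integrable_Sk[OF f, of x]] e by (simp add: Sk_def emeasure_MN)

text \<open>All points of \<open>S\<close> have norm at most \<open>R\<close>, so
  \<open>x \<bullet> y\<close> is \<open>R\<close>-Lipschitz in x for each of them, and the soft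
  maximum preserves this. The restriction to a ball serves this purpose: all iterates share one
  Lipschitz constant.\<close>

lemma lipschitz_Sk:
  assumes f: "R-lipschitz_on UNIV f"
  shows "R-lipschitz_on UNIV (Sk f)"
proof -
  have *: "Sk f x \<le> Sk f x' + R * norm (x - x')" for x x'
  proof -
    have "exp (Sk f x / e) \<le> (LINT y|N. exp (R * norm (x - x') / e) * exp ((x' \<bullet> y - Psi f y) / e))"
      unfolding exp_Sk[OF f]
    proof (intro integral_mono_AE integrable_mult_right integrable_Sk f)
      show "AE y in N. exp ((x \<bullet> y - Psi f y) / e) \<le> exp (R * norm (x - x') / e) * exp ((x' \<bullet> y - Psi f y) / e)"
        using AE_N
      proof eventually_elim
        fix y assume "y \<in> S"
        then have y: "norm y \<le> R" using S_bounded by auto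
        have "(x - x') \<bullet> y \<le> R * norm (x - x')"
          using norm_cauchy_schwarz[of "x - x'" y] mult_left_mono[OF y, of "norm (x - x')"] by (simp add: mult.commute)
        then show "exp ((x \<bullet> y - Psi f y) / e) \<le> exp (R * norm (x - x') / e) * exp ((x' \<bullet> y - Psi f y) / e)"
          using e by (simp add: exp_add[symmetric] divide_simps inner_diff_left)
      qed
    qed
    also have "\<dots> = exp (R * norm (x - x') / e) * exp (Sk f x' / e)"
      by (simp add: exp_Sk[OF f])
    finally show ?thesis using e by (simp add: exp_add[symmetric] divide_simps)
  qed
  show ?thesis
  proof (rule lipschitz_onI[OF _ R])
    fix x x' show "dist (Sk f x) (Sk f x') \<le> R * dist x x'"
      using *[of x x'] *[of x' x] by (auto simp: dist_real_def dist_norm norm_minus_commute)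
  qed
qed

lemma convex_Sk:
  assumes f: "R-lipschitz_on UNIV f"
  shows "convex_on UNIV (Sk f)"
proof (rule convex_onI)
  fix t :: real and x y assume t: "0 < t" "t < 1"
  have "ln (LINT z|N. exp ((((1 - t) *\<^sub>R x + t *\<^sub>R y) \<bullet> z - Psi f z) / e))
    \<le> (1 - t) * ln (LINT z|N. exp ((x \<bullet> z - Psi f z) / e)) + t * ln (LINT z|N. exp ((y \<bullet> z - Psi f z) / e))"
  proof (intro ln_integral_exp_convex integrable_Sk f t)
    fix z
    have "((1 - t) *\<^sub>R x + t *\<^sub>R y) \<bullet> z - Psi f z = (1 - t) * (x \<bullet> z - Psi f z) + t * (y \<bullet> z - Psi f z)"
      unfolding inner_add_left inner_scaleR_left by (simp add: algebra_simps)
    then show "(((1 - t) *\<^sub>R x + t *\<^sub>R y) \<bullet> z - Psi f z) / e \<le> (1 - t) * ((x \<bullet> z - Psi f z) / e) + t * ((y \<bullet> z - Psi f z) / e)"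
      by (simp add: add_divide_distrib)
  qed (simp add: emeasure_MN)
  then have "e * ln (LINT z|N. exp ((((1 - t) *\<^sub>R x + t *\<^sub>R y) \<bullet> z - Psi f z) / e))
    \<le> e * ((1 - t) * ln (LINT z|N. exp ((x \<bullet> z - Psi f z) / e)) + t * ln (LINT z|N. exp ((y \<bullet> z - Psi f z) / e)))"
    using e by (intro mult_left_mono) auto
  then show "Sk f ((1 - t) *\<^sub>R x + t *\<^sub>R y) \<le> (1 - t) * Sk f x + t * Sk f y"
    by (simp add: Sk_def algebra_simps)
qed simp

section \<open>Propagation of the modulus through one iteration\<close>

lemma smooth_insert_zero:
  assumes "smooth f" "norm (x1 - x0) \<in> insert 0 A" "0 < t" "t < 1"
  shows "(1 - t) * f x0 + t * f x1 \<le> f ((1 - t) *\<^sub>R x0 + t *\<^sub>R x1) + t * (1 - t) * \<sigma> (norm (x1 - x0))"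
proof (cases "x1 = x0")
  case True
  then show ?thesis using zero by (simp add: algebra_simps)
next
  case False
  then show ?thesis using assms by (simp add: smooth_def)
qed

text \<open>Shifting the integrands at \<open>y0\<close> and \<open>y1\<close> by \<open>- t u\<close> and \<open>(1 - t) u\<close> and applying Hoelder's inequality.\<close>

lemma Psi_modulus:
  assumes f: "R-lipschitz_on UNIV f" "smooth f" and u: "norm u \<in> insert 0 A" and t: "0 < t" "t < 1"
  shows "Psi f ((1 - t) *\<^sub>R y0 + t *\<^sub>R y1) + t * (1 - t) * (u \<bullet> (y1 - y0) - \<sigma> (norm u) - e * \<kappa> (norm u))
    \<le> (1 - t) * Psi f y0 + t * Psi f y1"
proof -
  have [measurable]: "f \<in> borel_measurable borel" using lipschitz_measurable f by auto
  define F where "F y x = (x \<bullet> y - f x) / e - U x" for x y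
  have [measurable]: "F y \<in> borel_measurable borel" for y unfolding F_def by measurable
  have Psi: "Psi f y = e * ln (LINT x|lborel. exp (F y x))" for y
    unfolding Psi_def F_def by (subst integral_M) (simp_all add: exp_add[symmetric])
  have int: "integrable lborel (\<lambda>x. exp (F y x))" for y
    using integrable_Psi[OF f(1), of y] by (subst (asm) integrable_M) (simp_all add: F_def exp_add[symmetric])
  define yt where "yt = (1 - t) *\<^sub>R y0 + t *\<^sub>R y1"
  define c where "c = t * (1 - t) * (u \<bullet> (y1 - y0) - \<sigma> (norm u) - e * \<kappa> (norm u)) / e"
  have le: "F yt x + c \<le> (1 - t) * F y0 ((- t *\<^sub>R u) + x) + t * F y1 (((1 - t) *\<^sub>R u) + x)" for x
  proof -
    define x0 where "x0 = (- t *\<^sub>R u) + x"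
    define x1 where "x1 = ((1 - t) *\<^sub>R u) + x"
    have xx: "x1 - x0 = u" "(1 - t) *\<^sub>R x0 + t *\<^sub>R x1 = x"
      by (simp_all add: x0_def x1_def algebra_simps)
    have f': "(1 - t) * f x0 + t * f x1 \<le> f x + t * (1 - t) * \<sigma> (norm u)"
      using smooth_insert_zero[OF f(2) _ t, of x1 x0] u by (simp add: xx)
    have U': "(1 - t) * U x0 + t * U x1 \<le> U x + t * (1 - t) * \<kappa> (norm u)"
      using U_smooth[OF t, of x0 x1] by (simp add: xx)
    have i: "(1 - t) * (x0 \<bullet> y0) + t * (x1 \<bullet> y1) = x \<bullet> yt + t * (1 - t) * (u \<bullet> (y1 - y0))"
      by (simp add: x0_def x1_def yt_def inner_add_left inner_add_right inner_diff_right algebra_simps)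
    have "F yt x + c = (x \<bullet> yt + t * (1 - t) * (u \<bullet> (y1 - y0)) - (f x + t * (1 - t) * \<sigma> (norm u))) / e - (U x + t * (1 - t) * \<kappa> (norm u))"
      using e by (simp add: F_def c_def field_simps)
    also have "\<dots> \<le> ((1 - t) * (x0 \<bullet> y0) + t * (x1 \<bullet> y1) - ((1 - t) * f x0 + t * f x1)) / e - ((1 - t) * U x0 + t * U x1)"
      using f' U' i e by (intro diff_mono divide_right_mono) auto
    also have "\<dots> = (1 - t) * F y0 x0 + t * F y1 x1"
      by (simp add: F_def algebra_simps diff_divide_distrib add_divide_distrib)
    finally show ?thesis by (simp add: x0_def x1_def)
  qed
  have "ln (LINT x|lborel. exp (F yt x + c)) \<le> (1 - t) * ln (LINT x|lborel. exp (F y0 ((- t *\<^sub>R u) + x)))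
      + t * ln (LINT x|lborel. exp (F y1 (((1 - t) *\<^sub>R u) + x)))"
  proof (intro ln_integral_exp_convex t le)
    show "integrable lborel (\<lambda>x. exp (F y0 ((- t *\<^sub>R u) + x)))"
      using int lborel_integral_translate(2)[of "\<lambda>x. exp (F y0 x)" "- t *\<^sub>R u"] by simp
    show "integrable lborel (\<lambda>x. exp (F y1 (((1 - t) *\<^sub>R u) + x)))"
      using int lborel_integral_translate(2)[of "\<lambda>x. exp (F y1 x)" "(1 - t) *\<^sub>R u"] by simp
    show "integrable lborel (\<lambda>x. exp (F yt x + c))" using int by (simp add: exp_add)
  qed simp
  also have "(LINT x|lborel. exp (F y0 ((- t *\<^sub>R u) + x))) = (LINT x|lborel. exp (F y0 x))"
    by (rule lborel_integral_translate(1))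
  also have "(LINT x|lborel. exp (F y1 (((1 - t) *\<^sub>R u) + x))) = (LINT x|lborel. exp (F y1 x))"
    by (rule lborel_integral_translate(1))
  finally have "e * ln (LINT x|lborel. exp (F yt x + c))
      \<le> e * ((1 - t) * ln (LINT x|lborel. exp (F y0 x)) + t * ln (LINT x|lborel. exp (F y1 x)))"
    using e by (intro mult_left_mono) auto
  then have "e * ln (LINT x|lborel. exp (F yt x + c)) \<le> (1 - t) * Psi f y0 + t * Psi f y1"
    by (simp add: Psi algebra_simps)
  moreover have "ln (LINT x|lborel. exp (F yt x + c)) = ln (LINT x|lborel. exp (F yt x)) + c"
    using integral_exp_pos[OF int[of yt]] by (simp add: exp_add ln_mult)
  ultimately have "Psi f yt + e * c \<le> (1 - t) * Psi f y0 + t * Psi f y1"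
    by (simp add: Psi algebra_simps)
  then show ?thesis using e by (simp add: c_def yt_def)
qed

text \<open>The Prekopa-Leindler inequality is applied to the integrands at x0 and x1. Pointwise,
  the excess \<open>t * (1 - t) * (r * s)\<close> of the bilinear term must be paid for by the
  convexity of \<open>Psi f\<close> and of \<open>e * q\<close> together with the allowance
  \<open>\<sigma> r\<close>; the assumption \<open>modulus\<close> states this balance. A shift of
  length 0 is always available, since \<open>\<sigma> 0 = 0\<close> makes the smoothness inequality
  trivial there.\<close>

lemma smooth_Sk:
  assumes f: "R-lipschitz_on UNIV f" "smooth f"
  shows "smooth (Sk f)"
  unfolding smooth_def
proof (intro allI impI, elim conjE)
  fix t :: real and x0 x1 :: 'a
  assume t: "0 < t" "t < 1" and A: "norm (x1 - x0) \<in> A"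
  define r where "r = norm (x1 - x0)"
  define xt where "xt = (1 - t) *\<^sub>R x0 + t *\<^sub>R x1"
  have [measurable]: "Psi f \<in> borel_measurable borel" using f by measurable
  define G where "G x y = (x \<bullet> y - Psi f y) / e - q y" for x y
  define F where "F x y = indicator S y * exp (G x y)" for x y
  have eG: "e * G x y = x \<bullet> y - Psi f y - e * q y" for x y
    using e unfolding G_def right_diff_distrib by simp
  have FG: "indicator S y * exp (- q y) * exp ((x \<bullet> y - Psi f y) / e) = F x y" for x y
    by (simp add: F_def G_def mult.assoc exp_add[symmetric])
  have FN: "(LINT y|N. exp ((x \<bullet> y - Psi f y) / e)) = (LINT y|lborel. F x y)" for x
    by (subst integral_N) (simp_all add: FG)
  have int: "integrable lborel (F x)" for x
    using integrable_Sk[OF f(1), of x]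
    by (subst (asm) integrable_N) (simp_all add: FG)
  have pos: "0 < (LINT y|lborel. F x y)" for x
    using integral_exp_pos[OF integrable_Sk[OF f(1), of x]] by (simp add: FN emeasure_MN)
  have F_nonneg: "0 \<le> F x y" for x y by (simp add: F_def)
  define c where "c = t * (1 - t) * \<sigma> r / e"
  have "(LINT y|lborel. F x0 y) powr (1 - t) * (LINT y|lborel. F x1 y) powr t \<le> (LINT y|lborel. exp c * F xt y)"
  proof (intro prekopa_leindler int F_nonneg t integrable_mult_right)
    fix y0 y1
    show "F x0 y0 powr (1 - t) * F x1 y1 powr t \<le> exp c * F xt ((1 - t) *\<^sub>R y0 + t *\<^sub>R y1)"
    proof (cases "y0 \<in> S \<and> y1 \<in> S")
      case True
      define yt where "yt = (1 - t) *\<^sub>R y0 + t *\<^sub>R y1"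
      define s where "s = norm (y1 - y0)"
      have yt: "yt \<in> S" using S_convex True t by (auto simp: yt_def convex_def)
      obtain r' where r': "r' \<in> insert 0 A" "r * s - \<sigma> r \<le> r' * s - \<sigma> r' - e * \<kappa> r' + e * \<rho> s"
        using modulus[of r s] A unfolding r_def s_def by (metis norm_ge_zero)
      have r'0: "r' \<ge> 0" using r'(1) A_nonneg by auto
      \<comment> \<open>Among the shifts of length r' the one parallel to \<open>y1 - y0\<close>
        makes the convexity modulus of \<open>Psi f\<close> largest. For \<open>y1 = y0\<close> this
        u is 0, whatever r' is, and the claim reduces to \<open>0 \<le> \<sigma> r\<close>.\<close>
      define u where "u = r' *\<^sub>R sgn (y1 - y0)"
      have u: "norm u \<in> insert 0 A" "r * s - \<sigma> r \<le> u \<bullet> (y1 - y0) - \<sigma> (norm u) - e * \<kappa> (norm u) + e * \<rho> s"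
      proof -
        have "norm u \<in> insert 0 A \<and> r * s - \<sigma> r \<le> u \<bullet> (y1 - y0) - \<sigma> (norm u) - e * \<kappa> (norm u) + e * \<rho> s"
        proof (cases "y1 = y0")
          case True
          then show ?thesis using zero \<sigma>_nonneg[OF A] by (simp add: u_def s_def r_def)
        next
          case False
          have "norm u = r'" using False r'0 by (simp add: u_def norm_sgn)
          moreover have "u \<bullet> (y1 - y0) = r' * s"
          proof -
            have "u \<bullet> (y1 - y0) = r' * (((y1 - y0) \<bullet> (y1 - y0)) / norm (y1 - y0))"
              unfolding u_def sgn_div_norm by (simp add: divide_inverse mult.commute del: inner_diff_right inner_diff_left)
            then show ?thesis unfolding dot_square_norm s_def by (simp add: power2_eq_square)
          qed
          ultimately show ?thesis using r' by simp
        qed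
        then show "norm u \<in> insert 0 A" "r * s - \<sigma> r \<le> u \<bullet> (y1 - y0) - \<sigma> (norm u) - e * \<kappa> (norm u) + e * \<rho> s"
          by auto
      qed
      have 1: "(1 - t) * (x0 \<bullet> y0) + t * (x1 \<bullet> y1) \<le> xt \<bullet> yt + t * (1 - t) * (r * s)"
      proof -
        have "(1 - t) * (x0 \<bullet> y0) + t * (x1 \<bullet> y1) = xt \<bullet> yt + t * (1 - t) * ((x1 - x0) \<bullet> (y1 - y0))"
          unfolding xt_def yt_def inner_add_left inner_add_right inner_scaleR_left inner_scaleR_right
            inner_diff_left inner_diff_right by algebra
        moreover have "t * (1 - t) * ((x1 - x0) \<bullet> (y1 - y0)) \<le> t * (1 - t) * (r * s)"
          using norm_cauchy_schwarz[of "x1 - x0" "y1 - y0"] t by (intro mult_left_mono) (auto simp: r_def s_def)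
        ultimately show ?thesis by simp
      qed
      have 2: "Psi f yt + t * (1 - t) * (u \<bullet> (y1 - y0) - \<sigma> (norm u) - e * \<kappa> (norm u)) \<le> (1 - t) * Psi f y0 + t * Psi f y1"
        unfolding yt_def by (rule Psi_modulus[OF f u(1) t])
      have 3: "q yt + t * (1 - t) * \<rho> s \<le> (1 - t) * q y0 + t * q y1"
        unfolding yt_def s_def using q_convex[OF t] True by auto
      have 4: "t * (1 - t) * (r * s - \<sigma> r) \<le> t * (1 - t) * (u \<bullet> (y1 - y0) - \<sigma> (norm u) - e * \<kappa> (norm u) + e * \<rho> s)"
        using u t by (intro mult_left_mono) auto
      have "e * ((1 - t) * G x0 y0 + t * G x1 y1) = (1 - t) * (x0 \<bullet> y0) + t * (x1 \<bullet> y1) - ((1 - t) * Psi f y0 + t * Psi f y1) - e * ((1 - t) * q y0 + t * q y1)"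
      proof -
        have "e * ((1 - t) * G x0 y0 + t * G x1 y1) = (1 - t) * (e * G x0 y0) + t * (e * G x1 y1)" by algebra
        then show ?thesis unfolding eG by algebra
      qed
      also have "\<dots> \<le> xt \<bullet> yt + t * (1 - t) * (r * s) - (Psi f yt + t * (1 - t) * (u \<bullet> (y1 - y0) - \<sigma> (norm u) - e * \<kappa> (norm u))) - e * (q yt + t * (1 - t) * \<rho> s)"
        using 1 2 3 e by (intro diff_mono mult_left_mono) auto
      also have "\<dots> = xt \<bullet> yt - Psi f yt - e * q yt + t * (1 - t) * (r * s) - t * (1 - t) * (u \<bullet> (y1 - y0) - \<sigma> (norm u) - e * \<kappa> (norm u) + e * \<rho> s)"
        by (simp add: algebra_simps)
      also have "\<dots> \<le> xt \<bullet> yt - Psi f yt - e * q yt + t * (1 - t) * \<sigma> r"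
        using 4 by (simp add: right_diff_distrib)
      also have "\<dots> = e * (G xt yt + c)" unfolding distrib_left eG using e by (simp add: c_def)
      finally have "(1 - t) * G x0 y0 + t * G x1 y1 \<le> G xt yt + c" using e by simp
      then show ?thesis using True yt unfolding yt_def[symmetric]
        by (simp add: F_def powr_def exp_add[symmetric] add.commute)
    next
      case False
      then show ?thesis using F_nonneg by (auto simp: F_def)
    qed
  qed (use F_nonneg in auto)
  then have "ln ((LINT y|lborel. F x0 y) powr (1 - t) * (LINT y|lborel. F x1 y) powr t) \<le> ln (exp c * (LINT y|lborel. F xt y))"
    using pos[of x0] pos[of x1] pos[of xt] by (subst ln_le_cancel_iff) auto
  then have "(1 - t) * ln (LINT y|lborel. F x0 y) + t * ln (LINT y|lborel. F x1 y) \<le> c + ln (LINT y|lborel. F xt y)"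
    using pos[of x0] pos[of x1] pos[of xt] by (simp add: ln_mult ln_powr)
  then have "e * ((1 - t) * ln (LINT y|lborel. F x0 y) + t * ln (LINT y|lborel. F x1 y)) \<le> e * (c + ln (LINT y|lborel. F xt y))"
    using e by (intro mult_left_mono) auto
  then show "(1 - t) * Sk f x0 + t * Sk f x1 \<le> Sk f ((1 - t) *\<^sub>R x0 + t *\<^sub>R x1) + t * (1 - t) * \<sigma> (norm (x1 - x0))"
  proof -
    assume *: "e * ((1 - t) * ln (LINT y|lborel. F x0 y) + t * ln (LINT y|lborel. F x1 y)) \<le> e * (c + ln (LINT y|lborel. F xt y))"
    have "e * c = t * (1 - t) * \<sigma> r" using e by (simp add: c_def)
    then show ?thesis
      using * unfolding Sk_def FN xt_def[symmetric] r_def[symmetric] by (simp only: distrib_left mult.left_commute)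
  qed
qed
end

text \<open>Jensen's inequality with its equality case, both read off from the nonnegative integrand
  \<open>exp u - 1 - u\<close>, which vanishes only at 0.\<close>

lemma integral_nonpos_of_integral_exp_eq_1:
  fixes u :: "'a \<Rightarrow> real"
  assumes M: "emeasure M (space M) = 1"
    and int: "integrable M u" "integrable M (\<lambda>x. exp (u x))" and 1: "(LINT x|M. exp (u x)) = 1"
  shows "(LINT x|M. u x) \<le> 0" and "(LINT x|M. u x) = 0 \<Longrightarrow> AE x in M. u x = 0"
proof -
  interpret finite_measure M by (rule finite_measureI) (simp add: M)
  have m: "measure M (space M) = 1" using M by (simp add: measure_def)
  have nn: "0 \<le> exp (u x) - 1 - u x" for x using exp_ge_add_one_self[of "u x"] by linarith
  have int': "integrable M (\<lambda>x. exp (u x) - 1 - u x)" using int by auto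
  have eq: "(LINT x|M. exp (u x) - 1 - u x) = - (LINT x|M. u x)"
    using int 1 m by simp
  have "0 \<le> (LINT x|M. exp (u x) - 1 - u x)" using nn by (intro integral_nonneg_AE) auto
  then show "(LINT x|M. u x) \<le> 0" using eq by simp
  assume "(LINT x|M. u x) = 0"
  then have "AE x in M. exp (u x) - 1 - u x = 0"
    using integral_nonneg_eq_0_iff_AE[OF int'] nn eq by simp
  then show "AE x in M. u x = 0"
  proof eventually_elim
    fix x assume *: "exp (u x) - 1 - u x = 0"
    show "u x = 0"
      using ln_eq_minus_one[of "exp (u x)"] * by simp

  qed
qed

text \<open>Arzela-Ascoli in pointwise form: a diagonal argument on a countable dense set, after
  which equicontinuity carries the Cauchy property to every point.\<close>

lemma pointwise_convergent_subsequence: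
  fixes F :: "nat \<Rightarrow> 'a::euclidean_space \<Rightarrow> real"
  assumes bdd: "\<And>x. \<exists>B. \<forall>n. \<bar>F n x\<bar> \<le> B"
    and equi: "\<And>x e. e > 0 \<Longrightarrow> \<exists>d>0. \<forall>n y. dist y x < d \<longrightarrow> \<bar>F n y - F n x\<bar> < e"
  obtains k f where "strict_mono (k :: nat \<Rightarrow> nat)" "\<And>x. (\<lambda>n. F (k n) x) \<longlonglongrightarrow> f x"
proof -
  obtain B where B: "\<And>x n. \<bar>F n x\<bar> \<le> B x" using bdd by metis
  have B0: "0 \<le> B x" for x using B[of 0 x] by simp
  obtain D :: "'a set" where D: "countable D" "\<And>X. open X \<Longrightarrow> X \<noteq> {} \<Longrightarrow> \<exists>d\<in>D. d \<in> X"
    using countable_dense_exists by metis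
  \<comment> \<open>The diagonal lemma asks for one bound at all points, so the functions are first
    divided by \<open>1 + B x\<close>.\<close>
  obtain k :: "nat \<Rightarrow> nat" where k: "strict_mono k" "\<And>x. x \<in> D \<Longrightarrow> \<exists>l. (\<lambda>n. F (k n) x / (1 + B x)) \<longlonglongrightarrow> l"
  proof (rule function_convergent_subsequence[OF D(1), of "\<lambda>n x. F n x / (1 + B x)" 1])
    fix n x show "norm (F n x / (1 + B x)) \<le> 1" using B[of n x] B0[of x] by (simp add: divide_simps)
  qed blast
  have "convergent (\<lambda>n. F (k n) x)" for x
    unfolding Cauchy_convergent_iff[symmetric]
  proof (rule metric_CauchyI)
    fix e :: real assume e: "0 < e"
    obtain d where d: "d > 0" "\<And>n y. dist y x < d \<Longrightarrow> \<bar>F n y - F n x\<bar> < e / 3"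
      using equi[of "e / 3" x] e by auto
    obtain z where z: "z \<in> D" "dist z x < d"
      using D(2)[of "ball x d"] d by (auto simp: dist_commute)
    obtain l where "(\<lambda>n. F (k n) z / (1 + B z)) \<longlonglongrightarrow> l" using k(2)[OF z(1)] by auto
    then have "(\<lambda>n. F (k n) z / (1 + B z) * (1 + B z)) \<longlonglongrightarrow> l * (1 + B z)" by (intro tendsto_mult tendsto_const)
    moreover have "1 + B z \<noteq> 0" using B0[of z] by linarith
    ultimately have "Cauchy (\<lambda>n. F (k n) z)" by (simp add: LIMSEQ_imp_Cauchy)
    then obtain M where M: "\<And>m n. m \<ge> M \<Longrightarrow> n \<ge> M \<Longrightarrow> dist (F (k m) z) (F (k n) z) < e / 3"
      using metric_CauchyD[of _ "e / 3"] e by (metis divide_pos_pos zero_less_numeral)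
    have "dist (F (k m) x) (F (k n) x) < e" if "m \<ge> M" "n \<ge> M" for m n
      using M[OF that] d(2)[OF z(2), of "k m"] d(2)[OF z(2), of "k n"] unfolding dist_real_def by linarith
    then show "\<exists>M. \<forall>m\<ge>M. \<forall>n\<ge>M. dist (F (k m) x) (F (k n) x) < e" by auto
  qed
  then have "\<forall>x. \<exists>l. (\<lambda>n. F (k n) x) \<longlonglongrightarrow> l" by (simp add: convergent_def)
  then show ?thesis using that k(1) by metis
qed

section \<open>The dual functional and its minimiser\<close>

context entropic_transport
begin

text \<open>Adding a constant to a potential changes neither \<open>J\<close> nor the coupling;
  \<open>f 0 = 0\<close> picks a representative and makes the class compact for pointwise
  convergence.\<close>

definition K :: "('a \<Rightarrow> real) set" where
  "K = {f. R-lipschitz_on UNIV f \<and> f 0 = 0 \<and> smooth f}"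

text \<open>The entropic dual functional of a pair of potentials with the second one already
  minimised out: \<open>Psi f\<close> is the optimal partner of f and makes the exponential penalty
  term constant.\<close>

definition J :: "('a \<Rightarrow> real) \<Rightarrow> real" where
  "J f = (LINT x|M. f x) + (LINT y|N. Psi f y)"

lemma integrable_norm_M: "integrable M (\<lambda>x. norm x)"
proof (rule Bochner_Integration.integrable_bound[OF integrable_exp_norm[of 1]])
  show "AE x in M. norm (norm x) \<le> norm (exp (1 * norm x))"
    using exp_ge_add_one_self by (intro AE_I2) (smt (verit) norm_ge_zero real_norm_def)
qed measurable

lemma integrable_lipschitz:
  fixes f :: "'a \<Rightarrow> real"
  assumes f: "R-lipschitz_on UNIV f"
  shows "integrable M f"
proof (rule Bochner_Integration.integrable_bound)
  show "integrable M (\<lambda>x. \<bar>f 0\<bar> + R * norm x)" using integrable_norm_M by auto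
  show "f \<in> borel_measurable M" using lipschitz_measurable[OF f] by simp
  show "AE x in M. norm (f x) \<le> norm (\<bar>f 0\<bar> + R * norm x)"
    using lipschitz_bound[OF f] R by (intro AE_I2) (smt (verit) norm_ge_zero real_norm_def zero_le_mult_iff)
qed

lemma integrable_N_Psi:
  assumes f: "R-lipschitz_on UNIV f"
  shows "integrable N (Psi f)"
proof -
  define C where "C = \<bar>psi_lo - f 0\<bar> + \<bar>psi_hi - f 0\<bar>"
  show ?thesis
  proof (rule N.integrable_const_bound)
    show "Psi f \<in> borel_measurable N" using measurable_Psi[OF f] by simp
    show "AE y in N. norm (Psi f y) \<le> C"
      using AE_N
    proof eventually_elim
      fix y assume "y \<in> S"
      then have "norm y \<le> R" using S_bounded by auto
      from Psi_bounds[OF f this] show "norm (Psi f y) \<le> C" unfolding C_def real_norm_def by linarith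
    qed
  qed
qed

lemma Psi_shift: "R-lipschitz_on UNIV f \<Longrightarrow> Psi (\<lambda>x. f x - c) y = Psi f y + c"
proof -
  assume f: "R-lipschitz_on UNIV f"
  have "exp ((x \<bullet> y - (f x - c)) / e) = exp (c / e) * exp ((x \<bullet> y - f x) / e)" for x
    by (simp add: exp_add[symmetric] add_divide_distrib diff_divide_distrib)
  then show ?thesis
    using integral_exp_pos[OF integrable_Psi[OF f, of y]] e
    by (simp add: Psi_def emeasure_MN ln_mult algebra_simps)
qed

lemma Sk_shift: "R-lipschitz_on UNIV f \<Longrightarrow> Sk (\<lambda>x. f x - c) x = Sk f x - c"
proof -
  assume f: "R-lipschitz_on UNIV f"
  have "exp ((x \<bullet> y - (Psi f y + c)) / e) = exp (- c / e) * exp ((x \<bullet> y - Psi f y) / e)" for y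
    by (simp add: exp_add[symmetric] add_divide_distrib diff_divide_distrib)
  then show ?thesis
    using integral_exp_pos[OF integrable_Sk[OF f, of x]] e
    by (simp add: Sk_def Psi_shift[OF f] emeasure_MN ln_mult algebra_simps)
qed

lemma lipschitz_shift: "R-lipschitz_on UNIV f \<Longrightarrow> R-lipschitz_on UNIV (\<lambda>x. f x - c)" for f :: "'a \<Rightarrow> real"
  by (simp add: lipschitz_on_def dist_real_def)

lemma Sk_mem_K:
  assumes f: "f \<in> K"
  shows "(\<lambda>x. Sk f x - Sk f 0) \<in> K"
proof -
  have "R-lipschitz_on UNIV (Sk f)" "smooth (Sk f)" using f lipschitz_Sk smooth_Sk by (auto simp: K_def)
  then show ?thesis using lipschitz_shift by (auto simp: K_def smooth_def algebra_simps)
qed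

text \<open>The constant \<open>c\<close> is kept free: with \<open>c = Psi f y\<close> the value is
  1, and with the partner of another function it is the density to which Jensen's inequality is
  applied.\<close>

lemma nn_integral_exp_Psi:
  assumes f: "R-lipschitz_on UNIV f"
  shows "(\<integral>\<^sup>+x. ennreal (exp ((x \<bullet> y - f x - c) / e)) \<partial>M) = ennreal (exp ((Psi f y - c) / e))"
proof -
  have "exp ((x \<bullet> y - f x - c) / e) = exp (- c / e) * exp ((x \<bullet> y - f x) / e)" for x
    by (simp add: exp_add[symmetric] add_divide_distrib diff_divide_distrib)
  then have "(\<integral>\<^sup>+x. ennreal (exp ((x \<bullet> y - f x - c) / e)) \<partial>M) = ennreal (LINT x|M. exp (- c / e) * exp ((x \<bullet> y - f x) / e))"
    using integrable_Psi[OF f, of y] by (simp only:) (intro nn_integral_eq_integral; auto)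
  also have "(LINT x|M. exp (- c / e) * exp ((x \<bullet> y - f x) / e)) = exp ((Psi f y - c) / e)"
    by (simp only: integral_mult_right_zero exp_Psi[OF f, symmetric]) (simp add: exp_add[symmetric] diff_divide_distrib)
  finally show ?thesis .
qed

lemma nn_integral_exp_Sk:
  assumes f: "R-lipschitz_on UNIV f"
  shows "(\<integral>\<^sup>+y. ennreal (exp ((x \<bullet> y - c - Psi f y) / e)) \<partial>N) = ennreal (exp ((Sk f x - c) / e))"
proof -
  have "exp ((x \<bullet> y - c - Psi f y) / e) = exp (- c / e) * exp ((x \<bullet> y - Psi f y) / e)" for y
    by (simp add: exp_add[symmetric] add_divide_distrib diff_divide_distrib)
  then have "(\<integral>\<^sup>+y. ennreal (exp ((x \<bullet> y - c - Psi f y) / e)) \<partial>N) = ennreal (LINT y|N. exp (- c / e) * exp ((x \<bullet> y - Psi f y) / e))"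
    using integrable_Sk[OF f, of x] by (simp only:) (intro nn_integral_eq_integral; auto)
  also have "(LINT y|N. exp (- c / e) * exp ((x \<bullet> y - Psi f y) / e)) = exp ((Sk f x - c) / e)"
    by (simp only: integral_mult_right_zero exp_Sk[OF f, symmetric]) (simp add: exp_add[symmetric] diff_divide_distrib)
  finally show ?thesis .
qed

lemma integral_exp_eq_1:
  fixes u :: "'b \<Rightarrow> real"
  assumes "(\<integral>\<^sup>+x. ennreal (exp (u x)) \<partial>L) = 1" "u \<in> borel_measurable L"
  shows "integrable L (\<lambda>x. exp (u x))" "(LINT x|L. exp (u x)) = 1"
proof -
  show "integrable L (\<lambda>x. exp (u x))" using assms by (intro integrableI_nonneg) auto
  show "(LINT x|L. exp (u x)) = 1" using assms by (subst integral_eq_nn_integral) auto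
qed

text \<open>\<open>exp ((Sk f x - f x) / e)\<close> is the density of the first marginal of the
  coupling built from f and \<open>Psi f\<close>. The second marginal of that coupling is exact, so
  by Fubini the density has integral 1, and Jensen's inequality compares \<open>Sk f\<close> with f.
  The pair \<open>Sk f\<close>, \<open>Psi f\<close> has an exact first marginal, and the same
  exchange compares \<open>Psi (Sk f)\<close> with \<open>Psi f\<close>. Thus each half of
  \<open>J\<close> decreases separately.\<close>

lemma integral_Sk_le:
  assumes f: "R-lipschitz_on UNIV f"
  shows "(LINT x|M. Sk f x) \<le> (LINT x|M. f x)"
    and "(LINT x|M. Sk f x) = (LINT x|M. f x) \<Longrightarrow> AE x in M. Sk f x = f x"
    and "(LINT y|N. Psi (Sk f) y) \<le> (LINT y|N. Psi f y)"
proof -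
  have S: "R-lipschitz_on UNIV (Sk f)" by (rule lipschitz_Sk[OF f])
  have [measurable]: "f \<in> borel_measurable borel" "Sk f \<in> borel_measurable borel"
    using lipschitz_measurable f S by auto
  have [measurable]: "Psi f \<in> borel_measurable borel" "Psi (Sk f) \<in> borel_measurable borel"
    using measurable_Psi f S by auto
  have intM: "integrable M (\<lambda>x. (Sk f x - f x) / e)" and intN: "integrable N (\<lambda>y. (Psi (Sk f) y - Psi f y) / e)"
    using integrable_lipschitz[OF f] integrable_lipschitz[OF S] integrable_N_Psi[OF f] integrable_N_Psi[OF S] by auto
  have "(\<integral>\<^sup>+x. ennreal (exp ((Sk f x - f x) / e)) \<partial>M) = (\<integral>\<^sup>+x. \<integral>\<^sup>+y. ennreal (exp ((x \<bullet> y - f x - Psi f y) / e)) \<partial>N \<partial>M)"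
    by (simp add: nn_integral_exp_Sk[OF f])
  also have "\<dots> = (\<integral>\<^sup>+y. \<integral>\<^sup>+x. ennreal (exp ((x \<bullet> y - f x - Psi f y) / e)) \<partial>M \<partial>N)"
    by (rule MN.Fubini'[symmetric]) measurable
  also have "\<dots> = 1" by (simp add: nn_integral_exp_Psi[OF f] emeasure_MN)
  finally have 1: "(\<integral>\<^sup>+x. ennreal (exp ((Sk f x - f x) / e)) \<partial>M) = 1" .
  note 2 = integral_exp_eq_1[OF 1, simplified]
  note 3 = integral_nonpos_of_integral_exp_eq_1[of M, OF _ intM 2]
  have eq: "(LINT x|M. (Sk f x - f x) / e) = ((LINT x|M. Sk f x) - (LINT x|M. f x)) / e"
    using integrable_lipschitz[OF f] integrable_lipschitz[OF S] by simp
  show "(LINT x|M. Sk f x) \<le> (LINT x|M. f x)"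
    using 3(1) e unfolding eq by (simp add: emeasure_MN divide_simps)
  show "AE x in M. Sk f x = f x" if "(LINT x|M. Sk f x) = (LINT x|M. f x)"
    using 3(2) e that unfolding eq by (simp add: emeasure_MN)
  have "(\<integral>\<^sup>+y. ennreal (exp ((Psi (Sk f) y - Psi f y) / e)) \<partial>N) = (\<integral>\<^sup>+y. \<integral>\<^sup>+x. ennreal (exp ((x \<bullet> y - Sk f x - Psi f y) / e)) \<partial>M \<partial>N)"
    by (simp add: nn_integral_exp_Psi[OF S])
  also have "\<dots> = (\<integral>\<^sup>+x. \<integral>\<^sup>+y. ennreal (exp ((x \<bullet> y - Sk f x - Psi f y) / e)) \<partial>N \<partial>M)"
    by (rule MN.Fubini') measurable
  also have "\<dots> = 1" by (simp add: nn_integral_exp_Sk[OF f] emeasure_MN)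
  finally have 4: "(\<integral>\<^sup>+y. ennreal (exp ((Psi (Sk f) y - Psi f y) / e)) \<partial>N) = 1" .
  note 5 = integral_exp_eq_1[OF 4, simplified]
  note 6 = integral_nonpos_of_integral_exp_eq_1[of N, OF _ intN 5]
  show "(LINT y|N. Psi (Sk f) y) \<le> (LINT y|N. Psi f y)"
    using 6(1) e integrable_N_Psi[OF f] integrable_N_Psi[OF S] by (simp add: emeasure_MN divide_simps)
qed

lemma J_shift: "R-lipschitz_on UNIV f \<Longrightarrow> J (\<lambda>x. f x - c) = J f"
  using integrable_lipschitz[of f] integrable_N_Psi[of f] by (simp add: J_def Psi_shift)

lemma K_compact:
  assumes F: "\<And>n. F n \<in> K"
  obtains k f where "strict_mono (k :: nat \<Rightarrow> nat)" "\<And>x. (\<lambda>n. F (k n) x) \<longlonglongrightarrow> f x" "f \<in> K"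
proof -
  have lip: "R-lipschitz_on UNIV (F n)" and F0: "F n 0 = 0" and sm: "smooth (F n)" for n using F by (auto simp: K_def)
  have d: "\<bar>F n x - F n y\<bar> \<le> R * dist x y" for n x y
    using lipschitz_onD[OF lip] by (auto simp: dist_real_def)
  obtain k f where k: "strict_mono (k :: nat \<Rightarrow> nat)" and f: "\<And>x. (\<lambda>n. F (k n) x) \<longlonglongrightarrow> f x"
  proof (rule pointwise_convergent_subsequence[of F])
    fix x
    show "\<exists>B. \<forall>n. \<bar>F n x\<bar> \<le> B" using lipschitz_bound[OF lip] F0 by auto
    fix \<epsilon> :: real assume "\<epsilon> > 0"
    then have "\<bar>F n y - F n x\<bar> < \<epsilon>" if "dist y x < \<epsilon> / (R + 1)" for n y
    proof -
      have "\<bar>F n y - F n x\<bar> \<le> R * dist y x" by (rule d)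
      also have "\<dots> \<le> (R + 1) * dist y x" by (simp add: algebra_simps)
      also have "\<dots> < \<epsilon>" using that R by (simp add: field_simps)
      finally show ?thesis .
    qed
    then show "\<exists>d>0. \<forall>n y. dist y x < d \<longrightarrow> \<bar>F n y - F n x\<bar> < \<epsilon>"
      using \<open>\<epsilon> > 0\<close> R by (intro exI[of _ "\<epsilon> / (R + 1)"]) auto
  qed blast
  have "f \<in> K"
    unfolding K_def smooth_def
  proof (intro CollectI conjI allI impI; (elim conjE)?)
    show "R-lipschitz_on UNIV f"
    proof (rule lipschitz_onI[OF _ R])
      fix x y
      have "(\<lambda>n. \<bar>F (k n) x - F (k n) y\<bar>) \<longlonglongrightarrow> \<bar>f x - f y\<bar>" by (intro tendsto_intros f)
      then show "dist (f x) (f y) \<le> R * dist x y"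
        unfolding dist_real_def[of "f x"] by (rule LIMSEQ_le_const2) (use d in auto)
    qed
    show "f 0 = 0" using f[of 0] F0 by (simp add: LIMSEQ_const_iff)
    fix t :: real and x0 x1 :: 'a assume t: "0 < t" "t < 1" "norm (x1 - x0) \<in> A"
    show "(1 - t) * f x0 + t * f x1 \<le> f ((1 - t) *\<^sub>R x0 + t *\<^sub>R x1) + t * (1 - t) * \<sigma> (norm (x1 - x0))"
    proof (rule LIMSEQ_le)
      show "(\<lambda>n. (1 - t) * F (k n) x0 + t * F (k n) x1) \<longlonglongrightarrow> (1 - t) * f x0 + t * f x1"
        by (intro tendsto_intros f)
      show "(\<lambda>n. F (k n) ((1 - t) *\<^sub>R x0 + t *\<^sub>R x1) + t * (1 - t) * \<sigma> (norm (x1 - x0)))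
          \<longlonglongrightarrow> f ((1 - t) *\<^sub>R x0 + t *\<^sub>R x1) + t * (1 - t) * \<sigma> (norm (x1 - x0))"
        by (intro tendsto_intros f)
    qed (use sm t in \<open>auto simp: smooth_def\<close>)
  qed
  then show ?thesis using that k f by blast
qed

lemma J_continuous:
  assumes F: "\<And>n. F n \<in> K" and f: "f \<in> K" and lim: "\<And>x. (\<lambda>n. F n x) \<longlonglongrightarrow> f x"
  shows "(\<lambda>n. J (F n)) \<longlonglongrightarrow> J f"
proof -
  have lF: "R-lipschitz_on UNIV (F n)" "F n 0 = 0" for n using F by (auto simp: K_def)
  have lf: "R-lipschitz_on UNIV f" "f 0 = 0" using f by (auto simp: K_def)
  have [measurable]: "F n \<in> borel_measurable borel" "f \<in> borel_measurable borel" for n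
    using lipschitz_measurable lF lf by auto
  have [measurable]: "Psi (F n) \<in> borel_measurable borel" "Psi f \<in> borel_measurable borel" for n
    using measurable_Psi lF lf by auto
  have 1: "(\<lambda>n. \<integral>x. F n x \<partial>M) \<longlonglongrightarrow> (LINT x|M. f x)"
  proof (rule integral_dominated_convergence[where w = "\<lambda>x. R * norm x"])
    show "AE x in M. norm (F n x) \<le> R * norm x" for n
      using lipschitz_bound[OF lF(1)] lF(2) by (intro AE_I2) (metis diff_zero real_norm_def)
  qed (use lim integrable_norm_M in auto)
  have P: "(\<lambda>n. Psi (F n) y) \<longlonglongrightarrow> Psi f y" if y: "norm y \<le> R" for y
  proof -
    have "(\<lambda>n. \<integral>x. exp ((x \<bullet> y - F n x) / e) \<partial>M) \<longlonglongrightarrow> (LINT x|M. exp ((x \<bullet> y - f x) / e))"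
    proof (rule integral_dominated_convergence[where w = "\<lambda>x. exp (2 * R / e * norm x)"])
      show "AE x in M. (\<lambda>n. exp ((x \<bullet> y - F n x) / e)) \<longlonglongrightarrow> exp ((x \<bullet> y - f x) / e)"
        using e by (intro AE_I2 tendsto_intros lim) auto
      show "AE x in M. norm (exp ((x \<bullet> y - F n x) / e)) \<le> exp (2 * R / e * norm x)" for n
      proof (intro AE_I2)
        fix x
        have "x \<bullet> y \<le> norm x * R" using norm_cauchy_schwarz[of x y] mult_left_mono[OF y, of "norm x"] by simp
        then have "x \<bullet> y - F n x \<le> 2 * R * norm x"
          using lipschitz_bound[OF lF(1)[of n], of x] lF(2) by (simp add: algebra_simps)
        then have "(x \<bullet> y - F n x) / e \<le> 2 * R * norm x / e" using e by (intro divide_right_mono) auto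
        then show "norm (exp ((x \<bullet> y - F n x) / e)) \<le> exp (2 * R / e * norm x)" by simp
      qed
    qed (use integrable_exp_norm in measurable)
    then show ?thesis unfolding Psi_def
      using integral_exp_pos[OF integrable_Psi[OF lf(1), of y]]
      by (intro tendsto_intros) (auto simp: emeasure_MN)
  qed
  define C where "C = \<bar>psi_lo\<bar> + \<bar>psi_hi\<bar>"
  have 2: "(\<lambda>n. \<integral>y. Psi (F n) y \<partial>N) \<longlonglongrightarrow> (LINT y|N. Psi f y)"
  proof (rule integral_dominated_convergence[where w = "\<lambda>y. C"])
    show "AE y in N. (\<lambda>n. Psi (F n) y) \<longlonglongrightarrow> Psi f y"
      using AE_N by eventually_elim (use S_bounded P in auto)
    show "AE y in N. norm (Psi (F n) y) \<le> C" for n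
      using AE_N
    proof eventually_elim
      fix y assume "y \<in> S"
      then have "norm y \<le> R" using S_bounded by auto
      from Psi_bounds[OF lF(1)[of n] this] show "norm (Psi (F n) y) \<le> C"
        unfolding C_def real_norm_def lF by linarith
    qed
  qed auto
  show ?thesis unfolding J_def by (intro tendsto_add 1 2)
qed

lemma ex_minimizer: "\<exists>f\<in>K. \<forall>g\<in>K. J f \<le> J g"
proof -
  have K0: "(\<lambda>x. 0) \<in> K"
    using R \<sigma>_nonneg by (auto simp: K_def smooth_def lipschitz_on_def)
  define C where "C = psi_lo - (LINT x|M. R * norm x)"
  have C: "C \<le> J f" if "f \<in> K" for f
  proof -
    have lf: "R-lipschitz_on UNIV f" "f 0 = 0" using that by (auto simp: K_def)
    have "- (R * norm x) \<le> f x" for x using lipschitz_bound[OF lf(1), of x] lf(2) by linarith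
    then have "(LINT x|M. - (R * norm x)) \<le> (LINT x|M. f x)"
      using integrable_norm_M integrable_lipschitz[OF lf(1)]
      by (intro integral_mono) auto
    moreover have "(LINT y|N. psi_lo) \<le> (LINT y|N. Psi f y)"
    proof (rule integral_mono_AE)
      show "AE y in N. psi_lo \<le> Psi f y"
        using AE_N
      proof eventually_elim
        fix y assume "y \<in> S"
        then have "norm y \<le> R" using S_bounded by auto
        from Psi_bounds(1)[OF lf(1) this] show "psi_lo \<le> Psi f y"
          using lf(2) by simp
      qed
    qed (use integrable_N_Psi[OF lf(1)] in auto)
    ultimately show ?thesis unfolding J_def C_def by simp
  qed
  define m where "m = Inf (J ` K)"
  have bdd: "bdd_below (J ` K)" using C by (auto intro!: bdd_belowI)
  have "\<exists>f\<in>K. J f < m + 1 / real (Suc n)" for n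
  proof -
    have "Inf (J ` K) < m + 1 / real (Suc n)" by (simp add: m_def)
    then show ?thesis using cInf_less_iff[OF _ bdd] K0 by auto
  qed
  then obtain F where F: "\<And>n. F n \<in> K" "\<And>n. J (F n) < m + 1 / real (Suc n)" by metis
  obtain k f where k: "strict_mono (k :: nat \<Rightarrow> nat)" and f: "\<And>x. (\<lambda>n. F (k n) x) \<longlonglongrightarrow> f x" "f \<in> K"
    using K_compact[of F] F(1) by metis
  have "(\<lambda>n. J (F (k n))) \<longlonglongrightarrow> J f" by (rule J_continuous) (use F f in auto)
  moreover have "(\<lambda>n. m + 1 / real (Suc (k n))) \<longlonglongrightarrow> m + 0"
    using LIMSEQ_subseq_LIMSEQ[OF LIMSEQ_inverse_real_of_nat k]
    by (intro tendsto_add tendsto_const) (simp add: o_def inverse_eq_divide)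
  ultimately have "J f \<le> m + 0"
    by (rule LIMSEQ_le) (use F(2) less_imp_le in blast)
  moreover have "m \<le> J g" if "g \<in> K" for g
    unfolding m_def using bdd that by (auto intro: cInf_lower)
  ultimately show ?thesis using f(2) by force
qed

text \<open>Minimality turns the first inequality of \<open>integral_Sk_le\<close> into an equality,
  so \<open>Sk f = f\<close> almost everywhere for \<open>M\<close>. \<open>Psi\<close> does not see
  null sets, hence \<open>Psi (Sk f) = Psi f\<close>, and \<open>Sk f\<close> is fixed at every
  point. The potential is therefore \<open>Sk f\<close>, normalised at 0, rather than f; being an
  iterate it is also convex.\<close>

lemma ex_entropic_potential:
  obtains f \<psi> where "convex_on UNIV f" "f 0 = 0" "smooth f" "\<psi> \<in> borel_measurable borel"
    "\<And>y. (\<integral>\<^sup>+x. ennreal (gibbs e f \<psi> x y) \<partial>M) = 1"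
    "\<And>x. (\<integral>\<^sup>+y. ennreal (gibbs e f \<psi> x y) \<partial>N) = 1"
proof -
  obtain f where f: "f \<in> K" and min: "\<And>g. g \<in> K \<Longrightarrow> J f \<le> J g" using ex_minimizer by auto
  have lf: "R-lipschitz_on UNIV f" using f by (auto simp: K_def)
  have lS: "R-lipschitz_on UNIV (Sk f)" by (rule lipschitz_Sk[OF lf])
  have "J f \<le> J (Sk f)" using min[OF Sk_mem_K[OF f]] J_shift[OF lS] by simp
  then have "(LINT x|M. Sk f x) = (LINT x|M. f x)"
    using integral_Sk_le(1,3)[OF lf] by (simp add: J_def)
  then have ae: "AE x in M. Sk f x = f x" by (rule integral_Sk_le(2)[OF lf])
  have [measurable]: "f \<in> borel_measurable borel" "Sk f \<in> borel_measurable borel"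
    using lipschitz_measurable lf lS by auto
  have PS: "Psi (Sk f) = Psi f"
  proof
    fix y
    have "(LINT x|M. exp ((x \<bullet> y - Sk f x) / e)) = (LINT x|M. exp ((x \<bullet> y - f x) / e))"
      by (rule integral_cong_AE) (use ae in \<open>measurable, auto\<close>)
    then show "Psi (Sk f) y = Psi f y" by (simp add: Psi_def)
  qed
  have SS: "Sk (Sk f) x = Sk f x" for x
    by (subst Sk_def, subst PS, rule Sk_def[symmetric])
  define g where "g x = Sk f x - Sk f 0" for x
  have gK: "g \<in> K" unfolding g_def[abs_def] by (rule Sk_mem_K[OF f])
  have lg: "R-lipschitz_on UNIV g" using gK by (auto simp: K_def)
  have Sg: "Sk g x = g x" for x
    unfolding g_def[abs_def] using Sk_shift[OF lS] SS by simp
  have [measurable]: "g \<in> borel_measurable borel" "Psi g \<in> borel_measurable borel"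
    using lipschitz_measurable measurable_Psi lg by auto
  show ?thesis
  proof
    show "convex_on UNIV g" using convex_Sk[OF lg] ext[of "Sk g" g, OF Sg] by simp
    show "g 0 = 0" "smooth g" using gK by (auto simp: K_def)
    show "Psi g \<in> borel_measurable borel" by simp
    show "(\<integral>\<^sup>+x. ennreal (gibbs e g (Psi g) x y) \<partial>M) = 1" for y
      using nn_integral_exp_Psi[OF lg, of y "Psi g y"] by simp
    show "(\<integral>\<^sup>+y. ennreal (gibbs e g (Psi g) x y) \<partial>N) = 1" for x
      using nn_integral_exp_Sk[OF lg, of x "g x"] Sg[of x] by simp
  qed
qed

end

section \<open>The modulus of smoothness\<close>

text \<open>With r for the last argument, this is the larger root s of \<open>\<beta> / 2 *
  s\<^sup>2 - 2 * Lb * s = \<alpha> / 2 * r\<^sup>2 + 2 * La * r\<close>.\<close>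

definition sigma_slope :: "real \<Rightarrow> real \<Rightarrow> real \<Rightarrow> real \<Rightarrow> real \<Rightarrow> real" where
  "sigma_slope La Lb \<alpha> \<beta> s = sqrt (4 * Lb\<^sup>2 / \<beta>\<^sup>2 + 4 * La / \<beta> * s + \<alpha> / \<beta> * s\<^sup>2) + 2 * Lb / \<beta>"

lemma sigma_ab_eq: "sigma_ab La Lb \<alpha> \<beta> r = integral {0..r} (sigma_slope La Lb \<alpha> \<beta>)"
  by (simp add: sigma_ab_def sigma_slope_def[abs_def])

lemma sigma_ab_0[simp]: "sigma_ab La Lb \<alpha> \<beta> 0 = 0"
  by (simp add: sigma_ab_def)

lemma continuous_sigma_slope: "continuous_on X (sigma_slope La Lb \<alpha> \<beta>)"
  unfolding sigma_slope_def[abs_def] by (intro continuous_intros)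

lemma integrable_sigma_slope: "sigma_slope La Lb \<alpha> \<beta> integrable_on {u..v}"
  by (intro integrable_continuous_real continuous_sigma_slope)

context
  fixes La Lb \<alpha> \<beta> :: real
  assumes L: "0 \<le> La" "0 \<le> Lb" and \<alpha>: "0 \<le> \<alpha>" and \<beta>: "0 < \<beta>"
begin

lemma sigma_slope_mono: "0 \<le> r \<Longrightarrow> r \<le> s \<Longrightarrow> sigma_slope La Lb \<alpha> \<beta> r \<le> sigma_slope La Lb \<alpha> \<beta> s"
  unfolding sigma_slope_def using L \<alpha> \<beta>
  by (intro add_right_mono real_sqrt_le_mono add_mono mult_left_mono power_mono) auto

lemma sigma_slope_0: "sigma_slope La Lb \<alpha> \<beta> 0 = 4 * Lb / \<beta>"
  using L \<beta> by (simp add: sigma_slope_def real_sqrt_divide real_sqrt_mult)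

lemma sigma_slope_nonneg: "0 \<le> r \<Longrightarrow> 0 \<le> sigma_slope La Lb \<alpha> \<beta> r"
  using sigma_slope_mono[of 0 r] L \<beta> by (simp add: sigma_slope_0 order_trans[rotated])

text \<open>Convexity of \<open>sigma_ab\<close> in tangent form: the integrand is nondecreasing, so
  the increment from r to s is at least the one with the integrand frozen at r, on either side of
  r.\<close>

lemma sigma_ab_tangent:
  assumes "0 \<le> r" "0 \<le> s"
  shows "sigma_ab La Lb \<alpha> \<beta> r + sigma_slope La Lb \<alpha> \<beta> r * (s - r) \<le> sigma_ab La Lb \<alpha> \<beta> s"
proof (cases "r \<le> s")
  case True
  have "integral {0..r} (sigma_slope La Lb \<alpha> \<beta>) + integral {r..s} (sigma_slope La Lb \<alpha> \<beta>) = integral {0..s} (sigma_slope La Lb \<alpha> \<beta>)"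
    using assms True by (intro Henstock_Kurzweil_Integration.integral_combine integrable_sigma_slope)
  moreover have "integral {r..s} (\<lambda>_. sigma_slope La Lb \<alpha> \<beta> r) \<le> integral {r..s} (sigma_slope La Lb \<alpha> \<beta>)"
    using assms by (intro integral_le integrable_sigma_slope) (auto intro: sigma_slope_mono)
  ultimately show ?thesis using True by (simp add: sigma_ab_eq mult.commute)
next
  case False
  have "integral {0..s} (sigma_slope La Lb \<alpha> \<beta>) + integral {s..r} (sigma_slope La Lb \<alpha> \<beta>) = integral {0..r} (sigma_slope La Lb \<alpha> \<beta>)"
    using assms False by (intro Henstock_Kurzweil_Integration.integral_combine integrable_sigma_slope) auto
  moreover have "integral {s..r} (sigma_slope La Lb \<alpha> \<beta>) \<le> integral {s..r} (\<lambda>_. sigma_slope La Lb \<alpha> \<beta> r)"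
    using assms by (intro integral_le integrable_sigma_slope) (auto intro: sigma_slope_mono)
  ultimately show ?thesis using False by (simp add: sigma_ab_eq algebra_simps)
qed

lemma sigma_ab_nonneg: "0 \<le> r \<Longrightarrow> 0 \<le> sigma_ab La Lb \<alpha> \<beta> r"
  using sigma_ab_tangent[of 0 r] sigma_slope_nonneg[of 0] by (smt (verit) mult_nonneg_nonneg sigma_ab_0)

text \<open>In the notation of \<open>entropic_transport\<close> this is
  \<open>\<rho> s = \<kappa> r\<close> with s the slope of \<open>\<sigma>\<close> at r, the case in
  which one iteration loses exactly what it gains.\<close>

lemma sigma_slope_balance:
  assumes "0 \<le> r"
  shows "\<beta> / 2 * (sigma_slope La Lb \<alpha> \<beta> r)\<^sup>2 - 2 * Lb * sigma_slope La Lb \<alpha> \<beta> r = \<alpha> / 2 * r\<^sup>2 + 2 * La * r"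
proof -
  define w where "w = 4 * Lb\<^sup>2 / \<beta>\<^sup>2 + 4 * La / \<beta> * r + \<alpha> / \<beta> * r\<^sup>2"
  have "0 \<le> w" using L \<alpha> \<beta> assms by (simp add: w_def)
  then have w: "(sqrt w)\<^sup>2 = w" by simp
  have "\<beta> / 2 * (sqrt w + 2 * Lb / \<beta>)\<^sup>2 - 2 * Lb * (sqrt w + 2 * Lb / \<beta>) = \<beta> / 2 * (sqrt w)\<^sup>2 - 2 * Lb\<^sup>2 / \<beta>"
    using \<beta> by (simp add: power2_eq_square field_simps)
  also have "\<dots> = \<alpha> / 2 * r\<^sup>2 + 2 * La * r"
    unfolding w unfolding w_def using \<beta> by (simp add: power2_eq_square field_simps)
  finally show ?thesis by (simp add: sigma_slope_def w_def)
qed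

text \<open>The supremum defining the conjugate of \<open>sigma_ab\<close> at s is attained at the
  r' where the slope is s, and there the two terms with the factor e cancel by
  \<open>sigma_slope_balance\<close>. If s is below the slope at the threshold, such an r' may be
  inadmissible; then r' = 0 is used, the last term alone being large enough.\<close>

lemma sigma_ab_modulus:
  assumes e: "0 < e" and \<alpha>': "0 < \<alpha>" and r: "2 * e * Lb \<le> r" and s: "0 \<le> s"
  shows "\<exists>r'\<in>insert 0 {r. 2 * e * Lb \<le> r}. r * s - sigma_ab La Lb \<alpha> \<beta> r
    \<le> r' * s - sigma_ab La Lb \<alpha> \<beta> r' - e * (\<alpha> / 2 * r'\<^sup>2 + 2 * La * r') + e * (\<beta> / 2 * s\<^sup>2 - 2 * Lb * s)"
proof -
  define r0 where "r0 = 2 * e * Lb"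
  have r0: "0 \<le> r0" "r0 \<le> r" using e L r by (auto simp: r0_def)
  show ?thesis
  proof (cases "sigma_slope La Lb \<alpha> \<beta> r0 \<le> s")
    case True
    define k where "k = sqrt (\<alpha> / \<beta>)"
    \<comment> \<open>The slope is at least \<open>k * r\<close>, so it has reached s at r1 and the
      intermediate value theorem applies between r0 and r1.\<close>
    define r1 where "r1 = r0 + s / k"
    have k: "0 < k" using \<alpha>' \<beta> by (simp add: k_def)
    have r1: "r0 \<le> r1" using s k by (simp add: r1_def)
    have "s \<le> k * r1" using r0 k by (simp add: r1_def distrib_left)
    also have "\<dots> = sqrt (\<alpha> / \<beta> * r1\<^sup>2)"
      unfolding real_sqrt_mult k_def using r0 r1 by simp
    also have "\<dots> \<le> sqrt (4 * Lb\<^sup>2 / \<beta>\<^sup>2 + 4 * La / \<beta> * r1 + \<alpha> / \<beta> * r1\<^sup>2)"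
      using L \<beta> r0 r1 by (intro real_sqrt_le_mono) simp
    also have "\<dots> \<le> sigma_slope La Lb \<alpha> \<beta> r1" using L \<beta> by (simp add: sigma_slope_def)
    finally obtain r' where r': "r0 \<le> r'" "sigma_slope La Lb \<alpha> \<beta> r' = s"
      using IVT'[of "sigma_slope La Lb \<alpha> \<beta>" r0 s r1] True r1 continuous_sigma_slope by auto
    have "sigma_ab La Lb \<alpha> \<beta> r' + s * (r - r') \<le> sigma_ab La Lb \<alpha> \<beta> r"
      using sigma_ab_tangent[of r' r] r' r0 by simp
    moreover have *: "\<beta> / 2 * s\<^sup>2 - 2 * Lb * s = \<alpha> / 2 * r'\<^sup>2 + 2 * La * r'"
      using sigma_slope_balance[of r'] r' r0 by simp
    ultimately show ?thesis
      using r'(1) unfolding * by (intro bexI[of _ r']) (auto simp: r0_def algebra_simps)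
  next
    case False
    have "sigma_ab La Lb \<alpha> \<beta> r0 + sigma_slope La Lb \<alpha> \<beta> r0 * (r - r0) \<le> sigma_ab La Lb \<alpha> \<beta> r"
      using sigma_ab_tangent[of r0 r] r0 by simp
    moreover have "s * (r - r0) \<le> sigma_slope La Lb \<alpha> \<beta> r0 * (r - r0)"
      using False r0 by (intro mult_right_mono) auto
    moreover have "4 * Lb / \<beta> * r0 \<le> sigma_ab La Lb \<alpha> \<beta> r0"
      using sigma_ab_tangent[of 0 r0] r0 by (simp add: sigma_slope_0)
    ultimately have "r * s - sigma_ab La Lb \<alpha> \<beta> r \<le> r0 * (s - 4 * Lb / \<beta>)"
      by (simp add: algebra_simps)
    \<comment> \<open>The difference of the two sides is a perfect square: the line of slope
      \<open>2 * e * Lb\<close> through the zero \<open>4 * Lb / \<beta>\<close> of the right-hand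
      side is its tangent there. This is the origin of the threshold r0.\<close>
    also have "\<dots> \<le> e * (\<beta> / 2 * s\<^sup>2 - 2 * Lb * s)"
    proof -
      have "0 \<le> e * (\<beta> / 2 * (s - 4 * Lb / \<beta>)\<^sup>2)" using e \<beta> by simp
      also have "\<dots> = e * (\<beta> / 2 * s\<^sup>2 - 2 * Lb * s) - r0 * (s - 4 * Lb / \<beta>)"
        using \<beta> by (simp add: r0_def power2_eq_square field_simps)
      finally show ?thesis by simp
    qed
    finally show ?thesis by (intro bexI[of _ 0]) auto
  qed
qed

text \<open>Controls the effect of the Gaussian damping, which raises \<open>\<alpha>\<close> by an
  amount d tending to 0. Subadditivity of the square root gives an error of order
  \<open>sqrt d\<close> at each fixed r, enough for the limit.\<close>

lemma sigma_ab_add_le: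
  assumes d: "0 \<le> d" and r: "0 \<le> r"
  shows "sigma_ab La Lb (\<alpha> + d) \<beta> r \<le> sigma_ab La Lb \<alpha> \<beta> r + sqrt (d / \<beta>) * r\<^sup>2"
proof -
  have le: "sigma_slope La Lb (\<alpha> + d) \<beta> s \<le> sigma_slope La Lb \<alpha> \<beta> s + sqrt (d / \<beta>) * r" if s: "s \<in> {0..r}" for s
  proof -
    define w where "w = 4 * Lb\<^sup>2 / \<beta>\<^sup>2 + 4 * La / \<beta> * s + \<alpha> / \<beta> * s\<^sup>2"
    have w: "0 \<le> w" using L \<alpha> \<beta> s by (simp add: w_def)
    have "sqrt (w + d / \<beta> * s\<^sup>2) \<le> sqrt w + sqrt (d / \<beta> * s\<^sup>2)"
      using w d \<beta> by (intro sqrt_add_le_add_sqrt) auto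
    also have "sqrt (d / \<beta> * s\<^sup>2) = sqrt (d / \<beta>) * s" unfolding real_sqrt_mult using s by simp
    also have "\<dots> \<le> sqrt (d / \<beta>) * r" using s d \<beta> by (intro mult_left_mono) auto
    finally show ?thesis by (simp add: sigma_slope_def w_def add_divide_distrib distrib_right add.assoc)
  qed
  have "integral {0..r} (sigma_slope La Lb (\<alpha> + d) \<beta>) \<le> integral {0..r} (\<lambda>s. sigma_slope La Lb \<alpha> \<beta> s + sqrt (d / \<beta>) * r)"
    by (intro integral_le integrable_sigma_slope integrable_add le) auto
  also have "\<dots> = integral {0..r} (sigma_slope La Lb \<alpha> \<beta>) + sqrt (d / \<beta>) * r\<^sup>2"
    using r by (subst integral_add[OF integrable_sigma_slope]) (auto simp: power2_eq_square)
  finally show ?thesis by (simp add: sigma_ab_eq)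
qed

text \<open>The factor 2 comes from \<open>smooth_convex_gradient_bound\<close>. The integrand is
  split by subadditivity of the square root: the part linear in s integrates to half its end value
  times r, which leaves the coefficient 1, whereas the rest is bounded by its value at the end point
  r.\<close>

lemma two_sigma_ab_le:
  assumes r: "0 \<le> r"
  shows "2 * sigma_ab La Lb \<alpha> \<beta> r \<le> r * (4 * Lb / \<beta> + 4 * sqrt (Lb\<^sup>2 / \<beta>\<^sup>2 + La / \<beta> * r) + sqrt (\<alpha> / \<beta>) * r)"
proof -
  define c where "c = 2 * sqrt (Lb\<^sup>2 / \<beta>\<^sup>2 + La / \<beta> * r) + 2 * Lb / \<beta>"
  have le: "sigma_slope La Lb \<alpha> \<beta> s \<le> sqrt (\<alpha> / \<beta>) * s + c" if s: "s \<in> {0..r}" for s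
  proof -
    have "sqrt (4 * Lb\<^sup>2 / \<beta>\<^sup>2 + 4 * La / \<beta> * s + \<alpha> / \<beta> * s\<^sup>2)
        \<le> sqrt (4 * Lb\<^sup>2 / \<beta>\<^sup>2 + 4 * La / \<beta> * s) + sqrt (\<alpha> / \<beta> * s\<^sup>2)"
      using L \<alpha> \<beta> s by (intro sqrt_add_le_add_sqrt) auto
    moreover have "sqrt (4 * Lb\<^sup>2 / \<beta>\<^sup>2 + 4 * La / \<beta> * s) \<le> 2 * sqrt (Lb\<^sup>2 / \<beta>\<^sup>2 + La / \<beta> * r)"
    proof -
      have "sqrt (4 * Lb\<^sup>2 / \<beta>\<^sup>2 + 4 * La / \<beta> * s) \<le> sqrt (2\<^sup>2 * (Lb\<^sup>2 / \<beta>\<^sup>2 + La / \<beta> * r))"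
        using L \<beta> s by (intro real_sqrt_le_mono) (auto simp: divide_right_mono mult_left_mono)
      then show ?thesis by (simp only: real_sqrt_mult) simp
    qed
    moreover have "sqrt (\<alpha> / \<beta> * s\<^sup>2) = sqrt (\<alpha> / \<beta>) * s" unfolding real_sqrt_mult using s by simp
    ultimately show ?thesis unfolding sigma_slope_def c_def by linarith
  qed
  have "((\<lambda>s. sqrt (\<alpha> / \<beta>) * s + c) has_integral (sqrt (\<alpha> / \<beta>) * ((r\<^sup>2 - 0\<^sup>2) / 2) + (r - 0) *\<^sub>R c)) {0..r}"
    using r has_integral_const_real[of c 0 r] by (intro has_integral_add has_integral_mult_right ident_has_integral) auto
  then have I: "(\<lambda>s. sqrt (\<alpha> / \<beta>) * s + c) integrable_on {0..r}"
      "integral {0..r} (\<lambda>s. sqrt (\<alpha> / \<beta>) * s + c) = sqrt (\<alpha> / \<beta>) * (r\<^sup>2 / 2) + r * c"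
    by (auto simp: has_integral_integrable_integral)
  have "sigma_ab La Lb \<alpha> \<beta> r \<le> sqrt (\<alpha> / \<beta>) * (r\<^sup>2 / 2) + r * c"
    unfolding sigma_ab_eq I(2)[symmetric] by (intro integral_le integrable_sigma_slope I le)
  moreover have "2 * (k * (r\<^sup>2 / 2) + r * (2 * w + 2 * Lb / \<beta>)) = r * (4 * Lb / \<beta> + 4 * w + k * r)" for k w
    using \<beta> by (simp add: power2_eq_square field_simps)
  ultimately show ?thesis unfolding c_def by (smt (verit))
qed

end

text \<open>Dividing the convexity and smoothness inequalities by t and letting t tend to 0 puts f
  between its tangent plane and that plane plus \<open>\<sigma>\<close>. The lower bound from x and
  the upper bound from y, compared at \<open>y + v\<close>, improve the subgradient inequality from
  x to y by \<open>r * norm (p - q) - \<sigma> r\<close>. Adding the same with x and y exchanged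
  bounds \<open>2 * r * norm (p - q) - 2 * \<sigma> r\<close> by
  \<open>(p - q) \<bullet> (x - y)\<close>, hence by \<open>r * norm (p - q)\<close>.\<close>

lemma smooth_convex_gradient_bound:
  fixes f :: "'a::euclidean_space \<Rightarrow> real"
  assumes cvx: "convex_on UNIV f"
    and smooth: "\<And>t x0 x1. 0 < t \<Longrightarrow> t < 1 \<Longrightarrow>
      (1 - t) * f x0 + t * f x1 \<le> f ((1 - t) *\<^sub>R x0 + t *\<^sub>R x1) + t * (1 - t) * \<sigma> (norm (x1 - x0))"
    and p: "(f has_derivative (\<lambda>h. p \<bullet> h)) (at x)" and q: "(f has_derivative (\<lambda>h. q \<bullet> h)) (at y)"
  shows "norm (x - y) * norm (p - q) \<le> 2 * \<sigma> (norm (x - y))"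
proof -
  have bounds: "f z \<le> f x + p \<bullet> (z - x) + \<sigma> (norm (z - x)) \<and> f x + p \<bullet> (z - x) \<le> f z"
    if p: "(f has_derivative (\<lambda>h. p \<bullet> h)) (at x)" for x z p
  proof -
    define d where "d t = (f (x + t *\<^sub>R (z - x)) - f x) / t" for t
    have "((\<lambda>t. x + t *\<^sub>R (z - x)) has_derivative (\<lambda>t. t *\<^sub>R (z - x))) (at 0)"
      by (auto intro!: derivative_eq_intros)
    then have "((\<lambda>t. f (x + t *\<^sub>R (z - x))) has_derivative (\<lambda>t. p \<bullet> (t *\<^sub>R (z - x)))) (at 0)"
      by (rule has_derivative_compose) (use p in simp)
    then have "((\<lambda>t. f (x + t *\<^sub>R (z - x))) has_field_derivative p \<bullet> (z - x)) (at 0)"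
      by (rule has_derivative_imp_has_field_derivative) simp
    then have "d \<midarrow>0\<rightarrow> p \<bullet> (z - x)"
      by (simp add: DERIV_def d_def[abs_def])
    then have d: "(d \<longlongrightarrow> p \<bullet> (z - x)) (at_right 0)" by (simp add: filterlim_at_split)
    have ev: "\<forall>\<^sub>F t in at_right 0. 0 < t \<and> t < (1::real)"
      using eventually_at_right_real[of 0 1] by (auto elim: eventually_mono)
    have x: "x + t *\<^sub>R (z - x) = (1 - t) *\<^sub>R x + t *\<^sub>R z" for t :: real by (simp add: algebra_simps)
    have "p \<bullet> (z - x) \<le> f z - f x"
    proof (rule tendsto_upperbound[OF d])
      show "\<forall>\<^sub>F t in at_right 0. d t \<le> f z - f x"
        using ev
      proof eventually_elim
        fix t :: real assume t: "0 < t \<and> t < 1"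
        have "f (x + t *\<^sub>R (z - x)) \<le> (1 - t) * f x + t * f z"
          unfolding x using t by (intro convex_onD[OF cvx]) auto
        then show "d t \<le> f z - f x" using t by (simp add: d_def divide_simps algebra_simps)
      qed
    qed simp
    moreover have "f z - f x \<le> p \<bullet> (z - x) + (1 - 0) * \<sigma> (norm (z - x))"
    proof (rule tendsto_lowerbound)
      show "((\<lambda>t. d t + (1 - t) * \<sigma> (norm (z - x))) \<longlongrightarrow> p \<bullet> (z - x) + (1 - 0) * \<sigma> (norm (z - x))) (at_right 0)"
        by (intro tendsto_intros d)
      show "\<forall>\<^sub>F t in at_right 0. f z - f x \<le> d t + (1 - t) * \<sigma> (norm (z - x))"
        using ev
      proof eventually_elim
        fix t :: real assume t: "0 < t \<and> t < 1"
        have "(1 - t) * f x + t * f z \<le> f (x + t *\<^sub>R (z - x)) + t * (1 - t) * \<sigma> (norm (z - x))"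
          unfolding x using t smooth[of t x z] by simp
        moreover have "t * d t = f (x + t *\<^sub>R (z - x)) - f x" using t by (simp add: d_def)
        ultimately have "t * (f z - f x) \<le> t * (d t + (1 - t) * \<sigma> (norm (z - x)))"
          unfolding distrib_left by (simp add: left_diff_distrib right_diff_distrib mult.assoc)
        then show "f z - f x \<le> d t + (1 - t) * \<sigma> (norm (z - x))" using t by simp
      qed
    qed simp
    ultimately show ?thesis by simp
  qed
  define r where "r = norm (x - y)"
  have step: "f x + p \<bullet> (y - x) + (r * norm (p - q) - \<sigma> r) \<le> f y"
    if p: "(f has_derivative (\<lambda>h. p \<bullet> h)) (at x)" and q: "(f has_derivative (\<lambda>h. q \<bullet> h)) (at y)"
      and r: "r = norm (x - y)" and pq: "p \<noteq> q" for x y p q r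
  proof -
    \<comment> \<open>The direction in which the two tangent planes separate fastest; the length r
      makes the error term equal to \<open>\<sigma>\<close> at the distance of x and y.\<close>
    define v where "v = r *\<^sub>R sgn (p - q)"
    have "norm v = r" using pq r by (simp add: v_def norm_sgn)
    have v: "(p - q) \<bullet> v = r * norm (p - q)"
      unfolding v_def sgn_div_norm
      by (simp add: dot_square_norm power2_eq_square divide_inverse[symmetric] del: inner_diff_right inner_diff_left)
    have "f x + p \<bullet> (y + v - x) \<le> f (y + v)" using bounds[OF p] by blast
    moreover have "f (y + v) \<le> f y + q \<bullet> v + \<sigma> r" using bounds[OF q, of "y + v"] \<open>norm v = r\<close> by simp
    moreover have "p \<bullet> (y + v - x) = p \<bullet> (y - x) + p \<bullet> v" by (simp add: inner_diff_right inner_add_right)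
    ultimately show ?thesis using v by (simp add: inner_diff_left)
  qed
  show ?thesis
  proof (cases "p = q")
    case True
    \<comment> \<open>Here \<open>sgn (p - q)\<close> is 0 and gives no test direction, but the
      two-sided bounds still yield \<open>0 \<le> \<sigma> r\<close>.\<close>
    have "f y \<le> f x + p \<bullet> (y - x) + \<sigma> r" using bounds[OF p, of y] by (simp add: r_def norm_minus_commute)
    moreover have "f y + q \<bullet> (x - y) \<le> f x" using bounds[OF q, of x] by simp
    ultimately have "0 \<le> \<sigma> r"
      using bounds[OF p, of y] bounds[OF q, of x] True
      by (simp add: inner_diff_right r_def norm_minus_commute)
    then show ?thesis using True by (simp add: r_def)
  next
    case False
    have "f x + p \<bullet> (y - x) + (r * norm (p - q) - \<sigma> r) \<le> f y" by (rule step[OF p q r_def False])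
    moreover have "f y + q \<bullet> (x - y) + (r * norm (q - p) - \<sigma> r) \<le> f x"
      using step[OF q p _ False[symmetric], of r] by (simp add: r_def norm_minus_commute)
    moreover have "norm (q - p) = norm (p - q)" by (rule norm_minus_commute)
    moreover have "(q - p) \<bullet> (y - x) \<le> r * norm (p - q)"
      using norm_cauchy_schwarz[of "q - p" "y - x"] by (simp add: r_def norm_minus_commute mult.commute)
    ultimately show ?thesis by (simp add: r_def inner_diff_left inner_diff_right algebra_simps)
  qed
qed

text \<open>On a subdivision of a segment into \<open>N\<close> pieces the increments of \<open>f - g\<close> are bounded by those of the common
  subgradient, and these telescope to a multiple of \<open>1 / N\<close>.\<close>

lemma common_subgradient_imp_diff_constant:
  fixes f g :: "'a::real_inner \<Rightarrow> real"
  assumes sub: "\<And>x. \<exists>y. \<forall>z. f x + y \<bullet> (z - x) \<le> f z \<and> g x + y \<bullet> (z - x) \<le> g z"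
  shows "f x - g x = f x' - g x'"
proof -
  obtain Y where Y: "\<And>x z. f x + Y x \<bullet> (z - x) \<le> f z" "\<And>x z. g x + Y x \<bullet> (z - x) \<le> g z"
    using sub by metis
  define C where "C = (Y x' - Y x) \<bullet> (x' - x)"
  have step: "\<bar>(f b - g b) - (f a - g a)\<bar> \<le> (Y b - Y a) \<bullet> (b - a)" for a b
    using Y(1)[of a b] Y(2)[of a b] Y(1)[of b a] Y(2)[of b a]
    by (simp add: abs_le_iff inner_diff_left inner_diff_right)
  have bound: "\<bar>(f x' - g x') - (f x - g x)\<bar> \<le> C / real N" if N: "N > 0" for N :: nat
  proof -
    define z where "z i = x + (real i / real N) *\<^sub>R (x' - x)" for i :: nat
    have z0: "z 0 = x" and zN: "z N = x'" using N by (simp_all add: z_def)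
    have zd: "z (Suc i) - z i = (1 / real N) *\<^sub>R (x' - x)" for i
    proof -
      have "z (Suc i) - z i = (real (Suc i) / real N - real i / real N) *\<^sub>R (x' - x)"
        by (simp add: z_def scaleR_left_diff_distrib)
      also have "real (Suc i) / real N - real i / real N = 1 / real N" by (simp add: diff_divide_distrib[symmetric])
      finally show ?thesis .
    qed
    have "(f x' - g x') - (f x - g x) = (\<Sum>i<N. (f (z (Suc i)) - g (z (Suc i))) - (f (z i) - g (z i)))"
      by (subst sum_lessThan_telescope) (simp add: z0 zN)
    also have "\<bar>\<dots>\<bar> \<le> (\<Sum>i<N. (Y (z (Suc i)) - Y (z i)) \<bullet> (z (Suc i) - z i))"
      by (rule order_trans[OF sum_abs]) (intro sum_mono step)
    also have "\<dots> = (1 / real N) * ((\<Sum>i<N. Y (z (Suc i)) - Y (z i)) \<bullet> (x' - x))"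
      by (simp add: zd inner_sum_left sum_divide_distrib)
    also have "(\<Sum>i<N. Y (z (Suc i)) - Y (z i)) = Y x' - Y x"
      by (subst sum_lessThan_telescope) (simp add: z0 zN)
    finally show ?thesis by (simp add: C_def)
  qed
  have "(\<lambda>n. C / real (Suc n)) \<longlonglongrightarrow> 0"
    using LIMSEQ_Suc[OF lim_const_over_n[of C]] by simp
  then have "\<bar>(f x' - g x') - (f x - g x)\<bar> \<le> 0"
    by (rule LIMSEQ_le_const) (use bound in blast)
  then show ?thesis by simp
qed

section \<open>Vanishing regularisation\<close>

lemma convex_local_lipschitz:
  fixes f :: "'a::euclidean_space \<Rightarrow> real"
  assumes cvx: "convex_on UNIV f" and B: "\<And>y. dist y x \<le> 1 \<Longrightarrow> \<bar>f y\<bar> \<le> B" and y: "dist y x \<le> 1"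
  shows "\<bar>f y - f x\<bar> \<le> 2 * B * dist y x"
proof (cases "y = x")
  case False
  define d where "d = dist y x"
  have d: "0 < d" "d \<le> 1" using False y by (auto simp: d_def)
  define u where "u = (1 / d) *\<^sub>R (y - x)"
  have u: "norm u = 1" using d by (simp add: u_def d_def dist_norm)
  have yu: "y = x + d *\<^sub>R u" using d by (simp add: u_def)
  have b: "\<bar>f (x + u)\<bar> \<le> B" "\<bar>f (x - u)\<bar> \<le> B" "\<bar>f x\<bar> \<le> B" using u by (auto intro!: B simp: dist_norm)
  have "f ((1 - d) *\<^sub>R x + d *\<^sub>R (x + u)) \<le> (1 - d) * f x + d * f (x + u)"
    using d by (intro convex_onD[OF cvx]) auto
  moreover have "(1 - d) *\<^sub>R x + d *\<^sub>R (x + u) = y" by (simp add: yu algebra_simps)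
  ultimately have "f y - f x \<le> d * (f (x + u) - f x)" by (simp add: algebra_simps)
  also have "\<dots> \<le> d * (2 * B)" using b d by (intro mult_left_mono) auto
  finally have 1: "f y - f x \<le> 2 * B * d" by (simp add: mult.commute)
  define s where "s = d / (1 + d)"
  have s: "0 \<le> s" "s \<le> 1" "(1 + d) * s = d" "(1 + d) * (1 - s) = 1" using d by (simp_all add: s_def field_simps)
  have "f ((1 - s) *\<^sub>R y + s *\<^sub>R (x - u)) \<le> (1 - s) * f y + s * f (x - u)"
    using s by (intro convex_onD[OF cvx]) auto
  moreover have "(1 - s) *\<^sub>R y + s *\<^sub>R (x - u) = x"
  proof -
    have "(1 - s) * d = s" using s(3) by (simp add: algebra_simps)
    then show ?thesis by (simp add: yu algebra_simps) (metis scaleR_left_distrib diff_add_cancel)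
  qed
  ultimately have "(1 + d) * f x \<le> (1 + d) * ((1 - s) * f y + s * f (x - u))"
    using d by (intro mult_left_mono) auto
  also have "\<dots> = ((1 + d) * (1 - s)) * f y + ((1 + d) * s) * f (x - u)" by (simp add: algebra_simps)
  also have "\<dots> = f y + d * f (x - u)" unfolding s by simp
  finally have "f x - f y \<le> d * (f (x - u) - f x)" by (simp add: algebra_simps)
  also have "\<dots> \<le> d * (2 * B)" using b d by (intro mult_left_mono) auto
  finally have 2: "f x - f y \<le> 2 * B * d" by (simp add: mult.commute)
  show ?thesis using 1 2 unfolding d_def[symmetric] by linarith
qed simp

text \<open>If \<open>f\<close> were large at some \<open>c\<close>, its increments \<open>f x - f (x - 2 c)\<close> would be large for all \<open>x\<close> near
  \<open>2 c\<close>, and the conditional laws of \<open>y\<close> given such \<open>x\<close> would charge mostly \<open>norm y > l\<close>.\<close>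

lemma entropic_potential_upper_bound:
  fixes M N :: "'a::euclidean_space measure" and f \<psi> :: "'a \<Rightarrow> real"
  assumes MN: "sigma_finite_measure M" "sigma_finite_measure N" "sets M = sets borel" "sets N = sets borel"
    and f: "convex_on UNIV f" "f 0 = 0" and [measurable]: "\<psi> \<in> borel_measurable borel"
    and e: "0 < e" "e \<le> 1"
    and DM: "\<And>y. (\<integral>\<^sup>+x. ennreal (gibbs e f \<psi> x y) \<partial>M) = 1"
    and DN: "\<And>x. (\<integral>\<^sup>+y. ennreal (gibbs e f \<psi> x y) \<partial>N) = 1"
    and r: "0 < r" and l: "0 \<le> l" and \<eta>: "0 < \<eta>"
    and M: "\<And>c. norm c \<le> 2 * r \<Longrightarrow> ennreal (2 * \<eta>) \<le> emeasure M (ball c (r / 4))"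
    and N: "emeasure N {y. l < norm y} < ennreal \<eta>"
    and x: "norm x \<le> r"
  shows "f x \<le> 2 * r * l + 1"
proof (rule ccontr)
  note [measurable_cong] = MN(3,4)
  interpret M: sigma_finite_measure M by fact
  interpret N: sigma_finite_measure N by fact
  interpret pair_sigma_finite M N ..
  have contf: "continuous_on UNIV f" using f(1) by (intro convex_on_continuous) auto
  then have [measurable]: "f \<in> borel_measurable borel" by (rule borel_measurable_continuous_onI)
  assume "\<not> f x \<le> 2 * r * l + 1"
  then have fx: "2 * r * l + 1 < f x" by simp
  obtain c where c: "c \<in> cball 0 r" and max: "\<And>z. z \<in> cball 0 r \<Longrightarrow> f z \<le> f c"
    using continuous_attains_sup[of "cball 0 r" f] r continuous_on_subset[OF contf, of "cball 0 r"] by force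
  define d where "d = f c"
  have d: "2 * r * l + 1 < d" using fx max[of x] x by (simp add: d_def)
  have d0: "0 < d" using d r l by (smt (verit) mult_nonneg_nonneg)
  have inc: "3 / 2 * d \<le> f z - f (z - 2 *\<^sub>R c)" if z: "z \<in> ball (2 *\<^sub>R c) (r / 4)" for z
  proof -
    \<comment> \<open>The radius r / 4 is chosen for this: 4 v stays in the ball on which
      \<open>d\<close> is the maximum, and \<open>f 0 = 0\<close>. As c is the midpoint of z and 2 c
      - z, convexity gives \<open>f z \<ge> 2 * d - d / 4\<close>, and subtracting the value at z -
      2 c, at most \<open>d / 4\<close>, leaves \<open>3 / 2 * d\<close>.\<close>
    have quarter: "f v \<le> d / 4" if v: "norm v \<le> r / 4" for v
    proof -
      have "f ((1 - 1/4) *\<^sub>R 0 + (1/4) *\<^sub>R (4 *\<^sub>R v)) \<le> (1 - 1/4) * f 0 + (1/4) * f (4 *\<^sub>R v)"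
        by (intro convex_onD[OF f(1)]) auto
      moreover have "f (4 *\<^sub>R v) \<le> d" unfolding d_def using v by (intro max) simp
      ultimately show ?thesis using f(2) by simp
    qed
    have n: "norm (z - 2 *\<^sub>R c) \<le> r / 4" "norm (2 *\<^sub>R c - z) \<le> r / 4"
      using z by (simp_all add: dist_norm norm_minus_commute)
    have "f ((1 - 1/2) *\<^sub>R z + (1/2) *\<^sub>R (2 *\<^sub>R c - z)) \<le> (1 - 1/2) * f z + (1/2) * f (2 *\<^sub>R c - z)"
      by (intro convex_onD[OF f(1)]) auto
    moreover have "(1 - 1/2) *\<^sub>R z + (1/2) *\<^sub>R (2 *\<^sub>R c - z) = c" by (simp add: algebra_simps)
    ultimately have "2 * d \<le> f z + f (2 *\<^sub>R c - z)" by (simp add: d_def)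
    with quarter[OF n(1)] quarter[OF n(2)] show ?thesis by linarith
  qed
  define D where "D x y = ennreal (gibbs e f \<psi> x y)" for x y
  have [measurable]: "case_prod D \<in> borel_measurable (M \<Otimes>\<^sub>M N)" unfolding D_def by measurable
  have [measurable]: "D z \<in> borel_measurable borel" for z unfolding D_def by measurable
  have D1: "(\<integral>\<^sup>+y. D z y \<partial>N) = 1" for z using DN[of z] by (simp add: D_def)
  define B where "B = ball (2 *\<^sub>R c) (r / 4)"
  have [measurable]: "B \<in> sets borel" by (simp add: B_def)
  \<comment> \<open>Comparison with the density at z - 2 c, whose total mass is 1: for
    \<open>norm y \<le> l\<close> the exponent is smaller by at least 1, because
    \<open>2 * r * l - 3 / 2 * d \<le> - 1\<close> and \<open>e \<le> 1\<close>, and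
    \<open>exp (- 1) \<le> 1 / 2\<close>.\<close>
  have small: "(\<integral>\<^sup>+y. D z y * indicator {y. norm y \<le> l} y \<partial>N) \<le> ennreal (1 / 2)" if z: "z \<in> B" for z
  proof -
    have "(\<integral>\<^sup>+y. D z y * indicator {y. norm y \<le> l} y \<partial>N) \<le> (\<integral>\<^sup>+y. ennreal (1 / 2) * D (z - 2 *\<^sub>R c) y \<partial>N)"
    proof (rule nn_integral_mono)
      fix y
      show "D z y * indicator {y. norm y \<le> l} y \<le> ennreal (1 / 2) * D (z - 2 *\<^sub>R c) y"
      proof (cases "norm y \<le> l")
        case True
        have "2 * (c \<bullet> y) \<le> 2 * (norm c * norm y)" using norm_cauchy_schwarz[of c y] by simp
        also have "\<dots> \<le> 2 * (r * l)" using c True r l by (intro mult_left_mono mult_mono) auto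
        finally have "2 * (c \<bullet> y) - (f z - f (z - 2 *\<^sub>R c)) \<le> - 1"
          using inc[of z] z d d0 by (simp add: B_def)
        then have "(z \<bullet> y - f z - \<psi> y) / e \<le> (- 1 + ((z - 2 *\<^sub>R c) \<bullet> y - f (z - 2 *\<^sub>R c) - \<psi> y)) / e"
          using e by (intro divide_right_mono) (auto simp: inner_diff_left)
        also have "\<dots> = - 1 / e + ((z - 2 *\<^sub>R c) \<bullet> y - f (z - 2 *\<^sub>R c) - \<psi> y) / e"
          by (rule add_divide_distrib)
        also have "\<dots> \<le> - 1 + ((z - 2 *\<^sub>R c) \<bullet> y - f (z - 2 *\<^sub>R c) - \<psi> y) / e"
          using e by (intro add_right_mono) (simp add: divide_simps)
        finally have "gibbs e f \<psi> z y \<le> exp (-1) * exp (((z - 2 *\<^sub>R c) \<bullet> y - f (z - 2 *\<^sub>R c) - \<psi> y) / e)"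
          by (simp add: exp_add[symmetric])
        also have "\<dots> \<le> 1 / 2 * exp (((z - 2 *\<^sub>R c) \<bullet> y - f (z - 2 *\<^sub>R c) - \<psi> y) / e)"
          using exp_ge_add_one_self[of 1] by (intro mult_right_mono) (auto simp: exp_minus field_simps)
        finally show ?thesis using True unfolding D_def
          by (subst ennreal_mult'[symmetric]) (auto intro: ennreal_leI)
      qed simp
    qed
    also have "\<dots> = ennreal (1 / 2)"
      by (subst nn_integral_cmult) (simp_all add: D1)
    finally show ?thesis .
  qed
  have big: "ennreal (1 / 2) \<le> (\<integral>\<^sup>+y. D z y * indicator {y. l < norm y} y \<partial>N)" if z: "z \<in> B" for z
  proof (rule ccontr)
    assume "\<not> ?thesis"
    then have lt: "(\<integral>\<^sup>+y. D z y * indicator {y. l < norm y} y \<partial>N) < ennreal (1 / 2)" by simp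
    have "(\<integral>\<^sup>+y. D z y \<partial>N) = (\<integral>\<^sup>+y. D z y * indicator {y. norm y \<le> l} y + D z y * indicator {y. l < norm y} y \<partial>N)"
      by (intro nn_integral_cong) (auto simp: indicator_def)
    also have "\<dots> = (\<integral>\<^sup>+y. D z y * indicator {y. norm y \<le> l} y \<partial>N) + (\<integral>\<^sup>+y. D z y * indicator {y. l < norm y} y \<partial>N)"
      by (rule nn_integral_add) measurable
    also have "\<dots> \<le> ennreal (1 / 2) + (\<integral>\<^sup>+y. D z y * indicator {y. l < norm y} y \<partial>N)"
      by (intro add_right_mono small z)
    also have "\<dots> < ennreal (1 / 2) + ennreal (1 / 2)"
      using lt by (subst ennreal_add_left_cancel_less) simp
    also have "\<dots> = 1" by (subst ennreal_plus[symmetric]) auto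
    finally show False by (simp add: D1)
  qed
  have "ennreal \<eta> = ennreal (1 / 2) * ennreal (2 * \<eta>)" using \<eta> by (subst ennreal_mult'[symmetric]) auto
  also have "\<dots> \<le> ennreal (1 / 2) * emeasure M B"
    unfolding B_def using c by (intro mult_left_mono M) auto
  also have "\<dots> = (\<integral>\<^sup>+z. ennreal (1 / 2) * indicator B z \<partial>M)"
    by (subst nn_integral_cmult_indicator) auto
  also have "\<dots> \<le> (\<integral>\<^sup>+z. \<integral>\<^sup>+y. D z y * indicator {y. l < norm y} y \<partial>N \<partial>M)"
    using big by (intro nn_integral_mono) (auto simp: indicator_def)
  also have "\<dots> = (\<integral>\<^sup>+y. \<integral>\<^sup>+z. D z y * indicator {y. l < norm y} y \<partial>M \<partial>N)"
    by (rule Fubini'[symmetric]) measurable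
  also have "\<dots> = (\<integral>\<^sup>+y. indicator {y. l < norm y} y \<partial>N)"
    using DM by (intro nn_integral_cong) (auto simp: D_def indicator_def)
  also have "\<dots> = emeasure N {y. l < norm y}" by simp
  finally show False using N by simp
qed

text \<open>The dual functionals are compared only through bounded truncations, because the potentials of the
  approximating problems need not be integrable uniformly: \<open>\<mu>\<close> may have no first moment.\<close>

definition clamp1 :: "real \<Rightarrow> real \<Rightarrow> real" where
  "clamp1 K z = max (- K) (min K z)"

lemma clamp1_mono: "z \<le> z' \<Longrightarrow> clamp1 K z \<le> clamp1 K z'"
  by (auto simp: clamp1_def)

lemma abs_clamp1: "0 \<le> K \<Longrightarrow> \<bar>clamp1 K z\<bar> \<le> K"
  by (auto simp: clamp1_def)

lemma clamp1_diff: "0 \<le> s \<Longrightarrow> clamp1 K z - s \<le> clamp1 K (z - s)"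
  by (auto simp: clamp1_def)

lemma measurable_clamp1[measurable]: "clamp1 K \<in> borel_measurable borel"
  unfolding clamp1_def[abs_def] by measurable

lemma continuous_clamp1: "continuous_on UNIV (clamp1 K)"
  unfolding clamp1_def[abs_def] by (intro continuous_intros)

text \<open>Integration against the entropic coupling, whose density is D and whose marginals are M
  and N. Where D is at least \<open>exp (- m)\<close>, the exponent gives
  \<open>f x + \<psi> y \<le> x \<bullet> y + e * m\<close>, and \<open>young\<close> then gives
  \<open>\<psi> y - \<phi>s y - e * m \<le> \<phi> x - f x\<close>, which survives clamping. Where D
  is smaller, the clamped functions differ by at most \<open>2 * K\<close>, at a cost of at most
  \<open>2 * K * exp (- m)\<close>. This is the truncated form of the assertion that the dual value
  of f and \<psi> exceeds that of \<phi> and \<phi>s by a small error at most.\<close>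

lemma entropic_clamp_le:
  fixes M N :: "'a::euclidean_space measure" and f \<psi> \<phi> \<phi>s :: "'a \<Rightarrow> real"
  assumes MN: "finite_measure M" "finite_measure N" "sets M = sets borel" "sets N = sets borel"
    and MN1: "emeasure M UNIV = 1" "emeasure N UNIV = 1"
    and meas[measurable]: "f \<in> borel_measurable borel" "\<psi> \<in> borel_measurable borel" "\<phi> \<in> borel_measurable borel" "\<phi>s \<in> borel_measurable borel"
    and e: "0 < e"
    and DM: "\<And>y. (\<integral>\<^sup>+x. ennreal (gibbs e f \<psi> x y) \<partial>M) = 1"
    and DN: "\<And>x. (\<integral>\<^sup>+y. ennreal (gibbs e f \<psi> x y) \<partial>N) = 1"
    and young: "AE y in N. \<forall>x. x \<bullet> y \<le> \<phi> x + \<phi>s y"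
    and K: "0 \<le> K" and m: "0 \<le> m"
  shows "(LINT y|N. clamp1 K (\<psi> y - \<phi>s y)) - e * m - 2 * K * exp (- m) \<le> (LINT x|M. clamp1 K (\<phi> x - f x))"
proof -
  note [measurable_cong] = MN(3,4)
  interpret M: finite_measure M by fact
  interpret N: finite_measure N by fact
  interpret pair_sigma_finite M N ..
  define D where "D x y = gibbs e f \<psi> x y" for x y
  have D0: "0 < D x y" for x y by (simp add: D_def)
  have mD[measurable]: "(\<lambda>(x, y). D x y) \<in> borel_measurable (M \<Otimes>\<^sub>M N)" unfolding D_def by measurable
  have spaces: "space M = UNIV" "space N = UNIV" using MN(3,4) by (auto dest: sets_eq_imp_space_eq)
  have mMN: "measure M UNIV = 1" "measure N UNIV = 1" using MN1 by (simp_all add: measure_def)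
  have DMr: "integrable M (\<lambda>x. D x y)" "(LINT x|M. D x y) = 1" for y
    using DM[of y] by (auto simp: D_def intro!: integrableI_nonneg) (subst integral_eq_nn_integral, auto)
  have DNr: "integrable N (\<lambda>y. D x y)" "(LINT y|N. D x y) = 1" for x
    using DN[of x] by (auto simp: D_def intro!: integrableI_nonneg) (subst integral_eq_nn_integral, auto)
  have intD: "integrable (M \<Otimes>\<^sub>M N) (\<lambda>(x, y). D x y)"
  proof (rule integrableI_nonneg)
    have "(\<integral>\<^sup>+z. ennreal (case z of (x, y) \<Rightarrow> D x y) \<partial>(M \<Otimes>\<^sub>M N)) = (\<integral>\<^sup>+x. \<integral>\<^sup>+y. ennreal (D x y) \<partial>N \<partial>M)"
      by (subst N.nn_integral_fst[symmetric]) auto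
    also have "\<dots> = 1" using DN MN1 by (simp add: D_def spaces)
    finally show "(\<integral>\<^sup>+z. ennreal (case z of (x, y) \<Rightarrow> D x y) \<partial>(M \<Otimes>\<^sub>M N)) < \<infinity>" by simp
  qed (auto simp: D_def)
  have intD': "integrable (M \<Otimes>\<^sub>M N) (\<lambda>(x, y). D x y * h (x, y))"
    if [measurable]: "h \<in> borel_measurable (M \<Otimes>\<^sub>M N)" and "\<And>z. \<bar>h z\<bar> \<le> K" for h
  proof (rule Bochner_Integration.integrable_bound)
    show "integrable (M \<Otimes>\<^sub>M N) (\<lambda>z. K * (case z of (x, y) \<Rightarrow> D x y))" using intD by simp
    show "AE z in M \<Otimes>\<^sub>M N. norm (case z of (x, y) \<Rightarrow> D x y * h (x, y)) \<le> norm (K * (case z of (x, y) \<Rightarrow> D x y))"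
    proof (intro AE_I2)
      fix z :: "'a \<times> 'a"
      obtain x y where z: "z = (x, y)" by force
      have "D x y * \<bar>h (x, y)\<bar> \<le> D x y * K" using that(2) D0[of x y] by (intro mult_left_mono) auto
      then show "norm (case z of (x, y) \<Rightarrow> D x y * h (x, y)) \<le> norm (K * (case z of (x, y) \<Rightarrow> D x y))"
        using D0[of x y] K by (simp add: z abs_mult mult.commute)
    qed
  qed measurable
  define hM where "hM x = clamp1 K (\<phi> x - f x)" for x
  define hN where "hN y = clamp1 K (\<psi> y - \<phi>s y)" for y
  have [measurable]: "hM \<in> borel_measurable borel" "hN \<in> borel_measurable borel" unfolding hM_def hN_def by measurable
  have iM: "integrable (M \<Otimes>\<^sub>M N) (\<lambda>(x, y). D x y * hM x)" and iN: "integrable (M \<Otimes>\<^sub>M N) (\<lambda>(x, y). D x y * hN y)"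
    using intD'[of "\<lambda>z. hM (fst z)"] intD'[of "\<lambda>z. hN (snd z)"] abs_clamp1[OF K] by (simp_all add: hM_def hN_def)
  have eM: "(\<integral>(x, y). D x y * hM x \<partial>(M \<Otimes>\<^sub>M N)) = (LINT x|M. hM x)"
    using integral_fst'[OF iM] DNr by simp
  have eN: "(\<integral>(x, y). D x y * hN y \<partial>(M \<Otimes>\<^sub>M N)) = (LINT y|N. hN y)"
    using integral_snd[OF iN] DMr by simp
  have eD: "(\<integral>(x, y). D x y \<partial>(M \<Otimes>\<^sub>M N)) = 1"
    using integral_fst'[OF intD] DNr mMN by (simp add: spaces)
  have pw: "D x y * hN y - e * m * D x y - 2 * K * exp (- m) \<le> D x y * hM x" if y: "\<forall>x. x \<bullet> y \<le> \<phi> x + \<phi>s y" for x y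
  proof (cases "- m \<le> (x \<bullet> y - f x - \<psi> y) / e")
    case True
    then have "- (e * m) \<le> x \<bullet> y - f x - \<psi> y" using e by (simp add: field_simps)
    then have "\<psi> y - \<phi>s y - e * m \<le> \<phi> x - f x" using y[rule_format, of x] by linarith
    then have "hN y - e * m \<le> hM x"
      using clamp1_diff[of "e * m" K "\<psi> y - \<phi>s y"] clamp1_mono[of "\<psi> y - \<phi>s y - e * m" "\<phi> x - f x" K] e m
      by (simp add: hM_def hN_def)
    then have "D x y * (hN y - e * m) \<le> D x y * hM x" using D0[of x y] by (intro mult_left_mono) auto
    moreover have "0 \<le> 2 * K * exp (- m)" using K by simp
    moreover have "D x y * (e * m) = e * m * D x y" by simp
    ultimately show ?thesis unfolding right_diff_distrib by linarith
  next
    case False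
    then have "D x y \<le> exp (- m)" by (simp add: D_def)
    moreover have "hN y - hM x \<le> 2 * K" using abs_clamp1[OF K, of "\<psi> y - \<phi>s y"] abs_clamp1[OF K, of "\<phi> x - f x"]
      by (simp add: hM_def hN_def)
    ultimately have "D x y * (hN y - hM x) \<le> exp (- m) * (2 * K)"
      using D0[of x y] K by (intro order_trans[OF mult_left_mono mult_right_mono]) auto
    moreover have "0 \<le> e * m * D x y" using e m D0[of x y] by simp
    ultimately show ?thesis unfolding right_diff_distrib by (simp add: mult.commute)
  qed
  have "AE z in M \<Otimes>\<^sub>M N. \<forall>x. x \<bullet> snd z \<le> \<phi> x + \<phi>s (snd z)"
  proof -
    obtain Z where Z: "Z \<in> null_sets N" "{y \<in> space N. \<not> (\<forall>x. x \<bullet> y \<le> \<phi> x + \<phi>s y)} \<subseteq> Z"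
      using young by (auto simp: eventually_ae_filter)
    have "emeasure (M \<Otimes>\<^sub>M N) (space M \<times> Z) = emeasure M (space M) * emeasure N Z"
      using Z by (intro N.emeasure_pair_measure_Times) auto
    then have "space M \<times> Z \<in> null_sets (M \<Otimes>\<^sub>M N)" using Z by (intro null_setsI) auto
    then show ?thesis by (rule AE_I') (use Z(2) in \<open>auto simp: spaces\<close>)
  qed
  then have "(\<integral>z. (case z of (x, y) \<Rightarrow> D x y * hN y) - e * m * (case z of (x, y) \<Rightarrow> D x y) - 2 * K * exp (- m) \<partial>(M \<Otimes>\<^sub>M N))
      \<le> (\<integral>(x, y). D x y * hM x \<partial>(M \<Otimes>\<^sub>M N))"
  proof (intro integral_mono_AE)
    interpret P: finite_measure "M \<Otimes>\<^sub>M N" by (intro finite_measure_pair_measure) unfold_locales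
    show "integrable (M \<Otimes>\<^sub>M N) (\<lambda>z. (case z of (x, y) \<Rightarrow> D x y * hN y) - e * m * (case z of (x, y) \<Rightarrow> D x y) - 2 * K * exp (- m))"
      using iN intD by (intro Bochner_Integration.integrable_diff integrable_mult_right) auto
    show "AE z in M \<Otimes>\<^sub>M N. (case z of (x, y) \<Rightarrow> D x y * hN y) - e * m * (case z of (x, y) \<Rightarrow> D x y) - 2 * K * exp (- m)
      \<le> (case z of (x, y) \<Rightarrow> D x y * hM x)"
      if "AE z in M \<Otimes>\<^sub>M N. \<forall>x. x \<bullet> snd z \<le> \<phi> x + \<phi>s (snd z)"
      using that by eventually_elim (auto intro: pw)
  qed (use iM in auto)
  also have "(\<integral>z. (case z of (x, y) \<Rightarrow> D x y * hN y) - e * m * (case z of (x, y) \<Rightarrow> D x y) - 2 * K * exp (- m) \<partial>(M \<Otimes>\<^sub>M N))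
      = (LINT y|N. hN y) - e * m - 2 * K * exp (- m)"
  proof -
    interpret P: finite_measure "M \<Otimes>\<^sub>M N" by (intro finite_measure_pair_measure) unfold_locales
    have "measure (M \<Otimes>\<^sub>M N) (space (M \<Otimes>\<^sub>M N)) = 1"
      using MN1 N.emeasure_pair_measure_Times[of "space M" M "space N"] by (simp add: measure_def space_pair_measure spaces)
    then show ?thesis using iN intD eN eD by simp
  qed
  finally show ?thesis unfolding eM unfolding hM_def hN_def .
qed

text \<open>Approximate subgradients at points near x are bounded, since testing each in its own
  direction bounds its norm by the size of f near x; a subsequence converges and the inequalities
  pass to the limit.\<close>

lemma common_subgradient_limit:
  fixes f g :: "'a::euclidean_space \<Rightarrow> real"
  assumes cont: "continuous_on UNIV f" "continuous_on UNIV g"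
    and approx: "\<And>x \<rho> \<delta>. 0 < \<rho> \<Longrightarrow> 0 < \<delta> \<Longrightarrow> \<exists>x' y. dist x' x < \<rho> \<and>
      (\<forall>z. f x' + y \<bullet> (z - x') - \<delta> \<le> f z \<and> g x' + y \<bullet> (z - x') - \<delta> \<le> g z)"
  shows "\<exists>y. \<forall>z. f x + y \<bullet> (z - x) \<le> f z \<and> g x + y \<bullet> (z - x) \<le> g z"
proof -
  have "\<exists>x' y. dist x' x < 1 / real (Suc n) \<and>
      (\<forall>z. f x' + y \<bullet> (z - x') - 1 / real (Suc n) \<le> f z \<and> g x' + y \<bullet> (z - x') - 1 / real (Suc n) \<le> g z)" for n
    by (rule approx) auto
  then obtain X Y where X: "\<And>n. dist (X n) x < 1 / real (Suc n)"
    and f: "\<And>n z. f (X n) + Y n \<bullet> (z - X n) - 1 / real (Suc n) \<le> f z"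
    and g: "\<And>n z. g (X n) + Y n \<bullet> (z - X n) - 1 / real (Suc n) \<le> g z" by metis
  have lim0: "(\<lambda>n. 1 / real (Suc n)) \<longlonglongrightarrow> 0" using LIMSEQ_inverse_real_of_nat by (simp add: inverse_eq_divide)
  have "(\<lambda>n. dist (X n) x) \<longlonglongrightarrow> 0"
    by (rule tendsto_sandwich[OF always_eventually always_eventually tendsto_const lim0])
       (auto simp del: of_nat_Suc intro: less_imp_le[OF X])
  then have Xlim: "X \<longlonglongrightarrow> x" by (subst tendsto_dist_iff)
  have "bounded (f ` cball x 2)"
    by (intro compact_imp_bounded compact_continuous_image compact_cball) (rule continuous_on_subset[OF cont(1)], simp)
  then obtain B where "\<forall>v\<in>f ` cball x 2. norm v \<le> B" by (auto simp: bounded_iff)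
  then have B: "\<bar>f z\<bar> \<le> B" if "dist z x \<le> 2" for z using that by (simp add: dist_commute)
  have Y: "norm (Y n) \<le> 2 * B + 1" for n
  proof -
    have X1: "dist (X n) x < 1" using X[of n] by (rule less_le_trans) simp
    have "Y n \<bullet> (X n + sgn (Y n) - X n) = norm (Y n)"
      by (cases "Y n = 0") (simp_all add: sgn_div_norm dot_square_norm power2_eq_square)
    then have "f (X n) + norm (Y n) - 1 / real (Suc n) \<le> f (X n + sgn (Y n))"
      using f[of n "X n + sgn (Y n)"] by simp
    moreover have "dist (X n + sgn (Y n)) x \<le> 2"
    proof -
      have "dist (X n + sgn (Y n)) x \<le> dist (X n + sgn (Y n)) (X n) + dist (X n) x" by (rule dist_triangle)
      also have "dist (X n + sgn (Y n)) (X n) \<le> 1" by (simp add: dist_norm norm_sgn)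
      finally show ?thesis using X1 by simp
    qed
    then have "\<bar>f (X n + sgn (Y n))\<bar> \<le> B" "\<bar>f (X n)\<bar> \<le> B" using X1 by (auto intro!: B)
    moreover have "1 / real (Suc n) \<le> 1" by simp
    ultimately show ?thesis by linarith
  qed
  have "bounded (range Y)" using Y by (auto simp: bounded_iff)
  then obtain y k where k: "strict_mono (k :: nat \<Rightarrow> nat)" and y: "(Y \<circ> k) \<longlonglongrightarrow> y"
    using bounded_imp_convergent_subsequence[of Y] by auto
  have Xk: "(\<lambda>n. X (k n)) \<longlonglongrightarrow> x" using LIMSEQ_subseq_LIMSEQ[OF Xlim k] by (simp add: o_def)
  have Yk: "(\<lambda>n. Y (k n)) \<longlonglongrightarrow> y" using y by (simp add: o_def)
  have lk: "(\<lambda>n. 1 / real (Suc (k n))) \<longlonglongrightarrow> 0" using LIMSEQ_subseq_LIMSEQ[OF lim0 k] by (simp add: o_def)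
  have "h x + y \<bullet> (z - x) - 0 \<le> h z" if h: "continuous_on UNIV h" "\<And>n z. h (X n) + Y n \<bullet> (z - X n) - 1 / real (Suc n) \<le> h z" for h z
  proof (rule LIMSEQ_le_const2)
    show "(\<lambda>n. h (X (k n)) + Y (k n) \<bullet> (z - X (k n)) - 1 / real (Suc (k n))) \<longlonglongrightarrow> h x + y \<bullet> (z - x) - 0"
      using h(1) by (intro tendsto_intros Xk Yk lk continuous_on_tendsto_compose[OF h(1) Xk]) auto
  qed (use h(2) in blast)
  from this[OF cont(1) f] this[OF cont(2) g] show ?thesis by auto
qed

text \<open>For dense \<open>D\<close> and continuous \<open>f\<close> this is the truncation of \<open>f\<^sup>* - \<phi>s\<close>; countability of \<open>D\<close> gives measurability.\<close>

definition csup :: "'a::real_inner set \<Rightarrow> real \<Rightarrow> ('a \<Rightarrow> real) \<Rightarrow> ('a \<Rightarrow> real) \<Rightarrow> 'a \<Rightarrow> real" where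
  "csup D K f \<phi>s y = (SUP x\<in>D. clamp1 K (x \<bullet> y - f x - \<phi>s y))"

context
  fixes D :: "'a::euclidean_space set" and K :: real
  assumes D: "countable D" "\<And>X. open X \<Longrightarrow> X \<noteq> {} \<Longrightarrow> \<exists>d\<in>D. d \<in> X" and K: "0 \<le> K"
begin

lemma D_nonempty: "D \<noteq> {}"
  using D(2)[of UNIV] by auto

lemma bdd_above_csup: "bdd_above ((\<lambda>x. clamp1 K (x \<bullet> y - f x - \<phi>s y)) ` D)"
  using abs_clamp1[OF K] by (intro bdd_aboveI[of _ K]) (auto simp: abs_le_iff)

lemma csup_upper:
  assumes f: "continuous_on UNIV f"
  shows "clamp1 K (x \<bullet> y - f x - \<phi>s y) \<le> csup D K f \<phi>s y"
proof (rule ccontr)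
  assume "\<not> ?thesis"
  then have x: "csup D K f \<phi>s y < clamp1 K (x \<bullet> y - f x - \<phi>s y)" by simp
  have "continuous_on UNIV (\<lambda>x. clamp1 K (x \<bullet> y - f x - \<phi>s y))"
    by (rule continuous_on_compose2[OF continuous_clamp1]) (auto intro!: continuous_intros f)
  then have "open {x. csup D K f \<phi>s y < clamp1 K (x \<bullet> y - f x - \<phi>s y)}"
    by (intro open_Collect_less continuous_on_const)
  then obtain d where "d \<in> D" "csup D K f \<phi>s y < clamp1 K (d \<bullet> y - f d - \<phi>s y)"
    using D(2) x by blast
  moreover have "clamp1 K (d \<bullet> y - f d - \<phi>s y) \<le> csup D K f \<phi>s y" if "d \<in> D" for d
    unfolding csup_def using that bdd_above_csup by (rule cSUP_upper)
  ultimately show False by fastforce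
qed

lemma abs_csup: "\<bar>csup D K f \<phi>s y\<bar> \<le> K"
proof -
  have "csup D K f \<phi>s y \<le> K"
    unfolding csup_def using D_nonempty abs_clamp1[OF K] by (intro cSUP_least) (auto simp: abs_le_iff)
  moreover obtain d where d: "d \<in> D" using D_nonempty by auto
  then have "clamp1 K (d \<bullet> y - f d - \<phi>s y) \<le> csup D K f \<phi>s y"
    unfolding csup_def using bdd_above_csup by (rule cSUP_upper)
  moreover have "- K \<le> clamp1 K (d \<bullet> y - f d - \<phi>s y)" by (simp add: clamp1_def)
  ultimately show ?thesis by linarith
qed

lemma measurable_csup:
  assumes [measurable]: "\<phi>s \<in> borel_measurable borel"
  shows "csup D K f \<phi>s \<in> borel_measurable borel"
  unfolding csup_def[abs_def] using D(1) bdd_above_csup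
  by (intro borel_measurable_cSUP) auto

end

text \<open>A sequence of Schroedinger systems with e tending to 0. \<open>lower\<close> bounds the
  mass of balls under the first marginals from below and \<open>dom\<close> makes the second
  marginals uniformly tight; together they bound \<open>f k\<close> locally without using moments.
  The pair \<open>\<phi>\<close>, \<open>\<phi>s\<close> is the competitor, to be the given
  potential and its conjugate.\<close>

locale entropic_limit =
  fixes m n \<phi> \<phi>s :: "'a::euclidean_space \<Rightarrow> real" and mk nk f \<psi> :: "nat \<Rightarrow> 'a \<Rightarrow> real" and e :: "nat \<Rightarrow> real" and C :: real
  assumes meas[measurable]: "m \<in> borel_measurable borel" "n \<in> borel_measurable borel" "\<phi>s \<in> borel_measurable borel"
      "\<And>k. mk k \<in> borel_measurable borel" "\<And>k. nk k \<in> borel_measurable borel" "\<And>k. \<psi> k \<in> borel_measurable borel"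
    and int: "integrable lborel m" "integrable lborel n"
    and nonneg: "\<And>k x. 0 \<le> mk k x" "\<And>k x. 0 \<le> nk k x" "\<And>x. 0 \<le> m x" "\<And>x. 0 \<le> n x"
    and dom: "\<And>k x. mk k x \<le> C * m x" "\<And>k x. nk k x \<le> C * n x"
    and lim: "\<And>x. (\<lambda>k. mk k x) \<longlonglongrightarrow> m x" "\<And>x. (\<lambda>k. nk k x) \<longlonglongrightarrow> n x"
    and prob: "\<And>k. (LINT x|lborel. mk k x) = 1" "\<And>k. (LINT x|lborel. nk k x) = 1"
    and lower: "\<And>r. \<exists>c>0. \<forall>k x. norm x \<le> r \<longrightarrow> c \<le> mk k x"
    and f: "\<And>k. convex_on UNIV (f k)" "\<And>k. f k 0 = 0"
    and e: "\<And>k. 0 < e k" "\<And>k. e k \<le> 1" "e \<longlonglongrightarrow> 0"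
    and DM: "\<And>k y. (\<integral>\<^sup>+x. ennreal (gibbs (e k) (f k) (\<psi> k) x y) \<partial>density lborel (\<lambda>x. ennreal (mk k x))) = 1"
    and DN: "\<And>k x. (\<integral>\<^sup>+y. ennreal (gibbs (e k) (f k) (\<psi> k) x y) \<partial>density lborel (\<lambda>y. ennreal (nk k y))) = 1"
    and \<phi>_cont: "continuous_on UNIV \<phi>"
    and young: "AE y in density lborel (\<lambda>y. ennreal (n y)). \<forall>x. x \<bullet> y \<le> \<phi> x + \<phi>s y"
begin

abbreviation "M k \<equiv> density lborel (\<lambda>x. ennreal (mk k x))"
abbreviation "N k \<equiv> density lborel (\<lambda>x. ennreal (nk k x))"

lemma int_k: "integrable lborel (mk k)" "integrable lborel (nk k)"
  by (rule Bochner_Integration.integrable_bound[of lborel "\<lambda>x. C * m x"];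
      use int nonneg dom[of k] in \<open>auto intro!: AE_I2 order_trans[OF _ abs_ge_self]\<close>)
     (rule Bochner_Integration.integrable_bound[of lborel "\<lambda>x. C * n x"];
      use int nonneg dom[of k] in \<open>auto intro!: AE_I2 order_trans[OF _ abs_ge_self]\<close>)

lemma emeasure_k: "emeasure (M k) UNIV = 1" "emeasure (N k) UNIV = 1"
proof -
  have "(\<integral>\<^sup>+x. ennreal (mk k x) \<partial>lborel) = 1" "(\<integral>\<^sup>+x. ennreal (nk k x) \<partial>lborel) = 1"
    using nn_integral_eq_integral[OF int_k(1)[of k]] nn_integral_eq_integral[OF int_k(2)[of k]] prob nonneg by auto
  then show "emeasure (M k) UNIV = 1" "emeasure (N k) UNIV = 1" by (simp_all add: emeasure_density)
qed

lemma finite_k: "finite_measure (M k)" "finite_measure (N k)"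
  by (auto intro!: finite_measureI simp: emeasure_k)

lemma ball_lower: "\<exists>v>0. \<forall>k c. norm c \<le> r \<longrightarrow> ennreal v \<le> emeasure (M k) (ball c \<rho>)" if "0 < \<rho>"
proof -
  obtain c0 where c0: "c0 > 0" "\<And>k x. norm x \<le> r + \<rho> \<Longrightarrow> c0 \<le> mk k x" using lower by blast
  define v where "v = unit_ball_vol (real DIM('a)) * \<rho> ^ DIM('a)"
  have v: "0 < v" using that by (simp add: v_def)
  have "ennreal (c0 * v) \<le> emeasure (M k) (ball c \<rho>)" if c: "norm c \<le> r" for k c
  proof -
    have "ennreal (c0 * v) = ennreal c0 * emeasure lborel (ball c \<rho>)"
      using c0 v \<open>0 < \<rho>\<close> by (simp add: emeasure_ball v_def ennreal_mult')
    also have "\<dots> = (\<integral>\<^sup>+x. ennreal c0 * indicator (ball c \<rho>) x \<partial>lborel)"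
      by (subst nn_integral_cmult_indicator) auto
    also have "\<dots> \<le> (\<integral>\<^sup>+x. ennreal (mk k x) * indicator (ball c \<rho>) x \<partial>lborel)"
    proof (intro nn_integral_mono)
      fix x
      have "c0 \<le> mk k x" if "x \<in> ball c \<rho>"
        using that c norm_triangle_ineq2[of x c] by (intro c0) (simp add: dist_norm norm_minus_commute)
      then show "ennreal c0 * indicator (ball c \<rho>) x \<le> ennreal (mk k x) * indicator (ball c \<rho>) x"
        by (auto simp: indicator_def intro: ennreal_leI)
    qed
    also have "\<dots> = emeasure (M k) (ball c \<rho>)" by (simp add: emeasure_density)
    finally show ?thesis .
  qed
  then show ?thesis using c0 v by (intro exI[of _ "c0 * v"]) auto
qed

lemma tight: "\<exists>l\<ge>0. \<forall>k. emeasure (N k) {y. l < norm y} < ennreal \<eta>" if \<eta>: "0 < \<eta>"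
proof -
  have "(\<lambda>l. \<integral>y. C * n y * indicator {y. real l < norm y} y \<partial>lborel) \<longlonglongrightarrow> (\<integral>y. 0 \<partial>(lborel :: 'a measure))"
  proof (rule integral_dominated_convergence[where w = "\<lambda>y. \<bar>C * n y\<bar>"])
    show "AE y in lborel. (\<lambda>l. C * n y * indicator {y. real l < norm y} y) \<longlonglongrightarrow> 0"
    proof (intro AE_I2 tendsto_eventually)
      fix y :: 'a
      have "\<forall>\<^sub>F l in sequentially. norm y \<le> real l"
        by (rule eventually_ge_at_top[of "nat \<lceil>norm y\<rceil>", THEN eventually_mono]) linarith
      then show "\<forall>\<^sub>F l in sequentially. C * n y * indicator {y. real l < norm y} y = 0"
        by eventually_elim simp
    qed
  qed (use int in \<open>auto intro!: AE_I2 simp: indicator_def\<close>)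
  then have "\<forall>\<^sub>F l in sequentially. (LINT y|lborel. C * n y * indicator {y. real l < norm y} y) < \<eta>"
    using \<eta> by (intro order_tendstoD) auto
  then obtain l :: nat where l: "(LINT y|lborel. C * n y * indicator {y. real l < norm y} y) < \<eta>"
    using eventually_happens'[OF sequentially_bot] by blast
  have "emeasure (N k) {y. real l < norm y} < ennreal \<eta>" for k
  proof -
    have i: "integrable lborel (\<lambda>y. C * n y * indicator {y. real l < norm y} y)"
      using int by (intro integrable_real_mult_indicator) auto
    have nn: "0 \<le> C * n y" for y using dom(2)[of k y] nonneg(2)[of k y] by linarith
    have "emeasure (N k) {y. real l < norm y} = (\<integral>\<^sup>+y. ennreal (nk k y) * indicator {y. real l < norm y} y \<partial>lborel)"
      by (subst emeasure_density) auto
    also have "\<dots> \<le> (\<integral>\<^sup>+y. ennreal (C * n y * indicator {y. real l < norm y} y) \<partial>lborel)"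
      using dom(2)[of k] by (intro nn_integral_mono) (auto simp: indicator_def ennreal_leI)
    also have "\<dots> = ennreal (LINT y|lborel. C * n y * indicator {y. real l < norm y} y)"
      using nn i by (intro nn_integral_eq_integral) auto
    also have "\<dots> < ennreal \<eta>" using l \<eta> by (rule ennreal_lessI[rotated])
    finally show ?thesis .
  qed
  then show ?thesis by (intro exI[of _ "real l"]) auto
qed

lemma locally_bounded: "\<exists>B. \<forall>k x. norm x \<le> r \<longrightarrow> \<bar>f k x\<bar> \<le> B" if r: "0 < r" for r
proof -
  obtain v where v: "v > 0" "\<And>k c. norm c \<le> 2 * r \<Longrightarrow> ennreal v \<le> emeasure (M k) (ball c (r / 4))"
    using ball_lower[of "r / 4" "2 * r"] r by auto
  obtain l where l: "l \<ge> 0" "\<And>k. emeasure (N k) {y. l < norm y} < ennreal (v / 2)"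
    using tight[of "v / 2"] v by auto
  have up: "f k x \<le> 2 * r * l + 1" if "norm x \<le> r" for k x
  proof (rule entropic_potential_upper_bound[where M = "M k" and N = "N k" and \<psi> = "\<psi> k" and e = "e k" and \<eta> = "v / 2"])
    show "sigma_finite_measure (M k)" "sigma_finite_measure (N k)"
      using finite_k[of k] by (auto simp: finite_measure_def)
  qed (use f e DM DN r l v that in auto)
  have "\<bar>f k x\<bar> \<le> 2 * r * l + 1" if x: "norm x \<le> r" for k x
  proof -
    \<comment> \<open>Convexity and \<open>f k 0 = 0\<close> turn the upper bound at
      \<open>- x\<close> into a lower bound at x.\<close>
    have "f k ((1 - 1/2) *\<^sub>R x + (1/2) *\<^sub>R (- x)) \<le> (1 - 1/2) * f k x + (1/2) * f k (- x)"
      by (intro convex_onD[OF f(1)]) auto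
    then have "- f k (- x) \<le> f k x" using f(2) by simp
    then show ?thesis using up[of x k] up[of "- x" k] x by (simp add: abs_le_iff)
  qed
  then show ?thesis by blast
qed

lemma equicontinuous: "\<exists>d>0. \<forall>k y. dist y x < d \<longrightarrow> \<bar>f k y - f k x\<bar> < \<epsilon>" if \<epsilon>: "0 < \<epsilon>"
proof -
  obtain B where B: "\<And>k z. norm z \<le> norm x + 1 \<Longrightarrow> \<bar>f k z\<bar> \<le> B"
    using locally_bounded[of "norm x + 1"] by (auto simp: add_nonneg_pos)
  have B0: "0 \<le> B" using B[of x 0] by (smt (verit) norm_ge_zero)
  define d where "d = min 1 (\<epsilon> / (2 * B + 1))"
  have d: "0 < d" "d \<le> 1" "d * (2 * B + 1) \<le> \<epsilon>" 
  proof -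
    have p: "0 < 2 * B + 1" using B0 by simp
    show "0 < d" "d \<le> 1" using \<epsilon> p by (simp_all add: d_def)
    have "d \<le> \<epsilon> / (2 * B + 1)" by (simp add: d_def)
    then show "d * (2 * B + 1) \<le> \<epsilon>" using p by (simp only: pos_le_divide_eq)
  qed
  have "\<bar>f k y - f k x\<bar> < \<epsilon>" if y: "dist y x < d" for k y
  proof -
    have "\<bar>f k z\<bar> \<le> B" if "dist z x \<le> 1" for z
      using that norm_triangle_ineq2[of z x] by (intro B) (simp add: dist_norm)
    then have "\<bar>f k y - f k x\<bar> \<le> 2 * B * dist y x"
      using y d by (intro convex_local_lipschitz f) auto
    also have "\<dots> \<le> (2 * B + 1) * dist y x" by (simp add: distrib_right)
    also have "\<dots> < (2 * B + 1) * d" using y B0 by (intro mult_strict_left_mono) auto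
    also have "\<dots> \<le> \<epsilon>" using d by (simp add: mult.commute)
    finally show ?thesis .
  qed
  then show ?thesis using d by blast
qed

text \<open>Laplace's method from below: keeping only a small ball around x in the integral that
  determines \<open>\<psi> k y\<close> costs the vanishing term \<open>e k * ln v\<close>, with v a
  lower bound for the mass of that ball. If \<open>f k\<close> converges pointwise, the limit
  inferior of \<open>\<psi> k\<close> therefore dominates the Legendre transform of the
  limit.\<close>

lemma psi_lower:
  assumes lim_f: "(\<lambda>k. f k x) \<longlonglongrightarrow> f0" and \<epsilon>: "0 < \<epsilon>"
  shows "\<forall>\<^sub>F k in sequentially. x \<bullet> y - f0 - \<epsilon> \<le> \<psi> k y"
proof -
  obtain d where d: "d > 0" "\<And>k z. dist z x < d \<Longrightarrow> \<bar>f k z - f k x\<bar> < \<epsilon> / 4"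
    using equicontinuous[of "\<epsilon> / 4" x] \<epsilon> by auto
  define \<rho> where "\<rho> = min d (\<epsilon> / (4 * (norm y + 1)))"
  have \<rho>: "0 < \<rho>" "\<rho> \<le> d" "\<rho> * norm y \<le> \<epsilon> / 4"
  proof -
    have p: "0 < norm y + 1" by (simp add: add_nonneg_pos)
    then show "0 < \<rho>" "\<rho> \<le> d" using d \<epsilon> by (simp_all add: \<rho>_def)
    have "\<rho> * norm y \<le> \<rho> * (norm y + 1)" using \<open>0 < \<rho>\<close> by (simp add: distrib_left)
    also have "\<rho> \<le> \<epsilon> / 4 / (norm y + 1)" by (simp add: \<rho>_def)
    then have "\<rho> * (norm y + 1) \<le> \<epsilon> / 4" using p by (simp add: pos_le_divide_eq algebra_simps)
    finally show "\<rho> * norm y \<le> \<epsilon> / 4" .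
  qed
  obtain v where v: "v > 0" "\<And>k c. norm c \<le> norm x \<Longrightarrow> ennreal v \<le> emeasure (M k) (ball c \<rho>)"
    using ball_lower[OF \<rho>(1), of "norm x"] by auto
  have *: "x \<bullet> y - f k x - \<epsilon> / 2 + e k * ln v \<le> \<psi> k y" for k
  proof -
    have pt: "x \<bullet> y - f k x - \<epsilon> / 2 \<le> z \<bullet> y - f k z" if z: "z \<in> ball x \<rho>" for z
    proof -
      have "(x - z) \<bullet> y \<le> norm (x - z) * norm y" by (rule norm_cauchy_schwarz)
      also have "\<dots> \<le> \<rho> * norm y" using z by (intro mult_right_mono) (auto simp: dist_norm)
      finally have "x \<bullet> y - z \<bullet> y \<le> \<epsilon> / 4" using \<rho> by (simp add: inner_diff_left)
      moreover have "\<bar>f k z - f k x\<bar> < \<epsilon> / 4" using z \<rho> by (intro d) (auto simp: dist_commute)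
      ultimately show ?thesis by linarith
    qed
    define a where "a = exp ((x \<bullet> y - f k x - \<epsilon> / 2 - \<psi> k y) / e k)"
    have pt': "a \<le> gibbs (e k) (f k) (\<psi> k) z y" if z: "z \<in> ball x \<rho>" for z
    proof -
      have "x \<bullet> y - f k x - \<epsilon> / 2 - \<psi> k y \<le> z \<bullet> y - f k z - \<psi> k y" using pt[OF z] by linarith
      then show ?thesis unfolding a_def using e(1)[of k] by (simp add: divide_right_mono)
    qed
    have "ennreal (a * v) = ennreal a * ennreal v" using v by (simp add: ennreal_mult' a_def)
    also have "\<dots> \<le> ennreal a * emeasure (M k) (ball x \<rho>)" by (intro mult_left_mono v) auto
    also have "\<dots> = (\<integral>\<^sup>+z. ennreal a * indicator (ball x \<rho>) z \<partial>M k)"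
      by (subst nn_integral_cmult_indicator) auto
    also have "\<dots> \<le> (\<integral>\<^sup>+z. ennreal (gibbs (e k) (f k) (\<psi> k) z y) \<partial>M k)"
      using pt' by (intro nn_integral_mono) (auto simp: indicator_def intro!: ennreal_leI)
    also have "\<dots> = 1" by (rule DM)
    finally have "a * v \<le> 1" by (simp add: ennreal_le_1)
    then have "ln (a * v) \<le> 0" using v by (intro ln_le_zero_iff[THEN iffD2]) (auto simp: a_def)
    then have "(x \<bullet> y - f k x - \<epsilon> / 2 - \<psi> k y) / e k + ln v \<le> 0" using v by (simp add: ln_mult a_def)
    then have "e k * ((x \<bullet> y - f k x - \<epsilon> / 2 - \<psi> k y) / e k + ln v) \<le> 0" using e(1)[of k] by (simp add: mult_le_0_iff)
    then show ?thesis using e(1)[of k] by (simp add: distrib_left)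
  qed
  have "(\<lambda>k. x \<bullet> y - f k x - \<epsilon> / 2 + e k * ln v) \<longlonglongrightarrow> x \<bullet> y - f0 - \<epsilon> / 2 + 0 * ln v"
    by (intro tendsto_intros lim_f e)
  then have "\<forall>\<^sub>F k in sequentially. x \<bullet> y - f0 - \<epsilon> < x \<bullet> y - f k x - \<epsilon> / 2 + e k * ln v"
    using \<epsilon> by (intro order_tendstoD) auto
  then show ?thesis
  proof eventually_elim
    fix k assume "x \<bullet> y - f0 - \<epsilon> < x \<bullet> y - f k x - \<epsilon> / 2 + e k * ln v"
    then show "x \<bullet> y - f0 - \<epsilon> \<le> \<psi> k y" using *[of k] by linarith
  qed
qed

text \<open>\<open>entropic_clamp_le\<close> in the limit: first k tends to infinity with the
  cut-off t fixed, which removes \<open>e k * t\<close>, then t does, which removes the exponential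
  error.\<close>

lemma limit_clamp:
  assumes lim_f: "\<And>x. (\<lambda>k. f k x) \<longlonglongrightarrow> g x" and g: "continuous_on UNIV g"
    and D: "countable D" "\<And>X. open X \<Longrightarrow> X \<noteq> {} \<Longrightarrow> \<exists>d\<in>D. d \<in> X" and K: "0 \<le> K"
  shows "(\<integral>y. csup D K g \<phi>s y \<partial>density lborel (\<lambda>y. ennreal (n y))) \<le> (\<integral>x. clamp1 K (\<phi> x - g x) \<partial>density lborel (\<lambda>x. ennreal (m x)))"
proof -
  have [measurable]: "\<phi> \<in> borel_measurable borel" "g \<in> borel_measurable borel" "\<And>k. f k \<in> borel_measurable borel"
    using \<phi>_cont g f by (auto intro!: borel_measurable_continuous_onI convex_on_continuous)
  have [measurable]: "csup D K g \<phi>s \<in> borel_measurable borel" by (rule measurable_csup[OF D K]) measurable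
  define G where "G = csup D K g \<phi>s"
  have [measurable]: "G \<in> borel_measurable borel" by (simp add: G_def)
  have G: "\<bar>G y\<bar> \<le> K" for y unfolding G_def by (rule abs_csup[OF D K])
  \<comment> \<open>\<open>\<psi> k\<close> is controlled from below only, so its clamped difference
    with \<open>\<phi>s\<close> is capped by \<open>G\<close>. The capped functions converge to
    \<open>G\<close>, and capping only strengthens the inequality's left side downwards.\<close>
  define h where "h k y = min (clamp1 K (\<psi> k y - \<phi>s y)) (G y)" for k y
  have [measurable]: "h k \<in> borel_measurable borel" for k unfolding h_def by measurable
  have h: "\<bar>h k y\<bar> \<le> K" for k y using G[of y] abs_clamp1[OF K, of "\<psi> k y - \<phi>s y"] by (auto simp: h_def)
  have hlim: "(\<lambda>k. h k y) \<longlonglongrightarrow> G y" for y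
  proof (rule order_tendstoI)
    fix a assume "G y < a"
    then show "\<forall>\<^sub>F k in sequentially. h k y < a" by (auto simp: h_def intro!: always_eventually)
  next
    fix a assume a: "a < G y"
    then obtain x where x: "x \<in> D" "a < clamp1 K (x \<bullet> y - g x - \<phi>s y)"
      unfolding G_def csup_def using less_cSUP_iff[OF D_nonempty[OF D K] bdd_above_csup[OF D K]] by auto
    define \<epsilon> where "\<epsilon> = (clamp1 K (x \<bullet> y - g x - \<phi>s y) - a) / 2"
    have \<epsilon>: "0 < \<epsilon>" using x by (simp add: \<epsilon>_def)
    show "\<forall>\<^sub>F k in sequentially. a < h k y"
      using psi_lower[OF lim_f[of x] \<epsilon>, of y]
    proof eventually_elim
      fix k assume k: "x \<bullet> y - g x - \<epsilon> \<le> \<psi> k y"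
      have "clamp1 K (x \<bullet> y - g x - \<phi>s y) - \<epsilon> \<le> clamp1 K (x \<bullet> y - g x - \<phi>s y - \<epsilon>)"
        using \<epsilon> by (intro clamp1_diff) auto
      also have "\<dots> \<le> clamp1 K (\<psi> k y - \<phi>s y)" using k by (intro clamp1_mono) auto
      finally show "a < h k y" using \<epsilon> a by (simp add: h_def \<epsilon>_def field_simps)
    qed
  qed
  have L: "(\<lambda>k. \<integral>x. u k x * p k x \<partial>lborel) \<longlonglongrightarrow> (LINT x|lborel. u0 x * p0 x)"
    if [measurable]: "\<And>k. u k \<in> borel_measurable borel" "u0 \<in> borel_measurable borel" "\<And>k. p k \<in> borel_measurable borel" "p0 \<in> borel_measurable borel"
      and u: "\<And>k x. 0 \<le> u k x" "\<And>k x. u k x \<le> C * u0 x" "\<And>x. (\<lambda>k. u k x) \<longlonglongrightarrow> u0 x" "integrable lborel u0"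
      and p: "\<And>k x. \<bar>p k x\<bar> \<le> K" "\<And>x. (\<lambda>k. p k x) \<longlonglongrightarrow> p0 x"
    for u p :: "nat \<Rightarrow> 'a \<Rightarrow> real" and u0 p0
  proof (rule integral_dominated_convergence[where w = "\<lambda>x. C * u0 x * K"])
    show "AE x in lborel. norm (u k x * p k x) \<le> C * u0 x * K" for k
    proof (intro AE_I2)
      fix x
      have "\<bar>u k x\<bar> * \<bar>p k x\<bar> \<le> (C * u0 x) * K" using u(1,2)[of k x] p(1)[of k x] by (intro mult_mono) auto
      then show "norm (u k x * p k x) \<le> C * u0 x * K" by (simp add: abs_mult)
    qed
    show "AE x in lborel. (\<lambda>k. u k x * p k x) \<longlonglongrightarrow> u0 x * p0 x" by (intro AE_I2 tendsto_mult u p)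
  qed (use u in auto)
  have densM: "(\<integral>x. p x \<partial>density lborel (\<lambda>x. ennreal (u x))) = (LINT x|lborel. u x * p x)"
    if "u \<in> borel_measurable borel" "p \<in> borel_measurable borel" "\<And>x. 0 \<le> u x" for u p :: "'a \<Rightarrow> real"
    using that by (simp add: integral_density)
  have A: "(\<lambda>k. \<integral>x. clamp1 K (\<phi> x - f k x) \<partial>M k) \<longlonglongrightarrow> (\<integral>x. clamp1 K (\<phi> x - g x) \<partial>density lborel (\<lambda>x. ennreal (m x)))"
  proof -
    have "(\<lambda>k. clamp1 K (\<phi> x - f k x)) \<longlonglongrightarrow> clamp1 K (\<phi> x - g x)" for x
      by (intro continuous_on_tendsto_compose[OF continuous_clamp1] tendsto_intros lim_f) auto
    then show ?thesis using nonneg dom lim int abs_clamp1[OF K]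
      by (simp add: densM) (intro L; simp)
  qed
  have B: "(\<lambda>k. \<integral>y. h k y \<partial>N k) \<longlonglongrightarrow> (\<integral>y. G y \<partial>density lborel (\<lambda>y. ennreal (n y)))"
    using nonneg dom lim int h hlim by (simp add: densM) (intro L; simp)
  \<comment> \<open>\<open>nk k\<close> vanishes wherever \<open>n\<close> does, so an exceptional
    set that is null for the limit is null for every \<open>N k\<close>.\<close>
  have young_k: "AE y in N k. \<forall>x. x \<bullet> y \<le> \<phi> x + \<phi>s y" for k
  proof -
    have "AE y in lborel. 0 < n y \<longrightarrow> (\<forall>x. x \<bullet> y \<le> \<phi> x + \<phi>s y)"
      using young by (subst (asm) AE_density) auto
    then have "AE y in lborel. 0 < nk k y \<longrightarrow> (\<forall>x. x \<bullet> y \<le> \<phi> x + \<phi>s y)"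
    proof eventually_elim
      fix y assume y: "0 < n y \<longrightarrow> (\<forall>x. x \<bullet> y \<le> \<phi> x + \<phi>s y)"
      have "n y \<noteq> 0" if "0 < nk k y" using dom(2)[of k y] that by auto
      then show "0 < nk k y \<longrightarrow> (\<forall>x. x \<bullet> y \<le> \<phi> x + \<phi>s y)" using y nonneg(4)[of y] by force
    qed
    then show ?thesis by (subst AE_density) auto
  qed
  have main: "(\<integral>y. h k y \<partial>N k) - e k * t - 2 * K * exp (- t) \<le> (\<integral>x. clamp1 K (\<phi> x - f k x) \<partial>M k)" if t: "0 \<le> t" for k t
  proof -
    interpret Nk: finite_measure "N k" by (rule finite_k)
    have "(\<integral>y. h k y \<partial>N k) \<le> (\<integral>y. clamp1 K (\<psi> k y - \<phi>s y) \<partial>N k)"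
      using h abs_clamp1[OF K]
      by (intro integral_mono Nk.integrable_const_bound[where B = K]) (auto simp: h_def)
    moreover have "(\<integral>y. clamp1 K (\<psi> k y - \<phi>s y) \<partial>N k) - e k * t - 2 * K * exp (- t) \<le> (\<integral>x. clamp1 K (\<phi> x - f k x) \<partial>M k)"
      by (rule entropic_clamp_le[where e = "e k"]) (use finite_k emeasure_k e DM DN young_k K t in auto)
    ultimately show ?thesis by linarith
  qed
  have lim_t: "(\<integral>y. G y \<partial>density lborel (\<lambda>y. ennreal (n y))) - 2 * K * exp (- t) \<le> (\<integral>x. clamp1 K (\<phi> x - g x) \<partial>density lborel (\<lambda>x. ennreal (m x)))"
    if t: "0 \<le> t" for t
  proof -
    have "(\<lambda>k. (\<integral>y. h k y \<partial>N k) - e k * t - 2 * K * exp (- t)) \<longlonglongrightarrow> (\<integral>y. G y \<partial>density lborel (\<lambda>y. ennreal (n y))) - 0 * t - 2 * K * exp (- t)"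
      by (intro tendsto_intros B e)
    from LIMSEQ_le[OF this A] main[OF t] show ?thesis by auto
  qed
  have "(\<lambda>t. (\<integral>y. G y \<partial>density lborel (\<lambda>y. ennreal (n y))) - 2 * K * exp (- real t)) \<longlonglongrightarrow> (\<integral>y. G y \<partial>density lborel (\<lambda>y. ennreal (n y))) - 2 * K * 0"
    by (intro tendsto_intros filterlim_compose[OF exp_at_bot] filterlim_compose[OF filterlim_uminus_at_bot_at_top] filterlim_real_sequentially)
  then have "(\<integral>y. G y \<partial>density lborel (\<lambda>y. ennreal (n y))) - 2 * K * 0 \<le> (\<integral>x. clamp1 K (\<phi> x - g x) \<partial>density lborel (\<lambda>x. ennreal (m x)))"
    by (rule LIMSEQ_le_const2) (use lim_t in auto)
  then show ?thesis by (simp add: G_def)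
qed

lemma subsequence:
  assumes s: "strict_mono s"
  shows "entropic_limit m n \<phi> \<phi>s (\<lambda>k. mk (s k)) (\<lambda>k. nk (s k)) (\<lambda>k. f (s k)) (\<lambda>k. \<psi> (s k)) (\<lambda>k. e (s k)) C"
proof -
  have sub: "(\<lambda>k. u (s k)) \<longlonglongrightarrow> l" if "u \<longlonglongrightarrow> l" for u :: "nat \<Rightarrow> real" and l
    using LIMSEQ_subseq_LIMSEQ[OF that s] by (simp add: o_def)
  have low: "\<exists>c>0. \<forall>k x. norm x \<le> r \<longrightarrow> c \<le> mk (s k) x" for r using lower[of r] by blast
  show ?thesis
    by unfold_locales
       (use meas int nonneg dom sub[OF lim(1)] sub[OF lim(2)] prob low f e(1,2) sub[OF e(3)] DM DN \<phi>_cont young in \<open>auto\<close>)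
qed

lemma ex_limit:
  assumes D: "countable D" "\<And>X. open X \<Longrightarrow> X \<noteq> {} \<Longrightarrow> \<exists>d\<in>D. d \<in> X"
  obtains s g where "strict_mono (s :: nat \<Rightarrow> nat)" "\<And>x. (\<lambda>k. f (s k) x) \<longlonglongrightarrow> g x" "convex_on UNIV g"
    "\<And>K. 0 \<le> K \<Longrightarrow> (\<integral>y. csup D K g \<phi>s y \<partial>density lborel (\<lambda>y. ennreal (n y)))
      \<le> (\<integral>x. clamp1 K (\<phi> x - g x) \<partial>density lborel (\<lambda>x. ennreal (m x)))"
proof -
  obtain s g where s: "strict_mono (s :: nat \<Rightarrow> nat)" and g: "\<And>x. (\<lambda>k. f (s k) x) \<longlonglongrightarrow> g x"
  proof (rule pointwise_convergent_subsequence[of f])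
    show "\<exists>B. \<forall>k. \<bar>f k x\<bar> \<le> B" for x using locally_bounded[of "norm x + 1"] by (force simp: add_nonneg_pos)
    show "\<exists>d>0. \<forall>k y. dist y x < d \<longrightarrow> \<bar>f k y - f k x\<bar> < \<epsilon>" if "0 < \<epsilon>" for x \<epsilon> using equicontinuous[OF that] .
  qed blast
  interpret sub: entropic_limit m n \<phi> \<phi>s "\<lambda>k. mk (s k)" "\<lambda>k. nk (s k)" "\<lambda>k. f (s k)" "\<lambda>k. \<psi> (s k)" "\<lambda>k. e (s k)" C
    by (rule subsequence[OF s])
  have cvx: "convex_on UNIV g"
  proof (rule convex_onI)
    fix t :: real and x y assume t: "0 < t" "t < 1"
    show "g ((1 - t) *\<^sub>R x + t *\<^sub>R y) \<le> (1 - t) * g x + t * g y"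
    proof (rule LIMSEQ_le)
      show "(\<lambda>k. f (s k) ((1 - t) *\<^sub>R x + t *\<^sub>R y)) \<longlonglongrightarrow> g ((1 - t) *\<^sub>R x + t *\<^sub>R y)" by (rule g)
      show "(\<lambda>k. (1 - t) * f (s k) x + t * f (s k) y) \<longlonglongrightarrow> (1 - t) * g x + t * g y" by (intro tendsto_intros g)
      show "\<exists>N. \<forall>k\<ge>N. f (s k) ((1 - t) *\<^sub>R x + t *\<^sub>R y) \<le> (1 - t) * f (s k) x + t * f (s k) y"
        using t by (intro exI allI impI convex_onD[OF f(1)]) auto
    qed
  qed simp
  then have "continuous_on UNIV g" by (intro convex_on_continuous) auto
  then show ?thesis using that[OF s g cvx] sub.limit_clamp[OF g _ D] by blast
qed

end

section \<open>Identification of the limit\<close>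

lemma measurable_fst_snd_borel:
  shows "fst \<in> borel_measurable (borel :: ('a::euclidean_space \<times> 'a) measure)" "snd \<in> borel_measurable (borel :: ('a \<times> 'a) measure)"
proof -
  have "continuous_on UNIV (\<lambda>z :: 'a \<times> 'a. fst z)" "continuous_on UNIV (\<lambda>z :: 'a \<times> 'a. snd z)"
    by (intro continuous_intros)+
  then show "fst \<in> borel_measurable (borel :: ('a \<times> 'a) measure)" "snd \<in> borel_measurable (borel :: ('a \<times> 'a) measure)"
    by (auto intro: borel_measurable_continuous_onI)
qed

text \<open>For a nearly optimal coupling, \<theta> is nonnegative almost everywhere with small
  integral, and \<open>clamp\<close> makes the integral of \<open>G (snd z) - h (fst z)\<close>
  nonpositive; so Q, which dominates \<theta>, has small integral. Where Q is small,
  \<open>snd z\<close> is an approximate subgradient of both functions at \<open>fst z\<close>. If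
  this never happened over the ball, Q would be at least d there, contradicting the integral bound
  because every ball has positive mass.\<close>

lemma coupling_approx_common_subgradient:
  fixes \<mu> \<nu> :: "'a::euclidean_space measure" and f \<phi> \<phi>s :: "'a \<Rightarrow> real"
  assumes fin: "finite_measure \<mu>" "finite_measure \<nu>" and sets: "sets \<mu> = sets borel" "sets \<nu> = sets borel"
    and pos: "\<And>x \<rho>. 0 < \<rho> \<Longrightarrow> 0 < measure \<mu> (ball x \<rho>)"
    and cont: "continuous_on UNIV f" "continuous_on UNIV \<phi>" and meas[measurable]: "\<phi>s \<in> borel_measurable borel"
    and young: "AE y in \<nu>. \<forall>x. x \<bullet> y \<le> \<phi> x + \<phi>s y"
    and near: "\<And>\<eta>. 0 < \<eta> \<Longrightarrow> \<exists>\<pi>. coupling \<pi> \<mu> \<nu> \<and> integrable \<pi> (\<lambda>z. \<phi> (fst z) + \<phi>s (snd z) - fst z \<bullet> snd z) \<and>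
      (LINT z|\<pi>. \<phi> (fst z) + \<phi>s (snd z) - fst z \<bullet> snd z) \<le> \<eta>"
    and D: "countable D" "\<And>X. open X \<Longrightarrow> X \<noteq> {} \<Longrightarrow> \<exists>d\<in>D. d \<in> X"
    and clamp: "\<And>K. 0 \<le> K \<Longrightarrow> (LINT y|\<nu>. csup D K f \<phi>s y) \<le> (LINT x|\<mu>. clamp1 K (\<phi> x - f x))"
    and \<rho>: "0 < \<rho>" and \<delta>: "0 < \<delta>"
  shows "\<exists>x' y. dist x' x < \<rho> \<and> (\<forall>z. f x' + y \<bullet> (z - x') - \<delta> \<le> f z \<and> \<phi> x' + y \<bullet> (z - x') - \<delta> \<le> \<phi> z)"
proof (rule ccontr)
  assume neg: "\<not> ?thesis"
  have [measurable]: "f \<in> borel_measurable borel" "\<phi> \<in> borel_measurable borel"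
    using cont by (auto intro: borel_measurable_continuous_onI)
  have "bounded ((\<lambda>x. \<phi> x - f x) ` cball x \<rho>)"
    by (intro compact_imp_bounded compact_continuous_image compact_cball)
       (rule continuous_on_subset[where s = UNIV], auto intro!: continuous_intros cont)
  then obtain B where B: "\<forall>v\<in>(\<lambda>x. \<phi> x - f x) ` cball x \<rho>. norm v \<le> B" by (auto simp: bounded_iff)
  \<comment> \<open>The margin of 1 keeps the truncation at \<open>K\<close> inactive over the ball,
    with room for an additional error.\<close>
  define K where "K = \<bar>B\<bar> + 1"
  have K: "0 \<le> K" by (simp add: K_def)
  have AK: "\<bar>\<phi> z - f z\<bar> \<le> K - 1" if "dist z x < \<rho>" for z
  proof -
    have "norm (\<phi> z - f z) \<le> B" using B that by (simp add: dist_commute)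
    then show ?thesis by (simp add: K_def)
  qed
  \<comment> \<open>The inequality for f collects two errors of size d, hence the half of \<delta>;
    the bound \<open>1 / 2\<close> stays inside the margin of \<open>K\<close>.\<close>
  define d where "d = min (\<delta> / 2) (1 / 2)"
  have d: "0 < d" "d \<le> \<delta> / 2" "d \<le> 1 / 2" using \<delta> by (auto simp: d_def)
  \<comment> \<open>Small enough that the integral of Q, at most \<open>2 * \<eta>\<close>, falls
    below d times the mass of the ball.\<close>
  define \<eta> where "\<eta> = d * measure \<mu> (ball x \<rho>) / 4"
  have \<eta>: "0 < \<eta>" using d pos[OF \<rho>, of x] by (simp add: \<eta>_def)
  define \<theta> where "\<theta> z = \<phi> (fst z) + \<phi>s (snd z) - fst z \<bullet> snd z" for z
  obtain \<pi> where \<pi>: "sets \<pi> = sets borel" "distr \<pi> borel fst = \<mu>" "distr \<pi> borel snd = \<nu>"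
    and int: "integrable \<pi> \<theta>" "(LINT z|\<pi>. \<theta> z) \<le> \<eta>"
    using near[OF \<eta>] unfolding \<theta>_def[abs_def] coupling_def by auto
  note [measurable_cong] = \<pi>(1)
  have [measurable]: "fst \<in> \<pi> \<rightarrow>\<^sub>M borel" "snd \<in> \<pi> \<rightarrow>\<^sub>M borel"
    unfolding measurable_cong_sets[OF \<pi>(1) refl] by (rule measurable_fst_snd_borel)+
  have space: "space \<pi> = UNIV" using sets_eq_imp_space_eq[OF \<pi>(1)] by simp
  have "emeasure \<pi> (space \<pi>) = emeasure \<mu> UNIV"
    unfolding \<pi>(2)[symmetric] by (subst emeasure_distr) (auto simp: space)
  then interpret \<pi>: finite_measure \<pi>
    using finite_measure.emeasure_finite[OF fin(1), of UNIV] by (intro finite_measureI) simp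
  define G where "G = csup D K f \<phi>s"
  have [measurable]: "G \<in> borel_measurable borel" unfolding G_def by (rule measurable_csup[OF D K]) measurable
  have G: "\<bar>G y\<bar> \<le> K" for y unfolding G_def by (rule abs_csup[OF D K])
  have Gup: "clamp1 K (x \<bullet> y - f x - \<phi>s y) \<le> G y" for x y
    unfolding G_def by (rule csup_upper[OF D K cont(1)])
  define h where "h x = clamp1 K (\<phi> x - f x)" for x
  have [measurable]: "h \<in> borel_measurable borel" unfolding h_def by measurable
  have h: "\<bar>h x\<bar> \<le> K" for x unfolding h_def by (rule abs_clamp1[OF K])
  have iG: "integrable \<pi> (\<lambda>z. G (snd z))" and ih: "integrable \<pi> (\<lambda>z. h (fst z))"
    using G h by (auto intro!: \<pi>.integrable_const_bound[where B = K])
  have eG: "(LINT z|\<pi>. G (snd z)) = (LINT y|\<nu>. G y)" unfolding \<pi>(3)[symmetric] by (subst integral_distr) auto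
  have eh: "(LINT z|\<pi>. h (fst z)) = (LINT x|\<mu>. h x)" unfolding \<pi>(2)[symmetric] by (subst integral_distr) auto
  have "AE y in distr \<pi> borel snd. \<forall>x. x \<bullet> y \<le> \<phi> x + \<phi>s y" using young unfolding \<pi>(3) .
  then have ae: "AE z in \<pi>. \<forall>x. x \<bullet> snd z \<le> \<phi> x + \<phi>s (snd z)"
    by (rule AE_distrD[rotated]) measurable
  \<comment> \<open>One copy of \<theta> absorbs the possible negativity of
    \<open>G (snd z) - h (fst z)\<close>, which is at least \<open>- \<theta> z\<close>; the other
    remains, so a small Q forces both \<theta> and that difference to be small.\<close>
  define Q where "Q z = G (snd z) - h (fst z) + 2 * \<theta> z" for z
  have iQ: "integrable \<pi> Q" unfolding Q_def[abs_def] using iG ih int by auto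
  have "(LINT z|\<pi>. Q z) = (LINT y|\<nu>. G y) - (LINT x|\<mu>. h x) + 2 * (LINT z|\<pi>. \<theta> z)"
    unfolding Q_def using iG ih int by (simp add: eG eh)
  then have Q1: "(LINT z|\<pi>. Q z) \<le> 2 * \<eta>" using clamp[OF K] int(2) by (simp add: G_def h_def)
  have "(LINT z|\<pi>. d * indicator (ball x \<rho>) (fst z)) \<le> (LINT z|\<pi>. Q z)"
  proof (rule integral_mono_AE[OF _ iQ])
    show "integrable \<pi> (\<lambda>z. d * indicator (ball x \<rho>) (fst z))"
      by (intro \<pi>.integrable_const_bound[where B = d]) (use d in \<open>auto simp: indicator_def\<close>)
    show "AE z in \<pi>. d * indicator (ball x \<rho>) (fst z) \<le> Q z"
      using ae
    proof eventually_elim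
      fix z :: "'a \<times> 'a"
      assume y: "\<forall>x. x \<bullet> snd z \<le> \<phi> x + \<phi>s (snd z)"
      define u where "u = fst z"
      define v where "v = snd z"
      have \<theta>: "0 \<le> \<theta> z" using y by (simp add: \<theta>_def)
      have A: "u \<bullet> v - f u - \<phi>s v = \<phi> u - f u - \<theta> z" by (simp add: \<theta>_def u_def v_def)
      have "h u - \<theta> z \<le> G v"
        using clamp1_diff[OF \<theta>, of K "\<phi> u - f u"] Gup[of u v] unfolding A h_def by linarith
      then have Q: "\<theta> z \<le> Q z" by (simp add: Q_def u_def v_def)
      show "d * indicator (ball x \<rho>) (fst z) \<le> Q z"
      proof (rule ccontr)
        assume not: "\<not> ?thesis"
        then have u: "dist u x < \<rho>" and Qd: "Q z < d"
          using \<theta> Q by (cases "dist u x < \<rho>"; simp add: indicator_def u_def dist_commute)+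
        then have \<theta>d: "\<theta> z \<le> d" using Q by simp
        have hu: "h u = \<phi> u - f u" using AK[OF u] by (auto simp: h_def clamp1_def)
        have Gd: "G v < \<phi> u - f u + d" using Qd \<theta> hu by (simp add: Q_def u_def v_def)
        have "f u + v \<bullet> (w - u) - \<delta> \<le> f w \<and> \<phi> u + v \<bullet> (w - u) - \<delta> \<le> \<phi> w" for w
        proof
          have "w \<bullet> v \<le> \<phi> w + \<phi>s v" using y by (simp add: v_def)
          moreover have uv: "u \<bullet> v = \<phi> u + \<phi>s v - \<theta> z" by (simp add: \<theta>_def u_def v_def)
          ultimately show "\<phi> u + v \<bullet> (w - u) - \<delta> \<le> \<phi> w"
            using \<theta>d d by (simp add: inner_diff_right inner_commute)
          have "clamp1 K (w \<bullet> v - f w - \<phi>s v) < \<phi> u - f u + d" using Gup[of w v] Gd by linarith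
          then have "w \<bullet> v - f w - \<phi>s v \<le> \<phi> u - f u + d"
            using AK[OF u] d by (auto simp: clamp1_def max_def min_def split: if_splits)
          then show "f u + v \<bullet> (w - u) - \<delta> \<le> f w"
            using uv \<theta>d \<theta> d by (simp add: inner_diff_right inner_commute)
        qed
        then show False using neg u by blast
      qed
    qed
  qed
  moreover have "(LINT z|\<pi>. d * indicator (ball x \<rho>) (fst z)) = d * measure \<mu> (ball x \<rho>)"
  proof -
    have "(LINT z|\<pi>. indicator (ball x \<rho>) (fst z)) = (\<integral>x'. indicator (ball x \<rho>) x' \<partial>distr \<pi> borel fst :: real)"
      by (subst integral_distr) (auto intro!: borel_measurable_indicator)
    also have "\<dots> = measure \<mu> (ball x \<rho>)"
      unfolding \<pi>(2) using sets_eq_imp_space_eq[OF sets(1)] by simp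
    finally show ?thesis unfolding integral_mult_right_zero by simp
  qed
  ultimately have "d * measure \<mu> (ball x \<rho>) \<le> 2 * \<eta>" using Q1 by linarith
  then show False using \<eta> by (simp add: \<eta>_def)
qed

text \<open>The supremum over couplings supplies one whose correlation is within \<eta> of the dual
  value, and its marginals rewrite the dual value as an integral against it.\<close>

lemma kantorovich_near_optimal:
  fixes \<mu> \<nu> :: "'a::euclidean_space measure"
  assumes pot: "kantorovich_potential \<mu> \<nu> \<Phi>" and sets: "sets \<mu> = sets borel" "sets \<nu> = sets borel" and \<eta>: "0 < \<eta>"
  defines "\<phi> \<equiv> \<lambda>x. real_of_ereal (\<Phi> x)" and "\<phi>s \<equiv> \<lambda>y. real_of_ereal (fconj \<Phi> y)"
  shows "\<exists>\<pi>. coupling \<pi> \<mu> \<nu> \<and> integrable \<pi> (\<lambda>z. \<phi> (fst z) + \<phi>s (snd z) - fst z \<bullet> snd z) \<and>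
      (LINT z|\<pi>. \<phi> (fst z) + \<phi>s (snd z) - fst z \<bullet> snd z) \<le> \<eta>"
proof -
  have i: "integrable \<mu> \<phi>" "integrable \<nu> \<phi>s"
    and eq: "ereal ((LINT x|\<mu>. \<phi> x) + (LINT y|\<nu>. \<phi>s y)) = (SUP \<pi> \<in> {\<pi>. coupling \<pi> \<mu> \<nu> \<and> integrable \<pi> (\<lambda>(x, y). inner x y)}.
            ereal (LINT z|\<pi>. (case z of (x, y) \<Rightarrow> inner x y)))"
    using pot unfolding kantorovich_potential_def \<phi>_def \<phi>s_def by auto
  have [measurable]: "\<phi> \<in> borel_measurable borel" "\<phi>s \<in> borel_measurable borel"
    using borel_measurable_integrable[OF i(1)] borel_measurable_integrable[OF i(2)]
    by (simp_all add: measurable_cong_sets[OF sets(1) refl] measurable_cong_sets[OF sets(2) refl])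
  have "ereal ((LINT x|\<mu>. \<phi> x) + (LINT y|\<nu>. \<phi>s y) - \<eta>) < ereal ((LINT x|\<mu>. \<phi> x) + (LINT y|\<nu>. \<phi>s y))" using \<eta> by simp
  then obtain \<pi> where \<pi>: "coupling \<pi> \<mu> \<nu>" "integrable \<pi> (\<lambda>(x, y). inner x y)"
    and lt: "(LINT x|\<mu>. \<phi> x) + (LINT y|\<nu>. \<phi>s y) - \<eta> < (LINT z|\<pi>. (case z of (x, y) \<Rightarrow> inner x y))"
    unfolding eq less_SUP_iff by auto
  have c: "sets \<pi> = sets borel" "distr \<pi> borel fst = \<mu>" "distr \<pi> borel snd = \<nu>" using \<pi>(1) by (auto simp: coupling_def)
  note [measurable_cong] = c(1)
  have [measurable]: "fst \<in> \<pi> \<rightarrow>\<^sub>M borel" "snd \<in> \<pi> \<rightarrow>\<^sub>M borel"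
    unfolding measurable_cong_sets[OF c(1) refl] by (rule measurable_fst_snd_borel)+
  have ii: "integrable \<pi> (\<lambda>z. \<phi> (fst z))" "integrable \<pi> (\<lambda>z. \<phi>s (snd z))"
    using i unfolding c(2,3)[symmetric] by (auto simp: integrable_distr_eq)
  have ee: "(LINT z|\<pi>. \<phi> (fst z)) = (LINT x|\<mu>. \<phi> x)" "(LINT z|\<pi>. \<phi>s (snd z)) = (LINT y|\<nu>. \<phi>s y)"
    unfolding c(2,3)[symmetric] by (auto simp: integral_distr)
  have in3: "integrable \<pi> (\<lambda>z. fst z \<bullet> snd z)" using \<pi>(2) by (simp add: case_prod_beta')
  have "(LINT z|\<pi>. \<phi> (fst z) + \<phi>s (snd z) - fst z \<bullet> snd z) = (LINT x|\<mu>. \<phi> x) + (LINT y|\<nu>. \<phi>s y) - (LINT z|\<pi>. fst z \<bullet> snd z)"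
    using ii in3 by (simp add: ee)
  also have "\<dots> \<le> \<eta>" using lt by (simp add: case_prod_beta')
  finally show ?thesis using \<pi>(1) ii in3 by (intro exI[of _ \<pi>]) auto
qed

section \<open>From the hypotheses on V, W, a and b to the approximating problems\<close>

lemma strongly_convex_ereal_real:
  fixes W :: "'a::real_normed_vector \<Rightarrow> ereal"
  assumes W_not_minf: "\<And>y. W y \<noteq> -\<infinity>"
    and W_hess: "W ((1 - t) *\<^sub>R x + t *\<^sub>R y) + ereal c \<le> ereal (1 - t) * W x + ereal t * W y"
    and fin: "W x < \<infinity>" "W y < \<infinity>"
  shows "W ((1 - t) *\<^sub>R x + t *\<^sub>R y) < \<infinity>"
    and "real_of_ereal (W ((1 - t) *\<^sub>R x + t *\<^sub>R y)) + c \<le> (1 - t) * real_of_ereal (W x) + t * real_of_ereal (W y)"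
proof -
  obtain w0 where w0: "W x = ereal w0" using fin W_not_minf[of x] by (cases "W x") auto
  obtain w1 where w1: "W y = ereal w1" using fin W_not_minf[of y] by (cases "W y") auto
  show *: "W ((1 - t) *\<^sub>R x + t *\<^sub>R y) < \<infinity>"
    using W_hess by (cases "W ((1 - t) *\<^sub>R x + t *\<^sub>R y)") (auto simp: w0 w1)
  obtain w where w: "W ((1 - t) *\<^sub>R x + t *\<^sub>R y) = ereal w"
    using * W_not_minf[of "(1 - t) *\<^sub>R x + t *\<^sub>R y"] by (cases "W ((1 - t) *\<^sub>R x + t *\<^sub>R y)") auto
  show "real_of_ereal (W ((1 - t) *\<^sub>R x + t *\<^sub>R y)) + c \<le> (1 - t) * real_of_ereal (W x) + t * real_of_ereal (W y)"
    using W_hess by (simp add: w w0 w1)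
qed

lemma norm_square_convex_identity:
  fixes x y :: "'a::real_inner"
  shows "(1 - t) * (norm x)\<^sup>2 + t * (norm y)\<^sup>2 = (norm ((1 - t) *\<^sub>R x + t *\<^sub>R y))\<^sup>2 + t * (1 - t) * (norm (y - x))\<^sup>2"
proof -
  have c: "y \<bullet> x = x \<bullet> y" by (rule inner_commute)
  have *: "(1 - t) * A + t * C = (1 - t) * ((1 - t) * A + t * B) + t * ((1 - t) * B + t * C) + t * (1 - t) * (C - B - (B - A))" for A B C :: real
    by algebra
  show ?thesis
    unfolding power2_norm_eq_inner inner_add_left inner_add_right inner_diff_left inner_diff_right inner_scaleR_left inner_scaleR_right c
    by (rule *)
qed

text \<open>The end points lie at t and 1 - t times their mutual distance from the intermediate
  point and carry the weights 1 - t and t. Each contributes \<open>L * t * (1 - t)\<close> times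
  that distance, which is the origin of the terms \<open>2 * La * r\<close> and
  \<open>2 * Lb * s\<close> in the moduli.\<close>

lemma lipschitz_convex_combination:
  fixes a :: "'a::real_normed_vector \<Rightarrow> real"
  assumes a: "L-lipschitz_on UNIV a" and t: "0 < t" "t < 1"
  shows "\<bar>(1 - t) * a x0 + t * a x1 - a ((1 - t) *\<^sub>R x0 + t *\<^sub>R x1)\<bar> \<le> t * (1 - t) * (2 * L * norm (x1 - x0))"
proof -
  define xt where "xt = (1 - t) *\<^sub>R x0 + t *\<^sub>R x1"
  have "x0 - xt = (- t) *\<^sub>R (x1 - x0)" "x1 - xt = (1 - t) *\<^sub>R (x1 - x0)"
    by (simp_all add: xt_def algebra_simps)
  then have n: "norm (x0 - xt) = t * norm (x1 - x0)" "norm (x1 - xt) = (1 - t) * norm (x1 - x0)"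
    using t by simp_all
  have "\<bar>a x0 - a xt\<bar> \<le> L * (t * norm (x1 - x0))" "\<bar>a x1 - a xt\<bar> \<le> L * ((1 - t) * norm (x1 - x0))"
    using lipschitz_onD[OF a, of x0 xt] lipschitz_onD[OF a, of x1 xt] n by (auto simp: dist_real_def dist_norm)
  then have "(1 - t) * \<bar>a x0 - a xt\<bar> \<le> (1 - t) * (L * (t * norm (x1 - x0)))"
    "t * \<bar>a x1 - a xt\<bar> \<le> t * (L * ((1 - t) * norm (x1 - x0)))"
    using t by (auto intro!: mult_left_mono)
  moreover have "\<bar>(1 - t) * (a x0 - a xt) + t * (a x1 - a xt)\<bar> \<le> (1 - t) * \<bar>a x0 - a xt\<bar> + t * \<bar>a x1 - a xt\<bar>"
    using t abs_triangle_ineq[of "(1 - t) * (a x0 - a xt)" "t * (a x1 - a xt)"] by (simp add: abs_mult)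
  moreover have "(1 - t) * (a x0 - a xt) + t * (a x1 - a xt) = (1 - t) * a x0 + t * a x1 - a xt" by (simp add: algebra_simps)
  moreover have "(1 - t) * (L * (t * norm (x1 - x0))) + t * (L * ((1 - t) * norm (x1 - x0))) = t * (1 - t) * (2 * L * norm (x1 - x0))"
    by (simp add: algebra_simps)
  ultimately show ?thesis unfolding xt_def[symmetric] by linarith
qed

definition entropic_approximation ::
  "real \<Rightarrow> 'a::euclidean_space measure \<Rightarrow> 'a measure \<Rightarrow> real \<Rightarrow> (real \<Rightarrow> real) \<Rightarrow> ('a \<Rightarrow> real) \<Rightarrow> ('a \<Rightarrow> real) \<Rightarrow> bool" where
  "entropic_approximation e M N r \<sigma> f \<psi> \<longleftrightarrow>
    convex_on UNIV f \<and> f 0 = 0 \<and> \<psi> \<in> borel_measurable borel \<and>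
    (\<forall>t x0 x1. 0 < t \<longrightarrow> t < 1 \<longrightarrow> r \<le> norm (x1 - x0) \<longrightarrow>
      (1 - t) * f x0 + t * f x1 \<le> f ((1 - t) *\<^sub>R x0 + t *\<^sub>R x1) + t * (1 - t) * \<sigma> (norm (x1 - x0))) \<and>
    (\<forall>y. (\<integral>\<^sup>+x. ennreal (gibbs e f \<psi> x y) \<partial>M) = 1) \<and>
    (\<forall>x. (\<integral>\<^sup>+y. ennreal (gibbs e f \<psi> x y) \<partial>N) = 1)"

text \<open>One parameter k drives all relaxations: e = 1 / k, a Gaussian of variance k and a ball
  of radius k. The Gaussian adds \<open>(norm x)\<^sup>2 / (2 * k)\<close> to the potential of the
  first measure, so \<open>\<alpha>\<close> becomes \<open>\<alpha> + 1 / k\<close>.\<close>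

lemma ex_entropic_approximation:
  fixes V a b :: "'a::euclidean_space \<Rightarrow> real" and W :: "'a \<Rightarrow> ereal" and p s :: "'a \<Rightarrow> real"
  assumes V_meas[measurable]: "V \<in> borel_measurable borel" and W_meas[measurable]: "W \<in> borel_measurable borel"
    and W_not_minf: "\<And>y. W y \<noteq> -\<infinity>" and \<alpha>: "0 < \<alpha>" and \<beta>: "0 < \<beta>"
    and V_hess: "convex_on UNIV (\<lambda>x. \<alpha> / 2 * (norm x)\<^sup>2 - V x)"
    and W_hess: "\<And>t x y. 0 \<le> t \<Longrightarrow> t \<le> 1 \<Longrightarrow>
        W ((1 - t) *\<^sub>R x + t *\<^sub>R y) + ereal (\<beta> / 2 * t * (1 - t) * (norm (x - y))\<^sup>2)
          \<le> ereal (1 - t) * W x + ereal t * W y"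
    and a_lip: "La-lipschitz_on UNIV a" and b_lip: "Lb-lipschitz_on UNIV b"
    and a_norm: "integrable lborel (\<lambda>x. exp (- (a x + V x)))"
    and b_norm: "integrable lborel (\<lambda>y. exp (- b y) * expm_ereal (W y))"
    and k: "0 < k"
    and P: "P = (LINT x|lborel. exp (- (a x + V x)) * exp (- (norm x)\<^sup>2 / (2 * k)))" "0 < P"
    and Q: "Q = (LINT y|lborel. indicator (cball 0 k) y * (exp (- b y) * expm_ereal (W y)))" "0 < Q"
  shows "\<exists>f \<psi>. entropic_approximation (1 / k)
    (density lborel (\<lambda>x. ennreal (exp (- (a x + V x)) * exp (- (norm x)\<^sup>2 / (2 * k)) / P)))
    (density lborel (\<lambda>y. ennreal (indicator (cball 0 k) y * (exp (- b y) * expm_ereal (W y)) / Q)))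
    (2 * (1 / k) * Lb) (sigma_ab La Lb (\<alpha> + 1 / k) \<beta>) f \<psi>"
proof -
  have L: "0 \<le> La" "0 \<le> Lb" using a_lip b_lip by (auto intro: lipschitz_on_nonneg)
  have [measurable]: "a \<in> borel_measurable borel" "b \<in> borel_measurable borel"
    using a_lip b_lip by (auto intro!: borel_measurable_continuous_onI lipschitz_on_continuous_on)
  \<comment> \<open>\<open>ln P\<close> and \<open>ln Q\<close> build the normalisation into the
    potentials; additive constants do not affect the moduli.\<close>
  define U where "U x = a x + V x + (norm x)\<^sup>2 / (2 * k) + ln P" for x
  define q where "q y = b y + real_of_ereal (W y) + ln Q" for y
  \<comment> \<open>\<open>real_of_ereal\<close> sends an infinite value of W to 0, so such points
    are removed through \<open>S\<close>, which is convex because W is.\<close>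
  define S where "S = {y. W y < \<infinity>} \<inter> cball 0 k"
  have [measurable]: "U \<in> borel_measurable borel" "q \<in> borel_measurable borel" unfolding U_def q_def by measurable
  have [measurable]: "S \<in> sets borel" unfolding S_def by measurable
  have eU: "exp (- U x) = exp (- (a x + V x)) * exp (- (norm x)\<^sup>2 / (2 * k)) / P" for x
  proof -
    have "exp (- U x) = exp (- (a x + V x)) * exp (- (norm x)\<^sup>2 / (2 * k)) * exp (- ln P)"
      unfolding U_def exp_add[symmetric] by (simp add: algebra_simps)
    moreover have "exp (- ln P) = 1 / P" using P(2) by (simp add: exp_minus inverse_eq_divide)
    ultimately show ?thesis by simp
  qed
  have eq: "indicator S y * exp (- q y) = indicator (cball 0 k) y * (exp (- b y) * expm_ereal (W y)) / Q" for y
  proof -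
    have "exp (- q y) = exp (- b y) * exp (- real_of_ereal (W y)) / Q"
    proof -
      have "exp (- q y) = exp (- b y) * exp (- real_of_ereal (W y)) * exp (- ln Q)"
        unfolding q_def exp_add[symmetric] by (simp add: algebra_simps)
      moreover have "exp (- ln Q) = 1 / Q" using Q(2) by (simp add: exp_minus inverse_eq_divide)
      ultimately show ?thesis by simp
    qed
    then show ?thesis by (auto simp: S_def expm_ereal_def indicator_def)
  qed
  have intq: "integrable lborel (\<lambda>y. indicator (cball 0 k) y * (exp (- b y) * expm_ereal (W y)))"
    using integrable_mult_indicator[of "cball 0 k" lborel, OF _ b_norm] by simp
  interpret entropic_transport U q S "1 / k" k "\<lambda>r. (\<alpha> + 1 / k) / 2 * r\<^sup>2 + 2 * La * r" "\<lambda>s. \<beta> / 2 * s\<^sup>2 - 2 * Lb * s"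
    "sigma_ab La Lb (\<alpha> + 1 / k) \<beta>" "{r. 2 * (1 / k) * Lb \<le> r}"
  proof
    show "0 < 1 / k" "0 \<le> k" using k by auto
    show "integrable lborel (\<lambda>x. exp (c * norm x - U x))" for c
    proof (rule Bochner_Integration.integrable_bound)
      show "integrable lborel (\<lambda>x. exp (c\<^sup>2 * k / 2) / P * exp (- (a x + V x)))" using a_norm by simp
      have "exp (c * norm x - U x) \<le> exp (c\<^sup>2 * k / 2) / P * exp (- (a x + V x))" for x
      proof -
        \<comment> \<open>Completing the square: the Gaussian factor beats
          \<open>exp (c * norm x)\<close> for every c, which is the purpose of the damping.\<close>
        have "0 \<le> (norm x - c * k)\<^sup>2 / (2 * k)" using k by simp
        also have "(norm x - c * k)\<^sup>2 / (2 * k) = (norm x)\<^sup>2 / (2 * k) - c * norm x + c\<^sup>2 * k / 2"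
          using k by (simp add: power2_eq_square field_simps)
        finally have "exp (c * norm x + - (norm x)\<^sup>2 / (2 * k)) \<le> exp (c\<^sup>2 * k / 2)" by simp
        then have "exp (c * norm x + - (norm x)\<^sup>2 / (2 * k)) * (exp (- (a x + V x)) / P) \<le> exp (c\<^sup>2 * k / 2) * (exp (- (a x + V x)) / P)"
          using P(2) by (intro mult_right_mono) auto
        moreover have "exp (c * norm x - U x) = exp (c * norm x + - (norm x)\<^sup>2 / (2 * k)) * (exp (- (a x + V x)) / P)"
          unfolding diff_conv_add_uminus exp_add[of "c * norm x"] eU by simp
        ultimately show ?thesis by simp
      qed
      then show "AE x in lborel. norm (exp (c * norm x - U x)) \<le> norm (exp (c\<^sup>2 * k / 2) / P * exp (- (a x + V x)))"
        using P(2) by (intro AE_I2) simp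
    qed measurable
    show "(LINT x|lborel. exp (- U x)) = 1" using P by (simp add: eU)
    show "convex S"
      unfolding convex_alt S_def
    proof (intro ballI allI impI IntI CollectI)
      fix x y t assume x: "x \<in> {y. W y < \<infinity>} \<inter> cball 0 k" and y: "y \<in> {y. W y < \<infinity>} \<inter> cball 0 k" and t: "0 \<le> t \<and> t \<le> (1::real)"
      show "W ((1 - t) *\<^sub>R x + t *\<^sub>R y) < \<infinity>"
        by (rule strongly_convex_ereal_real(1)[where W = W, OF W_not_minf W_hess]) (use x y t in auto)
      show "(1 - t) *\<^sub>R x + t *\<^sub>R y \<in> cball 0 k"
        using convexD_alt[OF convex_cball, of x 0 k y t] x y t by auto
    qed
    show "S \<subseteq> cball 0 k" by (auto simp: S_def)
    show "integrable lborel (\<lambda>y. indicator S y * exp (- q y))" unfolding eq using intq by simp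
    show "(LINT y|lborel. indicator S y * exp (- q y)) = 1" unfolding eq using Q by simp
    show "sigma_ab La Lb (\<alpha> + 1 / k) \<beta> 0 = 0" "(\<alpha> + 1 / k) / 2 * 0\<^sup>2 + 2 * La * 0 = 0" "\<beta> / 2 * 0\<^sup>2 - 2 * Lb * 0 = 0" by auto
    have A: "0 \<le> r" if "r \<in> {r. 2 * (1 / k) * Lb \<le> r}" for r
    proof -
      have "0 \<le> 2 * (1 / k) * Lb" using L k by simp
      then show ?thesis using that by simp
    qed
    show "0 \<le> r" if "r \<in> {r. 2 * (1 / k) * Lb \<le> r}" for r by (rule A[OF that])
    have ak: "0 < \<alpha> + 1 / k" using \<alpha> k by (simp add: add_pos_pos)
    show "0 \<le> sigma_ab La Lb (\<alpha> + 1 / k) \<beta> r" if "r \<in> {r. 2 * (1 / k) * Lb \<le> r}" for r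
      using sigma_ab_nonneg[OF L _ \<beta> A[OF that]] ak by simp
    show "\<exists>r'\<in>insert 0 {r. 2 * (1 / k) * Lb \<le> r}. r * s - sigma_ab La Lb (\<alpha> + 1 / k) \<beta> r
        \<le> r' * s - sigma_ab La Lb (\<alpha> + 1 / k) \<beta> r' - 1 / k * ((\<alpha> + 1 / k) / 2 * r'\<^sup>2 + 2 * La * r') + 1 / k * (\<beta> / 2 * s\<^sup>2 - 2 * Lb * s)"
      if "r \<in> {r. 2 * (1 / k) * Lb \<le> r}" "0 \<le> s" for r s
      using sigma_ab_modulus[OF L _ \<beta> _ ak _ that(2), of "1 / k" r] that(1) ak k by simp
    fix t :: real assume t: "0 < t" "t < 1"
    show "(1 - t) * U x0 + t * U x1 \<le> U ((1 - t) *\<^sub>R x0 + t *\<^sub>R x1) +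
        t * (1 - t) * ((\<alpha> + 1 / k) / 2 * (norm (x1 - x0))\<^sup>2 + 2 * La * norm (x1 - x0))" for x0 x1
    proof -
      define xt where "xt = (1 - t) *\<^sub>R x0 + t *\<^sub>R x1"
      define d where "d = norm (x1 - x0)"
      have n: "(1 - t) * (norm x0)\<^sup>2 + t * (norm x1)\<^sup>2 = (norm xt)\<^sup>2 + t * (1 - t) * d\<^sup>2"
        unfolding xt_def d_def by (rule norm_square_convex_identity)
      define c where "c = \<alpha> / 2"
      define c' where "c' = 1 / (2 * k)"
      have "c * (norm xt)\<^sup>2 - V xt \<le> (1 - t) * (c * (norm x0)\<^sup>2 - V x0) + t * (c * (norm x1)\<^sup>2 - V x1)"
        unfolding xt_def c_def using t by (intro convex_onD[OF V_hess]) auto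
      also have "\<dots> = c * ((1 - t) * (norm x0)\<^sup>2 + t * (norm x1)\<^sup>2) - ((1 - t) * V x0 + t * V x1)" by (simp add: algebra_simps)
      also have "\<dots> = c * (norm xt)\<^sup>2 + c * (t * (1 - t) * d\<^sup>2) - ((1 - t) * V x0 + t * V x1)"
        unfolding n by (simp only: distrib_left)
      finally have V: "(1 - t) * V x0 + t * V x1 \<le> V xt + c * (t * (1 - t) * d\<^sup>2)" by simp
      have a: "(1 - t) * a x0 + t * a x1 \<le> a xt + t * (1 - t) * (2 * La * d)"
        using lipschitz_convex_combination[OF a_lip t, of x0 x1] unfolding xt_def d_def by linarith
      have U: "U x = a x + V x + c' * (norm x)\<^sup>2 + ln P" for x by (simp add: U_def c'_def)
      have c: "(\<alpha> + 1 / k) / 2 = c + c'" by (simp add: c_def c'_def add_divide_distrib)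
      have "(1 - t) * U x0 + t * U x1 = ((1 - t) * a x0 + t * a x1) + ((1 - t) * V x0 + t * V x1) + c' * ((1 - t) * (norm x0)\<^sup>2 + t * (norm x1)\<^sup>2) + ln P"
        unfolding U by (simp add: algebra_simps)
      also have "\<dots> \<le> (a xt + t * (1 - t) * (2 * La * d)) + (V xt + c * (t * (1 - t) * d\<^sup>2)) + c' * ((norm xt)\<^sup>2 + t * (1 - t) * d\<^sup>2) + ln P"
        unfolding n by (intro add_mono a V order_refl)
      also have "\<dots> = U xt + t * (1 - t) * ((\<alpha> + 1 / k) / 2 * d\<^sup>2 + 2 * La * d)"
        unfolding U c by (simp add: algebra_simps)
      finally show ?thesis unfolding xt_def d_def .
    qed
    show "q ((1 - t) *\<^sub>R y0 + t *\<^sub>R y1) + t * (1 - t) * (\<beta> / 2 * (norm (y1 - y0))\<^sup>2 - 2 * Lb * norm (y1 - y0)) \<le> (1 - t) * q y0 + t * q y1"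
      if "y0 \<in> S" "y1 \<in> S" for y0 y1
    proof -
      define d where "d = norm (y1 - y0)"
      define yt where "yt = (1 - t) *\<^sub>R y0 + t *\<^sub>R y1"
      have W: "real_of_ereal (W yt) + \<beta> / 2 * t * (1 - t) * d\<^sup>2 \<le> (1 - t) * real_of_ereal (W y0) + t * real_of_ereal (W y1)"
        unfolding yt_def d_def norm_minus_commute[of y1]
        by (rule strongly_convex_ereal_real(2)[where W = W, OF W_not_minf W_hess]) (use that t in \<open>auto simp: S_def\<close>)
      have b: "b yt - t * (1 - t) * (2 * Lb * d) \<le> (1 - t) * b y0 + t * b y1"
        using lipschitz_convex_combination[OF b_lip t, of y0 y1] unfolding yt_def d_def by linarith
      have "q yt + t * (1 - t) * (\<beta> / 2 * d\<^sup>2 - 2 * Lb * d) = (b yt - t * (1 - t) * (2 * Lb * d)) + (real_of_ereal (W yt) + \<beta> / 2 * t * (1 - t) * d\<^sup>2) + ln Q"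
        by (simp add: q_def algebra_simps)
      also have "\<dots> \<le> ((1 - t) * b y0 + t * b y1) + ((1 - t) * real_of_ereal (W y0) + t * real_of_ereal (W y1)) + ln Q"
        using W b by linarith
      also have "\<dots> = (1 - t) * q y0 + t * q y1" by (simp add: q_def algebra_simps)
      finally show ?thesis unfolding yt_def d_def .
    qed
  qed measurable
  obtain f \<psi> where f: "convex_on UNIV f" "f 0 = 0" "smooth f" "\<psi> \<in> borel_measurable borel"
    and M: "\<And>y. (\<integral>\<^sup>+x. ennreal (gibbs (1 / k) f \<psi> x y) \<partial>M) = 1"
    and N: "\<And>x. (\<integral>\<^sup>+y. ennreal (gibbs (1 / k) f \<psi> x y) \<partial>N) = 1"
    by (rule ex_entropic_potential) blast
  have Meq: "M = density lborel (\<lambda>x. ennreal (exp (- (a x + V x)) * exp (- (norm x)\<^sup>2 / (2 * k)) / P))"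
    unfolding M_def eU by simp
  have Neq: "N = density lborel (\<lambda>y. ennreal (indicator (cball 0 k) y * (exp (- b y) * expm_ereal (W y)) / Q))"
    unfolding N_def eq by simp
  have sm: "(1 - t) * f x0 + t * f x1 \<le> f ((1 - t) *\<^sub>R x0 + t *\<^sub>R x1) + t * (1 - t) * sigma_ab La Lb (\<alpha> + 1 / k) \<beta> (norm (x1 - x0))"
    if "0 < t" "t < 1" "2 * (1 / k) * Lb \<le> norm (x1 - x0)" for t x0 x1
    using f(3) that unfolding smooth_def by simp
  show ?thesis
    unfolding entropic_approximation_def
    by (intro exI[of _ f] exI[of _ \<psi>] conjI allI impI f(1,2,4) sm M[unfolded Meq] N[unfolded Neq])
qed

section \<open>Finiteness of the potential, and the theorem\<close>

lemma AE_lborel_imp_AE_reflect: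
  fixes c :: "'a::euclidean_space"
  assumes "AE z in lborel. Pr z"
  shows "AE z in lborel. Pr (c - z)"
proof -
  have "(lborel :: 'a measure) = density (distr lborel borel (\<lambda>x. c + (- 1) *\<^sub>R x)) (\<lambda>_. ennreal (\<bar>- 1\<bar> ^ DIM('a)))"
    by (rule lborel_affine) simp
  also have "(\<lambda>_. ennreal (\<bar>- 1\<bar> ^ DIM('a))) = (\<lambda>_. 1)" by simp
  finally have "distr lborel borel (\<lambda>x. c + (- 1) *\<^sub>R x) = (lborel :: 'a measure)" by (simp only: density_1)
  with assms have "AE z in distr lborel borel (\<lambda>x. c + (- 1) *\<^sub>R x). Pr z" by (simp only:)
  then have "AE z in lborel. Pr (c + (- 1) *\<^sub>R z)" by (rule AE_distrD[rotated]) measurable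
  then show ?thesis by simp
qed

text \<open>The set where \<Phi> is finite has full measure, and so has its reflection in x; a point
  of both makes x the midpoint of two points with finite values.\<close>

lemma ereal_convex_finite_everywhere:
  fixes \<Phi> :: "'a::euclidean_space \<Rightarrow> ereal"
  assumes cvx: "ereal_convex \<Phi>" and nm: "\<And>x. \<Phi> x \<noteq> -\<infinity>" and ae: "AE x in lborel. \<Phi> x \<noteq> \<infinity>"
  shows "\<bar>\<Phi> x\<bar> \<noteq> \<infinity>"
proof -
  have 1: "AE z in lborel. \<Phi> z \<noteq> \<infinity> \<and> \<Phi> (2 *\<^sub>R x - z) \<noteq> \<infinity>"
    using ae AE_lborel_imp_AE_reflect[OF ae, of "2 *\<^sub>R x"] by eventually_elim auto
  have 2: "\<not> (AE z in (lborel :: 'a measure). False)" by (simp add: AE_iff_null null_sets_def)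
  have "\<exists>z. \<Phi> z \<noteq> \<infinity> \<and> \<Phi> (2 *\<^sub>R x - z) \<noteq> \<infinity>"
  proof (rule ccontr)
    assume neg: "\<not> ?thesis"
    have "AE z in (lborel :: 'a measure). False" by (rule eventually_mono[OF 1]) (use neg in blast)
    with 2 show False by (rule notE)
  qed
  then obtain z where z: "\<Phi> z \<noteq> \<infinity>" "\<Phi> (2 *\<^sub>R x - z) \<noteq> \<infinity>" by blast
  obtain u where u: "\<Phi> z = ereal u" using z nm[of z] by (cases "\<Phi> z") auto
  obtain v where v: "\<Phi> (2 *\<^sub>R x - z) = ereal v" using z nm[of "2 *\<^sub>R x - z"] by (cases "\<Phi> (2 *\<^sub>R x - z)") auto
  have "\<Phi> ((1 - 1/2) *\<^sub>R z + (1/2) *\<^sub>R (2 *\<^sub>R x - z)) \<le> ereal (1 - 1/2) * \<Phi> z + ereal (1/2) * \<Phi> (2 *\<^sub>R x - z)"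
    using cvx[unfolded ereal_convex_def, rule_format, of "1/2" z "2 *\<^sub>R x - z"] by simp
  moreover have "(1 - 1/2) *\<^sub>R z + (1/2) *\<^sub>R (2 *\<^sub>R x - z) = x" by (simp add: algebra_simps)
  ultimately have "\<Phi> x \<le> ereal ((1 - 1/2) * u + 1/2 * v)" by (simp add: u v)
  then show ?thesis using nm[of x] by (cases "\<Phi> x") auto
qed

text \<open>The Hessian bounds are stated as convexity inequalities along segments, which make sense
  for nonsmooth V and for W with infinite values. The Brenier map appears through p and q, the
  gradients of \<phi> at points where it is differentiable.\<close>

theorem theorem5p16:
  fixes V :: "'a::euclidean_space \<Rightarrow> real" and W :: "'a \<Rightarrow> ereal"
    and a b :: "'a \<Rightarrow> real" and \<alpha>V \<beta>W La Lb :: real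
    and \<phi> :: "'a \<Rightarrow> ereal"
  assumes V_meas: "V \<in> borel_measurable borel"
    and V_prob: "(\<integral>\<^sup>+ x. ennreal (exp (- V x)) \<partial>lborel) = 1"
    and W_meas: "W \<in> borel_measurable borel"
    and W_not_minf: "\<And>y. W y \<noteq> -\<infinity>"
    and W_prob: "(\<integral>\<^sup>+ y. ennreal (expm_ereal (W y)) \<partial>lborel) = 1"
    and \<alpha>V_pos: "\<alpha>V > 0" and \<beta>W_pos: "\<beta>W > 0"
    and V_hess: "convex_on UNIV (\<lambda>x. \<alpha>V / 2 * (norm x)\<^sup>2 - V x)"
    and W_hess: "\<And>t x y. 0 \<le> t \<Longrightarrow> t \<le> 1 \<Longrightarrow>
        W ((1 - t) *\<^sub>R x + t *\<^sub>R y) + ereal (\<beta>W / 2 * t * (1 - t) * (norm (x - y))\<^sup>2)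
          \<le> ereal (1 - t) * W x + ereal t * W y"
    and a_lip: "La-lipschitz_on UNIV a" and b_lip: "Lb-lipschitz_on UNIV b"
    and a_norm: "integrable lborel (\<lambda>x. exp (- (a x + V x)))"
    and b_norm: "integrable lborel (\<lambda>y. exp (- b y) * expm_ereal (W y))"
    and pot: "kantorovich_potential
                (normalized_density (\<lambda>x. exp (- (a x + V x))))
                (normalized_density (\<lambda>y. exp (- b y) * expm_ereal (W y))) \<phi>"
  shows "sigma_smooth (sigma_ab La Lb \<alpha>V \<beta>W) \<phi> \<and>
    (\<forall>x y p q.
       x \<in> interior (edom \<phi>) \<and> y \<in> interior (edom \<phi>) \<and>
       ((\<lambda>z. real_of_ereal (\<phi> z)) has_derivative (\<lambda>h. inner p h)) (at x) \<and>
       ((\<lambda>z. real_of_ereal (\<phi> z)) has_derivative (\<lambda>h. inner q h)) (at y) \<longrightarrow>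
       norm (p - q) \<le> 4 * Lb / \<beta>W + 4 * sqrt (Lb\<^sup>2 / \<beta>W\<^sup>2 + La / \<beta>W * norm (x - y))
                      + sqrt (\<alpha>V / \<beta>W) * norm (x - y))"
proof -
  note [measurable] = V_meas W_meas
  have L: "0 \<le> La" "0 \<le> Lb" using a_lip b_lip by (auto intro: lipschitz_on_nonneg)
  have conta: "continuous_on UNIV a" "continuous_on UNIV b" using a_lip b_lip by (auto intro: lipschitz_on_continuous_on)
  then have [measurable]: "a \<in> borel_measurable borel" "b \<in> borel_measurable borel"
    by (auto intro: borel_measurable_continuous_onI)
  \<comment> \<open>A finite convex function is continuous, hence so is V; the density then has a
    positive minimum on each ball.\<close>
  have c: "continuous_on UNIV (\<lambda>x. \<alpha>V / 2 * (norm x)\<^sup>2 - V x)" using V_hess by (intro convex_on_continuous) auto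
  have "continuous_on UNIV (\<lambda>x. \<alpha>V / 2 * (norm x)\<^sup>2 - (\<alpha>V / 2 * (norm x)\<^sup>2 - V x))"
    by (rule continuous_on_diff[OF _ c]) (intro continuous_intros)
  then have contV: "continuous_on UNIV V" by simp
  define m where "m x = exp (- (a x + V x))" for x
  define n where "n y = exp (- b y) * expm_ereal (W y)" for y
  have [measurable]: "expm_ereal \<in> borel_measurable borel" unfolding expm_ereal_def[abs_def] by measurable
  have m_meas[measurable]: "m \<in> borel_measurable borel" and n_meas[measurable]: "n \<in> borel_measurable borel"
    unfolding m_def[abs_def] n_def[abs_def] by measurable
  have m_pos: "0 < m x" for x by (simp add: m_def)
  have n_nonneg: "0 \<le> n y" for y by (simp add: n_def expm_ereal_def)
  have contm: "continuous_on UNIV m" unfolding m_def[abs_def] by (intro continuous_intros conta contV)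
  have im: "integrable lborel m" and iN: "integrable lborel n" using a_norm b_norm by (simp_all add: m_def[abs_def] n_def[abs_def])
  define Z where "Z = (\<integral>x. m x \<partial>lborel)"
  define Y where "Y = (\<integral>y. n y \<partial>lborel)"
  have Z: "0 < Z"
    unfolding Z_def m_def using im by (intro integral_exp_pos) (auto simp: m_def[abs_def])
  have Y: "0 < Y"
  proof (rule ccontr)
    assume "\<not> 0 < Y"
    moreover have "0 \<le> Y" unfolding Y_def using n_nonneg by (intro integral_nonneg_AE) auto
    ultimately have "(\<integral>y. n y \<partial>lborel) = 0" by (simp add: Y_def)
    then have "AE y in lborel. n y = 0" using integral_nonneg_eq_0_iff_AE[OF iN] n_nonneg by simp
    then have "AE y in lborel. ennreal (expm_ereal (W y)) = 0" by eventually_elim (simp add: n_def)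
    then have "(\<integral>\<^sup>+ y. ennreal (expm_ereal (W y)) \<partial>lborel) = (\<integral>\<^sup>+ y. 0 \<partial>(lborel :: 'a measure))"
      by (rule nn_integral_cong_AE)
    then show False using W_prob by simp
  qed
  define \<mu> where "\<mu> = density lborel (\<lambda>x. ennreal (m x / Z))"
  define \<nu> where "\<nu> = density lborel (\<lambda>y. ennreal (n y / Y))"
  have pot: "kantorovich_potential \<mu> \<nu> \<phi>"
    using pot by (simp add: \<mu>_def \<nu>_def normalized_density_def m_def n_def Z_def Y_def)
  have sets: "sets \<mu> = sets borel" "sets \<nu> = sets borel" by (simp_all add: \<mu>_def \<nu>_def)
  have "(\<integral>\<^sup>+x. ennreal (m x / Z) \<partial>lborel) = 1"
    using im m_pos Z by (subst nn_integral_eq_integral) (auto simp: Z_def less_imp_le)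
  then have fin1: "finite_measure \<mu>" by (intro finite_measureI) (simp add: \<mu>_def emeasure_density)
  have "(\<integral>\<^sup>+y. ennreal (n y / Y) \<partial>lborel) = 1"
    using iN n_nonneg Y by (subst nn_integral_eq_integral) (auto simp: Y_def)
  then have fin2: "finite_measure \<nu>" by (intro finite_measureI) (simp add: \<nu>_def emeasure_density)
  \<comment> \<open>The density of \<mu> is positive because V is finite, so \<mu> and Lebesgue
    measure have the same null sets. This makes the mass of every ball positive and, further down,
    \<phi> finite on the whole space.\<close>
  have AE_\<mu>: "(AE x in \<mu>. Pr x) \<longleftrightarrow> (AE x in lborel. Pr x)" for Pr
    unfolding \<mu>_def using m_pos Z by (subst AE_density) auto
  have pos: "0 < measure \<mu> (ball x \<rho>)" if "0 < \<rho>" for x \<rho>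
  proof (rule ccontr)
    assume "\<not> ?thesis"
    then have "measure \<mu> (ball x \<rho>) = 0" using measure_nonneg[of \<mu> "ball x \<rho>"] by linarith
    then have "emeasure \<mu> (ball x \<rho>) = 0" using fin1 by (simp add: finite_measure.emeasure_eq_measure)
    then have "ball x \<rho> \<in> null_sets \<mu>" by (auto simp: sets)
    then have "AE z in lborel. z \<notin> ball x \<rho>" unfolding AE_\<mu>[symmetric] by (rule AE_not_in)
    then have "emeasure lborel (ball x \<rho>) = 0" by (subst (asm) AE_iff_null_sets[symmetric]) auto
    then show False using that unit_ball_vol_pos[of "real DIM('a)"] by (simp add: emeasure_ball)
  qed

  have cvx\<phi>: "ereal_convex \<phi>" and nm: "\<And>x. \<phi> x \<noteq> -\<infinity>" and ae\<phi>: "AE x in \<mu>. \<phi> x \<noteq> \<infinity>"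
    and ae\<phi>s: "AE y in \<nu>. \<bar>fconj \<phi> y\<bar> \<noteq> \<infinity>" and i\<phi>s: "integrable \<nu> (\<lambda>y. real_of_ereal (fconj \<phi> y))"
    using pot by (auto simp: kantorovich_potential_def ereal_proper_def)
  have fin: "\<bar>\<phi> x\<bar> \<noteq> \<infinity>" for x
    by (rule ereal_convex_finite_everywhere[OF cvx\<phi> nm]) (use ae\<phi> AE_\<mu> in auto)
  define F where "F x = real_of_ereal (\<phi> x)" for x
  define Fs where "Fs y = real_of_ereal (fconj \<phi> y)" for y
  have F: "\<phi> x = ereal (F x)" for x using fin[of x] by (simp add: F_def ereal_real)
  have [measurable]: "Fs \<in> borel_measurable borel"
    using borel_measurable_integrable[OF i\<phi>s] by (simp add: Fs_def[abs_def] measurable_cong_sets[OF sets(2) refl])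
  have cvxF: "convex_on UNIV F"
  proof (rule convex_onI)
    fix t :: real and x y assume "0 < t" "t < 1"
    then show "F ((1 - t) *\<^sub>R x + t *\<^sub>R y) \<le> (1 - t) * F x + t * F y"
      using cvx\<phi>[unfolded ereal_convex_def, rule_format, of t x y] by (simp add: F)
  qed simp
  have contF: "continuous_on UNIV F" using cvxF by (intro convex_on_continuous) auto
  have young_\<nu>: "AE y in \<nu>. \<forall>x. x \<bullet> y \<le> F x + Fs y"
    using ae\<phi>s
  proof eventually_elim
    fix y assume y: "\<bar>fconj \<phi> y\<bar> \<noteq> \<infinity>"
    show "\<forall>x. x \<bullet> y \<le> F x + Fs y"
    proof
      fix x
      have "ereal (x \<bullet> y) - \<phi> x \<le> fconj \<phi> y" unfolding fconj_def by (rule SUP_upper) simp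
      also have "\<dots> = ereal (Fs y)" using y by (simp add: Fs_def ereal_real)
      finally show "x \<bullet> y \<le> F x + Fs y" by (simp add: F)
    qed
  qed

  define p where "p k x = m x * exp (- (norm x)\<^sup>2 / (2 * real k))" for k x
  define s where "s k y = indicator (cball 0 (real k)) y * n y" for k y
  define P where "P k = (\<integral>x. p k x \<partial>lborel)" for k
  define Q where "Q k = (\<integral>y. s k y \<partial>lborel)" for k
  have [measurable]: "p k \<in> borel_measurable borel" for k unfolding p_def[abs_def] by measurable
  have [measurable]: "s k \<in> borel_measurable borel" for k
    unfolding s_def[abs_def] by (intro borel_measurable_times borel_measurable_indicator borel_closed closed_cball n_meas)
  have p_le: "p k x \<le> m x" "0 < p k x" for k x using m_pos[of x] by (simp_all add: p_def mult_le_cancel_left1)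
  have s_le: "s k y \<le> n y" "0 \<le> s k y" for k y using n_nonneg[of y] by (auto simp: s_def indicator_def)
  have ip: "integrable lborel (p k)" for k
    by (rule Bochner_Integration.integrable_bound[OF im])
       (use p_le m_pos in \<open>auto intro!: AE_I2 simp: less_imp_le abs_of_pos\<close>)
  have int_s: "integrable lborel (s k)" for k
    by (rule Bochner_Integration.integrable_bound[OF iN])
       (use s_le n_nonneg in \<open>auto intro!: AE_I2\<close>)
  have plim: "(\<lambda>k. p k x) \<longlonglongrightarrow> m x" for x
  proof -
    have "(\<lambda>k. (- (norm x)\<^sup>2 / 2) / real k) \<longlonglongrightarrow> 0" by (rule lim_const_over_n)
    then have "(\<lambda>k. m x * exp ((- (norm x)\<^sup>2 / 2) / real k)) \<longlonglongrightarrow> m x * exp 0" by (intro tendsto_intros)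
    then show ?thesis by (simp add: p_def)
  qed
  have slim: "(\<lambda>k. s k y) \<longlonglongrightarrow> n y" for y
  proof (rule tendsto_eventually)
    show "\<forall>\<^sub>F k in sequentially. s k y = n y"
      by (rule eventually_ge_at_top[of "nat \<lceil>norm y\<rceil>", THEN eventually_mono]) (auto simp: s_def indicator_def)
  qed
  have Plim: "P \<longlonglongrightarrow> Z" unfolding P_def[abs_def] Z_def
    by (rule integral_dominated_convergence[where w = m]) (use im p_le plim in \<open>auto simp: less_imp_le abs_of_pos intro!: AE_I2\<close>)
  have Qlim: "Q \<longlonglongrightarrow> Y" unfolding Q_def[abs_def] Y_def
    by (rule integral_dominated_convergence[where w = n]) (use iN s_le slim in \<open>auto intro!: AE_I2\<close>)
  \<comment> \<open>From some index on the normalising constants exceed half their limits, which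
    yields the domination constant 2 below; \<open>1 \<le> k\<close> keeps the entropic parameter at
    most 1.\<close>
  have "\<forall>\<^sub>F k in sequentially. Z / 2 < P k \<and> Y / 2 < Q k \<and> 1 \<le> k"
    using order_tendstoD(1)[OF Plim, of "Z / 2"] order_tendstoD(1)[OF Qlim, of "Y / 2"] Z Y eventually_ge_at_top[of "1::nat"]
    by (auto elim: eventually_elim2 simp: eventually_conj_iff)
  then obtain k0 where k0: "\<And>k. k0 \<le> k \<Longrightarrow> Z / 2 < P k \<and> Y / 2 < Q k \<and> 1 \<le> k" by (auto simp: eventually_sequentially)
  define K where "K j = j + k0" for j
  have K: "Z / 2 < P (K j)" "Y / 2 < Q (K j)" "1 \<le> K j" for j using k0[of "K j"] by (auto simp: K_def)
  have P0: "0 < P (K j)" "0 < Q (K j)" for j using K[of j] Z Y by auto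
  have P_le: "P k \<le> Z" for k unfolding P_def Z_def using p_le ip im by (intro integral_mono) auto
  have Kinf: "(\<lambda>j. u (K j)) \<longlonglongrightarrow> l" if "u \<longlonglongrightarrow> l" for u :: "nat \<Rightarrow> real" and l
    unfolding K_def using that by (rule LIMSEQ_ignore_initial_segment)

  define Appr where "Appr j = entropic_approximation (1 / real (K j))
    (density lborel (\<lambda>x. ennreal (p (K j) x / P (K j)))) (density lborel (\<lambda>y. ennreal (s (K j) y / Q (K j))))
    (2 * (1 / real (K j)) * Lb) (sigma_ab La Lb (\<alpha>V + 1 / real (K j)) \<beta>W)" for j
  have "\<exists>f \<psi>. Appr j f \<psi>" for j
    unfolding Appr_def p_def s_def m_def n_def
    by (rule ex_entropic_approximation[OF V_meas W_meas W_not_minf \<alpha>V_pos \<beta>W_pos V_hess W_hess a_lip b_lip a_norm b_norm])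
       (use K[of j] P0[of j] in \<open>auto simp: P_def Q_def p_def s_def m_def n_def\<close>)
  then obtain f \<psi> where A: "\<And>j. Appr j (f j) (\<psi> j)" by metis
  have f: "\<And>j. convex_on UNIV (f j)" "\<And>j. f j 0 = 0" "\<And>j. \<psi> j \<in> borel_measurable borel"
    using A unfolding Appr_def entropic_approximation_def by blast+
  have smooth: "\<And>j t x0 x1. 0 < t \<Longrightarrow> t < 1 \<Longrightarrow> 2 * (1 / real (K j)) * Lb \<le> norm (x1 - x0) \<Longrightarrow>
      (1 - t) * f j x0 + t * f j x1 \<le> f j ((1 - t) *\<^sub>R x0 + t *\<^sub>R x1) + t * (1 - t) * sigma_ab La Lb (\<alpha>V + 1 / real (K j)) \<beta>W (norm (x1 - x0))"
    using A unfolding Appr_def entropic_approximation_def by blast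
  have DM: "\<And>j y. (\<integral>\<^sup>+x. ennreal (gibbs (1 / real (K j)) (f j) (\<psi> j) x y) \<partial>density lborel (\<lambda>x. ennreal (p (K j) x / P (K j)))) = 1"
    using A unfolding Appr_def entropic_approximation_def by blast
  have DN: "\<And>j x. (\<integral>\<^sup>+y. ennreal (gibbs (1 / real (K j)) (f j) (\<psi> j) x y) \<partial>density lborel (\<lambda>y. ennreal (s (K j) y / Q (K j)))) = 1"
    using A unfolding Appr_def entropic_approximation_def by blast
  have elim: "(\<lambda>j. 1 / real (K j)) \<longlonglongrightarrow> 0" by (rule Kinf) (rule lim_const_over_n)
  interpret entropic_limit "\<lambda>x. m x / Z" "\<lambda>y. n y / Y" F Fs "\<lambda>j x. p (K j) x / P (K j)" "\<lambda>j y. s (K j) y / Q (K j)" f \<psi>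
    "\<lambda>j. 1 / real (K j)" 2
  proof
    show "integrable lborel (\<lambda>x. m x / Z)" "integrable lborel (\<lambda>y. n y / Y)" using im iN by auto
    show "0 \<le> p (K k) x / P (K k)" "0 \<le> s (K k) x / Q (K k)" "0 \<le> m x / Z" "0 \<le> n x / Y" for k x
      using p_le[of "K k" x] s_le[of "K k" x] P0[of k] m_pos[of x] n_nonneg[of x] Z Y by (auto intro: divide_nonneg_pos less_imp_le)
    show "p (K k) x / P (K k) \<le> 2 * (m x / Z)" for k x
    proof -
      have "p (K k) x / P (K k) \<le> m x / (Z / 2)"
        using p_le[of "K k" x] m_pos[of x] K(1)[of k] Z by (intro frac_le) auto
      then show ?thesis by (simp add: mult.commute)
    qed
    show "s (K k) x / Q (K k) \<le> 2 * (n x / Y)" for k x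
    proof -
      have "s (K k) x / Q (K k) \<le> n x / (Y / 2)"
        using s_le[of "K k" x] n_nonneg[of x] K(2)[of k] Y by (intro frac_le) auto
      then show ?thesis by (simp add: mult.commute)
    qed
    show "(\<lambda>k. p (K k) x / P (K k)) \<longlonglongrightarrow> m x / Z" "(\<lambda>k. s (K k) x / Q (K k)) \<longlonglongrightarrow> n x / Y" for x
      using Z Y by (auto intro!: tendsto_divide Kinf[OF plim] Kinf[OF slim] Kinf[OF Plim] Kinf[OF Qlim])
    show "(\<integral>x. p (K k) x / P (K k) \<partial>lborel) = 1" "(\<integral>x. s (K k) x / Q (K k) \<partial>lborel) = 1" for k
      using P0[of k] by (simp_all add: P_def Q_def)
    show "\<exists>c>0. \<forall>k x. norm x \<le> r \<longrightarrow> c \<le> p (K k) x / P (K k)" for r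
    proof (cases "0 \<le> r")
      case True
      obtain x0 where x0: "\<And>x. norm x \<le> r \<Longrightarrow> m x0 \<le> m x"
        using continuous_attains_inf[of "cball 0 r" m] True continuous_on_subset[OF contm, of "cball 0 r"] by force
      have "m x0 * exp (- r\<^sup>2 / 2) / Z \<le> p (K k) x / P (K k)" if x: "norm x \<le> r" for k x
      proof (rule frac_le)
        have "(norm x)\<^sup>2 / (2 * real (K k)) \<le> (norm x)\<^sup>2 / 2" using K(3)[of k] by (intro divide_left_mono) auto
        also have "\<dots> \<le> r\<^sup>2 / 2" using x by (intro divide_right_mono power_mono) auto
        finally show "m x0 * exp (- r\<^sup>2 / 2) \<le> p (K k) x"
          unfolding p_def using x0[OF x] m_pos[of x0] by (intro mult_mono) (auto intro: less_imp_le)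
      qed (use p_le[of "K k" x] P0[of k] P_le in \<open>auto intro: less_imp_le\<close>)
      then show ?thesis using m_pos[of x0] Z by (intro exI[of _ "m x0 * exp (- r\<^sup>2 / 2) / Z"]) auto
    next
      case False
      then show ?thesis by (intro exI[of _ 1]) (auto dest: order_trans[OF norm_ge_zero])
    qed
    show "0 < 1 / real (K k)" "1 / real (K k) \<le> 1" for k using K(3)[of k] by auto
    show "AE y in density lborel (\<lambda>y. ennreal (n y / Y)). \<forall>x. x \<bullet> y \<le> F x + Fs y" using young_\<nu> unfolding \<nu>_def .
    show "(\<lambda>x. m x / Z) \<in> borel_measurable borel" "(\<lambda>y. n y / Y) \<in> borel_measurable borel" "Fs \<in> borel_measurable borel"
      by measurable
    show "(\<lambda>x. p (K k) x / P (K k)) \<in> borel_measurable borel" "(\<lambda>y. s (K k) y / Q (K k)) \<in> borel_measurable borel" for k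
      by measurable
  qed (fact f DM DN elim contF)+
  obtain D :: "'a set" where D: "countable D" "\<And>X. open X \<Longrightarrow> X \<noteq> {} \<Longrightarrow> \<exists>d\<in>D. d \<in> X"
    using countable_dense_exists by metis
  obtain r g where r: "strict_mono r" and g: "\<And>x. (\<lambda>k. f (r k) x) \<longlonglongrightarrow> g x" "convex_on UNIV g"
    and clamp: "\<And>K. 0 \<le> K \<Longrightarrow> (\<integral>y. csup D K g Fs y \<partial>\<nu>) \<le> (\<integral>x. clamp1 K (F x - g x) \<partial>\<mu>)"
    using ex_limit[OF D] unfolding \<mu>_def \<nu>_def by blast
  have contg: "continuous_on UNIV g" using g(2) by (intro convex_on_continuous) auto
  \<comment> \<open>Nearly optimal couplings give approximate common subgradients of g and
    \<open>F\<close> near every point, and exact ones follow in the limit; so the limit of the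
    entropic potentials is the given potential up to a constant.\<close>
  have diff: "g x - F x = g 0 - F 0" for x
  proof (rule common_subgradient_imp_diff_constant, rule common_subgradient_limit[OF contg contF])
    fix x :: 'a and \<rho> \<delta> :: real assume "0 < \<rho>" "0 < \<delta>"
    then show "\<exists>x' y. dist x' x < \<rho> \<and> (\<forall>z. g x' + y \<bullet> (z - x') - \<delta> \<le> g z \<and> F x' + y \<bullet> (z - x') - \<delta> \<le> F z)"
      by (intro coupling_approx_common_subgradient[OF fin1 fin2 sets pos contg contF _ young_\<nu> _ D clamp])
         (use kantorovich_near_optimal[OF pot sets] in \<open>simp_all add: F_def Fs_def\<close>)
  qed
  have smoothF: "(1 - t) * F x0 + t * F x1 \<le> F ((1 - t) *\<^sub>R x0 + t *\<^sub>R x1) + t * (1 - t) * sigma_ab La Lb \<alpha>V \<beta>W (norm (x1 - x0))"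
    if t: "0 < t" "t < 1" for t x0 x1
  proof (cases "x1 = x0")
    case True
    then show ?thesis by (simp add: algebra_simps)
  next
    case False
    define R where "R = norm (x1 - x0)"
    have R: "0 < R" using False by (simp add: R_def)
    define xt where "xt = (1 - t) *\<^sub>R x0 + t *\<^sub>R x1"
    have sub: "(\<lambda>k. u (r k)) \<longlonglongrightarrow> l" if "u \<longlonglongrightarrow> l" for u :: "nat \<Rightarrow> real" and l
      using LIMSEQ_subseq_LIMSEQ[OF that r] by (simp add: o_def)
    have e0: "(\<lambda>k. 1 / real (K (r k))) \<longlonglongrightarrow> 0" by (rule sub[OF elim])
    \<comment> \<open>The distance below which nothing is known tends to 0, so at the fixed positive
      distance \<open>R\<close> smoothness holds for all large k.\<close>
    have "(\<lambda>k. 2 * (1 / real (K (r k))) * Lb) \<longlonglongrightarrow> 2 * 0 * Lb" by (intro tendsto_intros e0)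
    then have "\<forall>\<^sub>F k in sequentially. 2 * (1 / real (K (r k))) * Lb < R" using R by (intro order_tendstoD) auto
    then have ev: "\<forall>\<^sub>F k in sequentially. (1 - t) * f (r k) x0 + t * f (r k) x1
        \<le> f (r k) xt + t * (1 - t) * (sigma_ab La Lb \<alpha>V \<beta>W R + sqrt ((1 / real (K (r k))) / \<beta>W) * R\<^sup>2)"
    proof eventually_elim
      fix k assume k: "2 * (1 / real (K (r k))) * Lb < R"
      have "(1 - t) * f (r k) x0 + t * f (r k) x1 \<le> f (r k) xt + t * (1 - t) * sigma_ab La Lb (\<alpha>V + 1 / real (K (r k))) \<beta>W R"
        using smooth[OF t, of "r k" x1 x0] k by (simp add: R_def xt_def)
      also have "\<dots> \<le> f (r k) xt + t * (1 - t) * (sigma_ab La Lb \<alpha>V \<beta>W R + sqrt ((1 / real (K (r k))) / \<beta>W) * R\<^sup>2)"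
        using t L \<alpha>V_pos \<beta>W_pos R by (intro add_left_mono mult_left_mono sigma_ab_add_le) auto
      finally show "(1 - t) * f (r k) x0 + t * f (r k) x1
        \<le> f (r k) xt + t * (1 - t) * (sigma_ab La Lb \<alpha>V \<beta>W R + sqrt ((1 / real (K (r k))) / \<beta>W) * R\<^sup>2)" .
    qed
    have "(1 - t) * g x0 + t * g x1 \<le> g xt + t * (1 - t) * (sigma_ab La Lb \<alpha>V \<beta>W R + sqrt (0 / \<beta>W) * R\<^sup>2)"
    proof (rule tendsto_le[OF sequentially_bot _ _ ev])
      show "(\<lambda>k. f (r k) xt + t * (1 - t) * (sigma_ab La Lb \<alpha>V \<beta>W R + sqrt ((1 / real (K (r k))) / \<beta>W) * R\<^sup>2))
          \<longlonglongrightarrow> g xt + t * (1 - t) * (sigma_ab La Lb \<alpha>V \<beta>W R + sqrt (0 / \<beta>W) * R\<^sup>2)"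
        using \<beta>W_pos by (intro tendsto_intros g e0) auto
      show "(\<lambda>k. (1 - t) * f (r k) x0 + t * f (r k) x1) \<longlonglongrightarrow> (1 - t) * g x0 + t * g x1"
        by (intro tendsto_intros g)
    qed
    then have le: "(1 - t) * g x0 + t * g x1 \<le> g xt + t * (1 - t) * sigma_ab La Lb \<alpha>V \<beta>W R" by simp
    define c where "c = g 0 - F 0"
    have g_eq: "g z = F z + c" for z using diff[of z] unfolding c_def by linarith
    have "(1 - t) * (F x0 + c) + t * (F x1 + c) = (1 - t) * F x0 + t * F x1 + c" by (simp add: algebra_simps)
    then show ?thesis using le unfolding g_eq R_def[symmetric] xt_def[symmetric] by linarith
  qed
  have "sigma_smooth (sigma_ab La Lb \<alpha>V \<beta>W) \<phi>"
    unfolding sigma_smooth_def using smoothF by (simp add: F)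
  moreover have "norm (p - q) \<le> 4 * Lb / \<beta>W + 4 * sqrt (Lb\<^sup>2 / \<beta>W\<^sup>2 + La / \<beta>W * norm (x - y)) + sqrt (\<alpha>V / \<beta>W) * norm (x - y)"
    if p: "(F has_derivative (\<lambda>h. inner p h)) (at x)" and q: "(F has_derivative (\<lambda>h. inner q h)) (at y)" for x y p q
  proof (cases "x = y")
    case True
    have "(\<lambda>h. inner p h) = (\<lambda>h. inner q h)" using has_derivative_unique[OF p] q True by simp
    then have "p = q" by (metis inner_commute vector_eq_ldot)
    then show ?thesis using True L \<beta>W_pos by simp
  next
    case False
    define R where "R = norm (x - y)"
    have R: "0 < R" using False by (simp add: R_def)
    have "R * norm (p - q) \<le> 2 * sigma_ab La Lb \<alpha>V \<beta>W R"
      unfolding R_def by (rule smooth_convex_gradient_bound[OF cvxF smoothF p q])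
    also have "\<dots> \<le> R * (4 * Lb / \<beta>W + 4 * sqrt (Lb\<^sup>2 / \<beta>W\<^sup>2 + La / \<beta>W * R) + sqrt (\<alpha>V / \<beta>W) * R)"
      using two_sigma_ab_le[OF L _ \<beta>W_pos, of \<alpha>V R] \<alpha>V_pos R by simp
    finally show ?thesis using R by (simp add: R_def)
  qed
  ultimately show ?thesis by (simp add: F_def[symmetric])
qed

end
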